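(* Let $S=\{x\in\overline K:\ \|T_n(x)\|\le q_n^{d_n/m_n}\|m_n\| \text{ for all } n\ge1\}$. Then: (a) $\mu(S)=1$. (b) For every $y\in S$ and every Borel set $A\subset\overline K$, $\mu(A+y)=\mu(A)$. (c) For every $y\in\overline K\setminus S$, the shifted measure $A\mapsto\mu(A+y)$ and $\mu$ are mutually singular. (d) If $a\in K_n$, $a\neq0$, with $|a|_n=q_n^N$, $N\in\mathbb Z$, then the $\mu$-essential supremum of $x\mapsto|\langle a,x\rangle|_1$ over $\overline K$ equals $q_1^{-\lfloor -N/e_n\rfloor}$. (e) For every $s\in[1,\infty)$, the set $\mathcal D(\overline K)$ is dense in $L_s(\overline K,\mu)$.
   Context: Setup: $k$ is a non-Archimedean local field of characteristic $0$ with normalized absolute value $|\cdot|_1$; $k=K_1\subset K_2\subset\cdots$ are finite extensions, $K=\bigcup_nK_n$, $m_n=[K_n:k]$, $|\cdot|_n$ the normalized absolute value of $K_n$, $\|x\|=|x|_n^{1/m_n}$ for $x\in K_n$. For $n\le\nu$, $x\in K_\nu$: $T_n(x)=\frac{m_n}{m_\nu}\mathrm{Tr}_{K_\nu/K_n}(x)$; $T=T_1$. $\overline{K}$ is the set of sequences $y=(y_n)$, $y_n\in K_n$, $y_n=T_n(y_\nu)$ for $\nu>n$, with seminorms $\|y\|_n=\|y_n\|$; $T_n(y):=y_n$; $K\subset\overline K$ via $x\mapsto (T_n(x))_n$; pairing $\langle\xi,y\rangle=T(\xi T_n(y))$ for $\xi\in K_n$. $q_n$ is the residue field cardinality of $K_n$,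 $e_n$ the ramification index and $d_n$ the exponent of the different of $K_n/k$. $\chi$ is a fixed rank-zero additive character of $k$ (continuous homomorphism $(k,+)\to\{|w|=1\}$, trivial on $\{|x|_1\le1\}$, nontrivial on $\{|x|_1\le q_1\}$). $\mu$ is the unique Radon probability measure on the Borel $\sigma$-algebra of $\overline K$ with $\int_{\overline K}\chi(\langle a,x\rangle)\,d\mu(x)=\Omega(a)$ for all $a\in K$, where $\Omega(a)=1$ if $\|a\|\le1$ and $0$ otherwise. $\mathcal D(K_n)$ is the space of locally constant compactly supported complex functions on $K_n$, and $\mathcal D(\overline K)$ is the set of functions $f(x)=\varphi(T_n(x))$ on $\overline K$ with $n\ge1$ and $\varphi\in\mathcal D(K_n)$. $\lfloor\cdot\rfloor$ is the integer part. *)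

theory Defs
  imports "HOL-Probability.Probability"
begin

definition is_subfield :: "'a::field set \<Rightarrow> bool" where
  "is_subfield F \<longleftrightarrow> 0 \<in> F \<and> 1 \<in> F \<and>
     (\<forall>x\<in>F. \<forall>y\<in>F. x + y \<in> F \<and> x - y \<in> F \<and> x * y \<in> F) \<and> (\<forall>x\<in>F. inverse x \<in> F)"

definition is_absval :: "'a::field set \<Rightarrow> ('a \<Rightarrow> real) \<Rightarrow> bool" where
  "is_absval F f \<longleftrightarrow> (\<forall>x\<in>F. f x \<ge> 0 \<and> (f x = 0 \<longleftrightarrow> x = 0)) \<and>
     (\<forall>x\<in>F. \<forall>y\<in>F. f (x * y) = f x * f y \<and> f (x + y) \<le> f x + f y)"

definition residue_classes :: "'a::field set \<Rightarrow> ('a \<Rightarrow> real) \<Rightarrow> 'a set set" where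
  "residue_classes F f = (\<lambda>x. {y\<in>F. f y \<le> 1 \<and> f (y - x) < 1}) ` {x\<in>F. f x \<le> 1}"

definition residue_card :: "'a::field set \<Rightarrow> ('a \<Rightarrow> real) \<Rightarrow> nat" where
  "residue_card F f = card (residue_classes F f)"

definition nonarch_local_field :: "'a::field set \<Rightarrow> ('a \<Rightarrow> real) \<Rightarrow> bool" where
  "nonarch_local_field k f \<longleftrightarrow> is_subfield k \<and> is_absval k f \<and>
     (\<forall>x\<in>k. \<forall>y\<in>k. f (x + y) \<le> max (f x) (f y)) \<and>
     (\<exists>p\<in>k. 0 < f p \<and> f p < 1 \<and> (\<forall>x\<in>k. x \<noteq> 0 \<longrightarrow> (\<exists>j::int. f x = f p powr real_of_int j))) \<and>
     (\<forall>s::nat \<Rightarrow> 'a. (\<forall>i. s i \<in> k) \<longrightarrow> (\<forall>\<epsilon>>0. \<exists>N. \<forall>i\<ge>N. \<forall>j\<ge>N. f (s i - s j) < \<epsilon>) \<longrightarrow>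
          (\<exists>l\<in>k. \<forall>\<epsilon>>0. \<exists>N. \<forall>i\<ge>N. f (s i - l) < \<epsilon>)) \<and>
     finite (residue_classes k f)"

definition normalized_absval :: "'a::field set \<Rightarrow> ('a \<Rightarrow> real) \<Rightarrow> bool" where
  "normalized_absval k f \<longleftrightarrow> (\<exists>p\<in>k. f p = 1 / real (residue_card k f) \<and>
      (\<forall>x\<in>k. x \<noteq> 0 \<longrightarrow> (\<exists>j::int. f x = f p powr real_of_int j)))"

definition lincomb_set :: "'a::field set \<Rightarrow> 'a set \<Rightarrow> 'a set" where
  "lincomb_set F B = {\<Sum>b\<in>B. c b * b | c. \<forall>b\<in>B. c b \<in> F}"

definition is_basis :: "'a::field set \<Rightarrow> 'a set \<Rightarrow> 'a set \<Rightarrow> bool" where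
  "is_basis F E B \<longleftrightarrow> finite B \<and> B \<subseteq> E \<and> E = lincomb_set F B \<and>
     (\<forall>c. (\<forall>b\<in>B. c b \<in> F) \<longrightarrow> (\<Sum>b\<in>B. c b * b) = 0 \<longrightarrow> (\<forall>b\<in>B. c b = 0))"

definition ext_degree :: "'a::field set \<Rightarrow> 'a set \<Rightarrow> nat" where
  "ext_degree F E = card (SOME B. is_basis F E B)"

definition coord :: "'a::field set \<Rightarrow> 'a set \<Rightarrow> 'a \<Rightarrow> 'a \<Rightarrow> 'a" where
  "coord F B v = (THE c. (\<forall>b\<in>B. c b \<in> F) \<and> (\<forall>b. b \<notin> B \<longrightarrow> c b = 0) \<and> v = (\<Sum>b\<in>B. c b * b))"

definition rel_trace :: "'a::field set \<Rightarrow> 'a set \<Rightarrow> 'a \<Rightarrow> 'a" where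
  "rel_trace F E x = (let B = (SOME B. is_basis F E B) in \<Sum>b\<in>B. coord F B (x * b) b)"

definition Kunion :: "(nat \<Rightarrow> 'a set) \<Rightarrow> 'a set" where
  "Kunion K = (\<Union>n\<in>{1..}. K n)"

definition tower_setup :: "('a::field_char_0 \<Rightarrow> real) \<Rightarrow> (nat \<Rightarrow> 'a set) \<Rightarrow> bool" where
  "tower_setup abs1 K \<longleftrightarrow> nonarch_local_field (K 1) abs1 \<and> normalized_absval (K 1) abs1 \<and>
     (\<forall>n\<ge>1. is_subfield (K n) \<and> K n \<subseteq> K (Suc n) \<and> (\<exists>B. is_basis (K 1) (K n) B))"

definition mdeg :: "(nat \<Rightarrow> 'a::field set) \<Rightarrow> nat \<Rightarrow> nat" where
  "mdeg K n = ext_degree (K 1) (K n)"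

text \<open>The unique absolute value on K extending |.|_1 (this is \<parallel>x\<parallel> = |x|_n^(1/m_n)).\<close>
definition nrm :: "('a::field \<Rightarrow> real) \<Rightarrow> (nat \<Rightarrow> 'a set) \<Rightarrow> 'a \<Rightarrow> real" where
  "nrm abs1 K = (THE g. is_absval (Kunion K) g \<and> (\<forall>x\<in>K 1. g x = abs1 x) \<and>
                        (\<forall>x. x \<notin> Kunion K \<longrightarrow> g x = 0))"

definition absn :: "('a::field \<Rightarrow> real) \<Rightarrow> (nat \<Rightarrow> 'a set) \<Rightarrow> nat \<Rightarrow> 'a \<Rightarrow> real" where
  "absn abs1 K n x = nrm abs1 K x ^ mdeg K n"

definition qres :: "('a::field \<Rightarrow> real) \<Rightarrow> (nat \<Rightarrow> 'a set) \<Rightarrow> nat \<Rightarrow> nat" where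
  "qres abs1 K n = residue_card (K n) (nrm abs1 K)"

text \<open>e_n: ramification index = index of the value group of k in that of K_n\<close>
definition ram :: "('a::field \<Rightarrow> real) \<Rightarrow> (nat \<Rightarrow> 'a set) \<Rightarrow> nat \<Rightarrow> nat" where
  "ram abs1 K n = card ((\<lambda>r. (\<lambda>s. r * s) ` (abs1 ` (K 1 - {0}))) ` (nrm abs1 K ` (K n - {0})))"

definition unif_abs :: "('a::field \<Rightarrow> real) \<Rightarrow> (nat \<Rightarrow> 'a set) \<Rightarrow> nat \<Rightarrow> real" where
  "unif_abs abs1 K n = Sup {r. \<exists>x\<in>K n. r = nrm abs1 K x \<and> 0 < r \<and> r < 1}"

definition inv_different :: "('a::field \<Rightarrow> real) \<Rightarrow> (nat \<Rightarrow> 'a set) \<Rightarrow> nat \<Rightarrow> 'a set" where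
  "inv_different abs1 K n = {x\<in>K n. \<forall>y\<in>K n. nrm abs1 K y \<le> 1 \<longrightarrow>
       abs1 (rel_trace (K 1) (K n) (x * y)) \<le> 1}"

definition different :: "('a::field \<Rightarrow> real) \<Rightarrow> (nat \<Rightarrow> 'a set) \<Rightarrow> nat \<Rightarrow> 'a set" where
  "different abs1 K n = {x\<in>K n. \<forall>y\<in>inv_different abs1 K n. nrm abs1 K (x * y) \<le> 1}"

definition diff_exp :: "('a::field \<Rightarrow> real) \<Rightarrow> (nat \<Rightarrow> 'a set) \<Rightarrow> nat \<Rightarrow> nat" where
  "diff_exp abs1 K n = (THE d. different abs1 K n = {x\<in>K n. nrm abs1 K x \<le> unif_abs abs1 K n ^ d})"

definition Tn_rel :: "(nat \<Rightarrow> 'a::field_char_0 set) \<Rightarrow> nat \<Rightarrow> nat \<Rightarrow> 'a \<Rightarrow> 'a" where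
  "Tn_rel K n \<nu> x = of_nat (mdeg K n) / of_nat (mdeg K \<nu>) * rel_trace (K n) (K \<nu>) x"

text \<open>\<overline>K: compatible sequences (index 0 unused, set to 0)\<close>
definition KBar :: "(nat \<Rightarrow> 'a::field_char_0 set) \<Rightarrow> (nat \<Rightarrow> 'a) set" where
  "KBar K = {y. y 0 = 0 \<and> (\<forall>n\<ge>1. y n \<in> K n) \<and>
      (\<forall>n \<nu>. 1 \<le> n \<longrightarrow> n < \<nu> \<longrightarrow> y n = Tn_rel K n \<nu> (y \<nu>))}"

definition KBar_top :: "('a::field_char_0 \<Rightarrow> real) \<Rightarrow> (nat \<Rightarrow> 'a set) \<Rightarrow> (nat \<Rightarrow> 'a) topology" where
  "KBar_top abs1 K = topology (\<lambda>U. U \<subseteq> KBar K \<and> (\<forall>y\<in>U. \<exists>n \<epsilon>. \<epsilon> > 0 \<and>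
      {z\<in>KBar K. \<forall>j\<in>{1..n}. nrm abs1 K (z j - y j) < \<epsilon>} \<subseteq> U))"

text \<open>pairing \<langle>\<xi>, y\<rangle> = T(\<xi> T_n(y)) with \<xi> \<in> K_n\<close>
definition pairing :: "(nat \<Rightarrow> 'a::field_char_0 set) \<Rightarrow> 'a \<Rightarrow> (nat \<Rightarrow> 'a) \<Rightarrow> 'a" where
  "pairing K \<xi> y = (let n = (LEAST n. 1 \<le> n \<and> \<xi> \<in> K n) in Tn_rel K 1 n (\<xi> * y n))"

definition Omega :: "('a::field \<Rightarrow> real) \<Rightarrow> (nat \<Rightarrow> 'a set) \<Rightarrow> 'a \<Rightarrow> complex" where
  "Omega abs1 K a = (if nrm abs1 K a \<le> 1 then 1 else 0)"

definition rank0_char :: "('a::field \<Rightarrow> real) \<Rightarrow> 'a set \<Rightarrow> nat \<Rightarrow> ('a \<Rightarrow> complex) \<Rightarrow> bool" where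
  "rank0_char abs1 k q1 chr \<longleftrightarrow>
     (\<forall>x\<in>k. \<forall>y\<in>k. chr (x + y) = chr x * chr y) \<and> (\<forall>x\<in>k. cmod (chr x) = 1) \<and>
     (\<forall>x\<in>k. \<forall>\<epsilon>>0. \<exists>\<delta>>0. \<forall>y\<in>k. abs1 (y - x) < \<delta> \<longrightarrow> cmod (chr y - chr x) < \<epsilon>) \<and>
     (\<forall>x\<in>k. abs1 x \<le> 1 \<longrightarrow> chr x = 1) \<and>
     (\<exists>x\<in>k. abs1 x \<le> real q1 \<and> chr x \<noteq> 1)"

definition radon_on :: "'b topology \<Rightarrow> 'b measure \<Rightarrow> bool" where
  "radon_on T M \<longleftrightarrow> (\<forall>A\<in>sets M. emeasure M A = (SUP C\<in>{C. compactin T C \<and> C \<subseteq> A}. emeasure M C))"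

definition Kn_top :: "('a::field \<Rightarrow> real) \<Rightarrow> (nat \<Rightarrow> 'a set) \<Rightarrow> nat \<Rightarrow> 'a topology" where
  "Kn_top abs1 K n = topology (\<lambda>U. U \<subseteq> K n \<and>
      (\<forall>x\<in>U. \<exists>r>0. \<forall>y\<in>K n. nrm abs1 K (y - x) < r \<longrightarrow> y \<in> U))"

definition DK :: "('a::field \<Rightarrow> real) \<Rightarrow> (nat \<Rightarrow> 'a set) \<Rightarrow> nat \<Rightarrow> ('a \<Rightarrow> complex) set" where
  "DK abs1 K n = {\<phi>. (\<forall>x\<in>K n. \<exists>U. openin (Kn_top abs1 K n) U \<and> x \<in> U \<and> (\<forall>y\<in>U. \<phi> y = \<phi> x)) \<and>
      compactin (Kn_top abs1 K n) ((Kn_top abs1 K n) closure_of {x\<in>K n. \<phi> x \<noteq> 0})}"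

definition DKBar :: "('a::field_char_0 \<Rightarrow> real) \<Rightarrow> (nat \<Rightarrow> 'a set) \<Rightarrow> ((nat \<Rightarrow> 'a) \<Rightarrow> complex) set" where
  "DKBar abs1 K = {f. \<exists>n\<ge>1. \<exists>\<phi>\<in>DK abs1 K n. \<forall>x\<in>KBar K. f x = \<phi> (x n)}"

definition Sset :: "('a::field_char_0 \<Rightarrow> real) \<Rightarrow> (nat \<Rightarrow> 'a set) \<Rightarrow> (nat \<Rightarrow> 'a) set" where
  "Sset abs1 K = {x\<in>KBar K. \<forall>n\<ge>1. nrm abs1 K (x n) \<le>
      real (qres abs1 K n) powr (real (diff_exp abs1 K n) / real (mdeg K n)) * nrm abs1 K (of_nat (mdeg K n))}"

definition shift :: "(nat \<Rightarrow> 'a::plus) \<Rightarrow> (nat \<Rightarrow> 'a) set \<Rightarrow> (nat \<Rightarrow> 'a) set" where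
  "shift y A = (\<lambda>x. \<lambda>n. x n + y n) ` A"

end

theory Submission
  imports Defs
begin

text \<open>
  The absolute value of \<open>k\<close> extends to a finite extension \<open>E\<close> because a minimal submultiplicative
  ultrametric seminorm on \<open>E\<close> is multiplicative.  Lifts of a residue basis times powers of a uniformizer
  form an orthogonal \<open>k\<close>-basis of \<open>E\<close>; this gives \<open>m = e f\<close>, completeness, uniqueness of the extension and
  \<open>|Tr x| \<le> |x|\<close> at once.

  In these terms the bound defining \<open>S\<close> says that \<open>T_n(x)\<close> lies in the dual, under
  \<open>(a, z) \<mapsto> T(a z)\<close>, of the ring of integers of \<open>K_n\<close>.  Since \<open>\<chi>\<close> has rank zero, this is equivalent to
  \<open>\<chi>(T(a T_n(x))) = 1\<close> for all integral \<open>a\<close>, and the Fourier transform of \<open>\<mu>\<close> forces this almost everywhere;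
  countably many \<open>a\<close> suffice by density.  The remaining parts follow: \<open>S\<close> is a group, so translates
  by elements outside \<open>S\<close> are disjoint from it; averaging characters over \<open>t O/O\<close> computes the measure of
  the balls \<open>{x. \<parallel>T_n(x) - c\<parallel> \<le> r}\<close>, which are therefore invariant under \<open>S\<close>; and suitable balls of this kind
  form a countable \<open>\<pi>\<close>-system generating the Borel sets, which gives invariance and density.
\<close>

section \<open>Linear algebra over subfields\<close>

text \<open>All fields are subsets of one ambient type, and the norm is a definite description over
  every absolute value on the union that extends the given one. Hence existence and uniqueness are
  both part of the proof, and competing absolute values are not known to be ultrametric; boundedness
  on the integers restores that. Starting from a seminorm avoids irreducible polynomials and
  Hensel's lemma: the matrix entries of multiplication give a submultiplicative seminorm at once.

  The measure is accessible only through its Fourier transform. A ball can be measured when it is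
  itself a dual, namely of \<open>t O\<close> with \<open>|t|\<close> a power of \<open>q\<close>:
  the characters indexed by \<open>t O / O\<close> then average to its indicator, up to a null set.
  Moving the centre to \<open>c\<close> multiplies the term of index \<open>a\<close> by the inverse
  of the phase \<open>chr (T (a c))\<close>, which is 1 for integral \<open>a\<close>, the only ones
  whose Fourier coefficient survives. So the measure does not see the centre as long as
  \<open>c\<close> stays in the dual of \<open>O\<close>. This dictates the radii
  \<open>kap n / q^j\<close> of the generating balls.\<close>

lemma subfield_closed:
  assumes "is_subfield F"
  shows "0 \<in> F" "1 \<in> F" "\<And>x y. x \<in> F \<Longrightarrow> y \<in> F \<Longrightarrow> x + y \<in> F"
    "\<And>x y. x \<in> F \<Longrightarrow> y \<in> F \<Longrightarrow> x - y \<in> F" "\<And>x y. x \<in> F \<Longrightarrow> y \<in> F \<Longrightarrow> x * y \<in> F"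
    "\<And>x. x \<in> F \<Longrightarrow> inverse x \<in> F" "\<And>x. x \<in> F \<Longrightarrow> - x \<in> F"
    "\<And>x y. x \<in> F \<Longrightarrow> y \<in> F \<Longrightarrow> x / y \<in> F"
    "\<And>x n. x \<in> F \<Longrightarrow> x ^ n \<in> F" "\<And>n. of_nat n \<in> F"
    "\<And>x j. x \<in> F \<Longrightarrow> x powi j \<in> F"
proof -
  show 0: "0 \<in> F" and 1: "1 \<in> F"
    and a: "\<And>x y. x \<in> F \<Longrightarrow> y \<in> F \<Longrightarrow> x + y \<in> F"
    and d: "\<And>x y. x \<in> F \<Longrightarrow> y \<in> F \<Longrightarrow> x - y \<in> F"
    and m: "\<And>x y. x \<in> F \<Longrightarrow> y \<in> F \<Longrightarrow> x * y \<in> F"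
    and i: "\<And>x. x \<in> F \<Longrightarrow> inverse x \<in> F"
    using assms by (auto simp: is_subfield_def)
  show "- x \<in> F" if "x \<in> F" for x using d[OF 0 that] by simp
  show "x / y \<in> F" if "x \<in> F" "y \<in> F" for x y
    using m[OF that(1) i[OF that(2)]] by (simp add: divide_inverse)
  show p: "x ^ n \<in> F" if "x \<in> F" for x n using that by (induction n) (auto simp: 1 m)
  show "of_nat n \<in> F" for n by (induction n) (auto simp: 0 1 a)
  show "x powi j \<in> F" if "x \<in> F" for x j using that by (auto simp: power_int_def p i)
qed

lemma subfield_sum:
  assumes "is_subfield F" "\<And>i. i \<in> I \<Longrightarrow> h i \<in> F"
  shows "sum h I \<in> F"
  using assms(2) by (induction I rule: infinite_finite_induct) (auto simp: subfield_closed[OF assms(1)])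

text \<open>Gaussian elimination, by induction on the equations \<open>A\<close>. An equation with
  no nonzero coefficient is dropped; otherwise a pivot unknown is eliminated, which costs one
  equation and one unknown and so preserves the strict inequality.\<close>

lemma homogeneous_system_solvable:
  fixes F :: "'a::field set"
  assumes F: "is_subfield F" and "finite A" "finite J" "card A < card J"
    and "\<And>j a. j \<in> J \<Longrightarrow> a \<in> A \<Longrightarrow> c j a \<in> F"
  shows "\<exists>d. (\<forall>j\<in>J. d j \<in> F) \<and> (\<exists>j\<in>J. d j \<noteq> 0) \<and> (\<forall>a\<in>A. (\<Sum>j\<in>J. d j * c j a) = 0)"
  using assms(2-)
proof (induction A arbitrary: J c rule: finite_induct)
  case empty
  then have "J \<noteq> {}" by auto
  then show ?case by (intro exI[of _ "\<lambda>_. 1"]) (auto simp: subfield_closed[OF F])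
next
  case (insert a A)
  show ?case
  proof (cases "\<forall>j\<in>J. c j a = 0")
    case True
    have "card A < card J" using insert by simp
    then have "\<exists>d. (\<forall>j\<in>J. d j \<in> F) \<and> (\<exists>j\<in>J. d j \<noteq> 0) \<and> (\<forall>b\<in>A. (\<Sum>j\<in>J. d j * c j b) = 0)"
      using insert.prems by (intro insert.IH) auto
    then obtain d where "(\<forall>j\<in>J. d j \<in> F)" "(\<exists>j\<in>J. d j \<noteq> 0)" "(\<forall>a\<in>A. (\<Sum>j\<in>J. d j * c j a) = 0)"
      by (elim exE conjE)
    then show ?thesis using True by (intro exI[of _ d]) auto
  next
    case False
    then obtain j0 where j0: "j0 \<in> J" "c j0 a \<noteq> 0" by auto
    define J' where "J' = J - {j0}"
    define c' where "c' = (\<lambda>j b. c j b - c j a / c j0 a * c j0 b)"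
    have "finite J'" "card A < card J'" using insert j0 by (auto simp: J'_def)
    moreover have "\<And>j b. j \<in> J' \<Longrightarrow> b \<in> A \<Longrightarrow> c' j b \<in> F"
      using insert.prems j0 subfield_closed(4,5,8)[OF F] by (simp add: c'_def J'_def)
    ultimately have "\<exists>d. (\<forall>j\<in>J'. d j \<in> F) \<and> (\<exists>j\<in>J'. d j \<noteq> 0) \<and> (\<forall>b\<in>A. (\<Sum>j\<in>J'. d j * c' j b) = 0)"
      by (rule insert.IH)
    then obtain d where d: "(\<forall>j\<in>J'. d j \<in> F)" "(\<exists>j\<in>J'. d j \<noteq> 0)"
        "(\<forall>b\<in>A. (\<Sum>j\<in>J'. d j * c' j b) = 0)"
      by (elim exE conjE)
    \<comment> \<open>The eliminated unknown \<open>j0\<close> gets the value that equation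
      \<open>a\<close> forces on it.\<close>
    define e where "e = d(j0 := - (\<Sum>j\<in>J'. d j * c j a) / c j0 a)"
    have J: "J = insert j0 J'" "j0 \<notin> J'" using j0 by (auto simp: J'_def)
    have eF: "\<forall>j\<in>J. e j \<in> F"
      using d(1) j0 insert.prems unfolding J e_def
      by (auto intro!: subfield_closed[OF F] subfield_sum[OF F])
    have nz: "\<exists>j\<in>J. e j \<noteq> 0" using d(2) J by (auto simp: e_def)
    have sumJ: "(\<Sum>j\<in>J. e j * c j b) = e j0 * c j0 b + (\<Sum>j\<in>J'. d j * c j b)" for b
    proof -
      have "(\<Sum>j\<in>J'. e j * c j b) = (\<Sum>j\<in>J'. d j * c j b)"
        by (rule sum.cong) (use J in \<open>auto simp: e_def\<close>)
      then show ?thesis using \<open>finite J'\<close> J(2) unfolding J(1) by simp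
    qed
    have "(\<Sum>j\<in>J. e j * c j b) = 0" if "b \<in> insert a A" for b
    proof (cases "b = a")
      case True
      then show ?thesis using j0 by (simp add: sumJ) (simp add: e_def)
    next
      case False
      then have b: "b \<in> A" using that by simp
      have "(\<Sum>j\<in>J'. d j * c' j b) = (\<Sum>j\<in>J'. d j * c j b) - (\<Sum>j\<in>J'. d j * c j a) / c j0 a * c j0 b"
        by (simp add: c'_def algebra_simps sum_subtractf sum_distrib_left sum_distrib_right sum_divide_distrib)
      then show ?thesis using d(3) b by (simp add: sumJ) (simp add: e_def)
    qed
    then show ?thesis using eF nz by blast
  qed
qed

text \<open>The independence half of \<open>is_basis\<close>, kept apart because orthogonal families
  are known to be independent long before they are known to span.\<close>

definition indep :: "'a::field set \<Rightarrow> 'a set \<Rightarrow> bool" where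
  "indep F B \<longleftrightarrow> finite B \<and> (\<forall>c. (\<forall>b\<in>B. c b \<in> F) \<longrightarrow> (\<Sum>b\<in>B. c b * b) = 0 \<longrightarrow> (\<forall>b\<in>B. c b = 0))"

lemma lincomb_setI: "v = (\<Sum>b\<in>B. c b * b) \<Longrightarrow> (\<And>b. b \<in> B \<Longrightarrow> c b \<in> F) \<Longrightarrow> v \<in> lincomb_set F B"
  by (auto simp: lincomb_set_def)

lemma lincomb_subset:
  assumes "is_subfield L" "F \<subseteq> L" "A \<subseteq> L"
  shows "lincomb_set F A \<subseteq> L"
proof
  fix x assume "x \<in> lincomb_set F A"
  then obtain c where c: "x = (\<Sum>b\<in>A. c b * b)" "\<forall>b\<in>A. c b \<in> F" by (auto simp: lincomb_set_def)
  show "x \<in> L" unfolding c(1)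
    by (rule subfield_sum[OF assms(1)], rule subfield_closed(5)[OF assms(1)]) (use c assms in auto)
qed

text \<open>Steinitz bound: with more vectors than generators, the homogeneous system of their
  coefficients has a nontrivial solution, which is a relation between the vectors. Besides making
  the degree well defined, it bounds every orthogonal family in an extension and thereby supplies
  the finiteness behind uniformizers and residue bases.\<close>

lemma indep_card_le:
  assumes F: "is_subfield F" and A: "finite A" and B: "indep F B" "B \<subseteq> lincomb_set F A"
  shows "card B \<le> card A"
proof (rule ccontr)
  assume "\<not> ?thesis"
  then have lt: "card A < card B" by simp
  have "\<forall>b\<in>B. \<exists>c. (\<forall>a\<in>A. c a \<in> F) \<and> b = (\<Sum>a\<in>A. c a * a)"
    using B(2) by (auto simp: lincomb_set_def)
  then obtain c where c: "\<And>b. b \<in> B \<Longrightarrow> (\<forall>a\<in>A. c b a \<in> F) \<and> b = (\<Sum>a\<in>A. c b a * a)"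
    by metis
  obtain d where d: "\<forall>j\<in>B. d j \<in> F" "\<exists>j\<in>B. d j \<noteq> 0" "\<forall>a\<in>A. (\<Sum>j\<in>B. d j * c j a) = 0"
    using homogeneous_system_solvable[OF F A _ lt, of c] B(1) c by (auto simp: indep_def)
  have "(\<Sum>b\<in>B. d b * b) = (\<Sum>b\<in>B. d b * (\<Sum>a\<in>A. c b a * a))"
    by (rule sum.cong) (use c in auto)
  also have "\<dots> = (\<Sum>a\<in>A. (\<Sum>b\<in>B. d b * c b a) * a)"
    by (simp add: sum_distrib_left sum_distrib_right mult.assoc) (rule sum.swap)
  also have "\<dots> = 0" using d(3) by simp
  finally show False using d B(1) by (auto simp: indep_def)
qed

section \<open>Degrees and coordinates with respect to a basis\<close>

lemma is_basis_alt: "is_basis F E B \<longleftrightarrow> indep F B \<and> B \<subseteq> E \<and> E = lincomb_set F B"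
  by (auto simp: is_basis_def indep_def)

lemma is_basis_card_eq:
  assumes "is_subfield F" "is_basis F E B" "is_basis F E C"
  shows "card B = card C"
  using indep_card_le[OF assms(1), of B C] indep_card_le[OF assms(1), of C B] assms(2,3)
  by (auto simp: is_basis_alt indep_def)

lemma ext_degree_eq:
  assumes "is_subfield F" "is_basis F E B"
  shows "ext_degree F E = card B"
  unfolding ext_degree_def
  by (rule is_basis_card_eq[OF assms(1) someI[of "is_basis F E", OF assms(2)] assms(2)])

lemma coord_props:
  assumes F: "is_subfield F" and B: "is_basis F E B" and v: "v \<in> E"
  shows coord_in: "coord F B v b \<in> F" and coord_outside: "b \<notin> B \<Longrightarrow> coord F B v b = 0"
    and coord_sum: "v = (\<Sum>b\<in>B. coord F B v b * b)"
proof -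
  let ?P = "\<lambda>c. (\<forall>b\<in>B. c b \<in> F) \<and> (\<forall>b. b \<notin> B \<longrightarrow> c b = 0) \<and> v = (\<Sum>b\<in>B. c b * b)"
  obtain c where c: "\<forall>b\<in>B. c b \<in> F" "v = (\<Sum>b\<in>B. c b * b)"
    using B v by (auto simp: is_basis_def lincomb_set_def)
  \<comment> \<open>The description in \<open>coord\<close> also prescribes the value 0 outside
    \<open>B\<close>; this makes the coefficient function unique as a total function.\<close>
  let ?c = "\<lambda>b. if b \<in> B then c b else 0"
  have "?P ?c" using c by (auto intro: sum.cong)
  moreover have "c1 = ?c" if "?P c1" for c1
  proof -
    have "(\<Sum>b\<in>B. (c1 b - c b) * b) = 0" using that c by (simp add: algebra_simps sum_subtractf)
    moreover have "\<forall>b\<in>B. c1 b - c b \<in> F" using that c subfield_closed(4)[OF F] by blast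
    ultimately have "\<forall>b\<in>B. c1 b - c b = 0"
      using B by (auto simp: is_basis_def dest!: spec[of _ "\<lambda>b. c1 b - c b"])
    then show ?thesis using that by auto
  qed
  ultimately have "?P (coord F B v)" unfolding coord_def by (rule theI)
  then show "b \<notin> B \<Longrightarrow> coord F B v b = 0" "v = (\<Sum>b\<in>B. coord F B v b * b)"
    by blast+
  from \<open>?P (coord F B v)\<close> show "coord F B v b \<in> F"
    using subfield_closed(1)[OF F] by metis
qed

lemma coord_unique:
  assumes F: "is_subfield F" and B: "is_basis F E B"
    and c: "\<And>b. b \<in> B \<Longrightarrow> c b \<in> F" "v = (\<Sum>b\<in>B. c b * b)" and b: "b \<in> B"
  shows "coord F B v b = c b"
proof -
  have v: "v \<in> E" using B c by (auto simp: is_basis_def lincomb_set_def)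
  have "(\<Sum>b\<in>B. (coord F B v b - c b) * b) = 0"
    using coord_sum[OF F B v] c(2) by (simp add: algebra_simps sum_subtractf)
  moreover have "\<forall>b\<in>B. coord F B v b - c b \<in> F"
    using c coord_in[OF F B v] subfield_closed(4)[OF F] by blast
  ultimately have "\<forall>b\<in>B. coord F B v b - c b = 0"
    using B by (auto simp: is_basis_def dest!: spec[of _ "\<lambda>b. coord F B v b - c b"])
  then show ?thesis using b by simp
qed

lemma coord_linear:
  assumes F: "is_subfield F" and B: "is_basis F E B" and b: "b \<in> B"
    and I: "finite I" "\<And>i. i \<in> I \<Longrightarrow> a i \<in> F" "\<And>i. i \<in> I \<Longrightarrow> v i \<in> E"
  shows "coord F B (\<Sum>i\<in>I. a i * v i) b = (\<Sum>i\<in>I. a i * coord F B (v i) b)"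
proof (rule coord_unique[OF F B _ _ b])
  show "(\<Sum>i\<in>I. a i * coord F B (v i) b) \<in> F" for b
    using I coord_in[OF F B] by (auto intro!: subfield_sum[OF F] subfield_closed[OF F])
  have "(\<Sum>i\<in>I. a i * v i) = (\<Sum>i\<in>I. a i * (\<Sum>b\<in>B. coord F B (v i) b * b))"
    using I coord_sum[OF F B] by (intro sum.cong) auto
  then show "(\<Sum>i\<in>I. a i * v i) = (\<Sum>b\<in>B. (\<Sum>i\<in>I. a i * coord F B (v i) b) * b)"
    by (simp add: sum_distrib_left sum_distrib_right mult.assoc) (rule sum.swap)
qed

lemma coord_add:
  assumes F: "is_subfield F" and B: "is_basis F E B" and b: "b \<in> B" and "x \<in> E" "y \<in> E"
  shows "coord F B (x + y) b = coord F B x b + coord F B y b"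
proof -
  have "coord F B (\<Sum>i\<in>{True,False}. 1 * (if i then x else y)) b
     = (\<Sum>i\<in>{True,False}. 1 * coord F B (if i then x else y) b)"
    by (rule coord_linear[OF F B b]) (use assms subfield_closed[OF F] in auto)
  then show ?thesis by simp
qed

lemma coord_scale:
  assumes F: "is_subfield F" and B: "is_basis F E B" and b: "b \<in> B" and "a \<in> F" "x \<in> E"
  shows "coord F B (a * x) b = a * coord F B x b"
  using coord_linear[OF F B b, of "{()}" "\<lambda>_. a" "\<lambda>_. x"] assms by simp

lemma coord_basis_element:
  assumes F: "is_subfield F" and B: "is_basis F E B" and b: "b \<in> B" "b' \<in> B"
  shows "coord F B b' b = (if b = b' then 1 else 0)"
proof (rule coord_unique[OF F B _ _ b(1)])
  have "finite B" using B by (simp add: is_basis_def)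
  then show "b' = (\<Sum>b\<in>B. (if b = b' then 1 else 0) * b)"
    using b by (simp add: if_distrib[of "\<lambda>t. t * _"] cong: if_cong)
qed (use subfield_closed[OF F] in auto)

section \<open>The trace\<close>

text \<open>Basis independence of the trace: expand in a second basis and use that the two
  change-of-basis matrices are inverse to each other (fact \<open>2\<close>). Since
  \<open>rel_trace\<close> hides an arbitrary choice of basis, this is what allows each later
  computation to use the basis that suits it.\<close>

lemma rel_trace_eq:
  assumes F: "is_subfield F" and E: "is_subfield E" and B: "is_basis F E B" and x: "x \<in> E"
  shows "rel_trace F E x = (\<Sum>b\<in>B. coord F B (x * b) b)"
proof -
  define C where "C = (SOME B. is_basis F E B)"
  have C: "is_basis F E C" unfolding C_def by (rule someI[of "is_basis F E", OF B])
  have fin: "finite B" "finite C" and sub: "B \<subseteq> E" "C \<subseteq> E" using B C by (auto simp: is_basis_def)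
  have mulE: "\<And>u v. u \<in> E \<Longrightarrow> v \<in> E \<Longrightarrow> u * v \<in> E" by (rule subfield_closed(5)[OF E])
  have 1: "coord F B (x * b) b
      = (\<Sum>c\<in>C. \<Sum>c'\<in>C. coord F C b c * coord F C (x * c) c' * coord F B c' b)" if b: "b \<in> B" for b
  proof -
    have bE: "b \<in> E" using b sub by auto
    have "x * b = x * (\<Sum>c\<in>C. coord F C b c * c)" using coord_sum[OF F C bE] by simp
    then have eq: "x * b = (\<Sum>c\<in>C. coord F C b c * (x * c))"
      by (simp add: sum_distrib_left algebra_simps)
    have "coord F B (x * b) b = (\<Sum>c\<in>C. coord F C b c * coord F B (x * c) b)"
      unfolding eq using coord_in[OF F C bE] sub x mulE
      by (intro coord_linear[OF F B b fin(2)]) auto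
    also have "\<dots> = (\<Sum>c\<in>C. coord F C b c * (\<Sum>c'\<in>C. coord F C (x * c) c' * coord F B c' b))"
    proof (intro sum.cong refl arg_cong2[of _ _ _ _ times])
      fix c assume c: "c \<in> C"
      have xc: "x * c \<in> E" using c sub x mulE by auto
      have "coord F B (x * c) b = coord F B (\<Sum>c'\<in>C. coord F C (x * c) c' * c') b"
        using coord_sum[OF F C xc] by simp
      also have "\<dots> = (\<Sum>c'\<in>C. coord F C (x * c) c' * coord F B c' b)"
        using coord_in[OF F C xc] sub by (intro coord_linear[OF F B b fin(2)]) auto
      finally show "coord F B (x * c) b = \<dots>" .
    qed
    finally show ?thesis by (simp add: sum_distrib_left mult.assoc)
  qed
  have 2: "(\<Sum>b\<in>B. coord F C b c * coord F B c' b) = (if c = c' then 1 else 0)"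
    if c: "c \<in> C" "c' \<in> C" for c c'
  proof -
    have c'E: "c' \<in> E" using c sub by auto
    have "coord F C c' c = coord F C (\<Sum>b\<in>B. coord F B c' b * b) c"
      using coord_sum[OF F B c'E] by simp
    also have "\<dots> = (\<Sum>b\<in>B. coord F B c' b * coord F C b c)"
      using coord_in[OF F B c'E] sub by (intro coord_linear[OF F C c(1) fin(1)]) auto
    finally show ?thesis using coord_basis_element[OF F C c] by (simp add: mult.commute)
  qed
  have "(\<Sum>b\<in>B. coord F B (x * b) b)
      = (\<Sum>b\<in>B. \<Sum>c\<in>C. \<Sum>c'\<in>C. coord F C b c * coord F C (x * c) c' * coord F B c' b)"
    using 1 by (rule sum.cong[OF refl])
  also have "\<dots> = (\<Sum>c\<in>C. \<Sum>c'\<in>C. \<Sum>b\<in>B. coord F C b c * coord F C (x * c) c' * coord F B c' b)"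
    by (rule trans[OF sum.swap]) (rule sum.cong[OF refl], rule sum.swap)
  also have "\<dots> = (\<Sum>c\<in>C. \<Sum>c'\<in>C. coord F C (x * c) c' * (\<Sum>b\<in>B. coord F C b c * coord F B c' b))"
    by (intro sum.cong refl) (simp add: sum_distrib_left mult.commute mult.left_commute)
  also have "\<dots> = (\<Sum>c\<in>C. \<Sum>c'\<in>C. if c' = c then coord F C (x * c) c' else 0)"
    by (intro sum.cong refl) (use 2 in auto)
  also have "\<dots> = (\<Sum>c\<in>C. coord F C (x * c) c)" using fin by simp
  finally show ?thesis by (simp add: rel_trace_def C_def Let_def)
qed

lemma rel_trace_in:
  assumes F: "is_subfield F" and E: "is_subfield E" and B: "is_basis F E B" and x: "x \<in> E"
  shows "rel_trace F E x \<in> F"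
  unfolding rel_trace_eq[OF assms]
  using B x subfield_closed[OF E] coord_in[OF F B] by (intro subfield_sum[OF F]) (auto simp: is_basis_def)

lemma rel_trace_add:
  assumes F: "is_subfield F" and E: "is_subfield E" and B: "is_basis F E B" and x: "x \<in> E" "y \<in> E"
  shows "rel_trace F E (x + y) = rel_trace F E x + rel_trace F E y"
proof -
  have "x + y \<in> E" "B \<subseteq> E" using subfield_closed[OF E] x B by (auto simp: is_basis_def)
  then show ?thesis using x subfield_closed[OF E]
    by (simp add: rel_trace_eq[OF F E B] sum.distrib[symmetric] distrib_right)
      (intro sum.cong refl coord_add[OF F B], auto)
qed

lemma rel_trace_scale:
  assumes F: "is_subfield F" and E: "is_subfield E" and B: "is_basis F E B" and FE: "F \<subseteq> E"
    and x: "a \<in> F" "x \<in> E"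
  shows "rel_trace F E (a * x) = a * rel_trace F E x"
proof -
  have "a * x \<in> E" "B \<subseteq> E" using subfield_closed[OF E] x B FE by (auto simp: is_basis_def)
  then show ?thesis using x subfield_closed[OF E]
    by (simp add: rel_trace_eq[OF F E B] sum_distrib_left mult.assoc)
      (intro sum.cong refl coord_scale[OF F B], auto)
qed

lemma rel_trace_one:
  assumes F: "is_subfield F" and E: "is_subfield E" and B: "is_basis F E B"
  shows "rel_trace F E 1 = of_nat (ext_degree F E)"
proof -
  have "rel_trace F E 1 = (\<Sum>b\<in>B. 1)"
    unfolding rel_trace_eq[OF F E B subfield_closed(2)[OF E]]
    using coord_basis_element[OF F B] by (intro sum.cong) auto
  then show ?thesis by (simp add: ext_degree_eq[OF F B])
qed

section \<open>Bases and traces in a tower of two extensions\<close>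

lemma basis_product:
  assumes F: "is_subfield F" and E: "is_subfield E" and FE: "F \<subseteq> E" and EL: "E \<subseteq> L"
    and L: "is_subfield L" and B: "is_basis F E B" and C: "is_basis E L C"
  shows "inj_on (\<lambda>(b,c). b * c) (B \<times> C)" "is_basis F L ((\<lambda>(b,c). b * c) ` (B \<times> C))"
proof -
  have fin: "finite B" "finite C" and sub: "B \<subseteq> E" "C \<subseteq> L" using B C by (auto simp: is_basis_def)
  \<comment> \<open>Independence is shown for the family indexed by pairs, before it is known that
    distinct pairs have distinct products.\<close>
  have ind: "d (b,c) = 0" if d: "\<And>p. p \<in> B \<times> C \<Longrightarrow> d p \<in> F"
      and z: "(\<Sum>(b,c)\<in>B\<times>C. d (b,c) * (b * c)) = 0" and bc: "b \<in> B" "c \<in> C" for d b c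
  proof -
    have "(\<Sum>c\<in>C. (\<Sum>b\<in>B. d (b,c) * b) * c) = 0"
      using z by (simp add: sum.cartesian_product[symmetric] sum_distrib_right mult.assoc)
        (subst sum.swap, simp)
    moreover have "\<forall>c\<in>C. (\<Sum>b\<in>B. d (b,c) * b) \<in> E"
      using d sub FE by (auto intro!: subfield_sum[OF E] subfield_closed(5)[OF E])
    ultimately have "\<forall>c\<in>C. (\<Sum>b\<in>B. d (b,c) * b) = 0"
      using C by (auto simp: is_basis_def dest!: spec[of _ "\<lambda>c. (\<Sum>b\<in>B. d (b,c) * b)"])
    then have "(\<Sum>b\<in>B. d (b,c) * b) = 0" using bc by simp
    moreover have "\<forall>b\<in>B. d (b,c) \<in> F" using d bc by auto
    ultimately show ?thesis
      using B bc by (auto simp: is_basis_def dest!: spec[of _ "\<lambda>b. d (b,c)"])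
  qed
  \<comment> \<open>Bases are sets, so coinciding products would lose basis elements. Two pairs with
    the same product would satisfy the relation with coefficients 1 and -1, against
    \<open>ind\<close>.\<close>
  show inj: "inj_on (\<lambda>(b,c). b * c) (B \<times> C)"
  proof (rule inj_onI, rule ccontr)
    fix p q assume p: "p \<in> B \<times> C" and q: "q \<in> B \<times> C"
      and eq: "(case p of (b,c) \<Rightarrow> b * c) = (case q of (b,c) \<Rightarrow> b * c)" and ne: "p \<noteq> q"
    define d where "d = (\<lambda>r. if r = p then 1 else if r = q then -1 else 0 :: 'a)"
    have "(\<Sum>(b,c)\<in>B\<times>C. d (b,c) * (b * c)) = (\<Sum>r\<in>B\<times>C. (if r = p then (case p of (b,c) \<Rightarrow> b * c) else 0)
       - (if r = q then (case q of (b,c) \<Rightarrow> b * c) else 0))"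
      using ne by (intro sum.cong) (auto simp: d_def)
    also have "\<dots> = 0" using p q fin eq by (simp add: sum_subtractf)
    finally have "(\<Sum>(b,c)\<in>B\<times>C. d (b,c) * (b * c)) = 0" .
    then have "d (fst p, snd p) = 0"
      using p by (intro ind[of d]) (auto simp: d_def subfield_closed[OF F])
    then show False by (simp add: d_def)
  qed
  let ?BC = "(\<lambda>(b,c). b * c) ` (B \<times> C)"
  have reix: "(\<Sum>v\<in>?BC. c v * v) = (\<Sum>(b,c')\<in>B\<times>C. c (b * c') * (b * c'))" for c
    by (subst sum.reindex[OF inj]) (simp add: case_prod_unfold)
  have subBC: "?BC \<subseteq> L" using sub EL by (auto intro!: subfield_closed(5)[OF L])
  show "is_basis F L ?BC"
    unfolding is_basis_def
  proof (intro conjI allI impI)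
    show "finite ?BC" using fin by simp
    show "?BC \<subseteq> L" by fact
    show "L = lincomb_set F ?BC"
    proof (intro equalityI subsetI)
      fix x assume x: "x \<in> L"
      define d where "d = (\<lambda>v. let p = the_inv_into (B\<times>C) (\<lambda>(b,c). b * c) v
          in coord F B (coord E C x (snd p)) (fst p))"
      have dp: "d (b * c) = coord F B (coord E C x c) b" if "b \<in> B" "c \<in> C" for b c
        using the_inv_into_f_f[OF inj, of "(b,c)"] that by (simp add: d_def)
      have "x = (\<Sum>c\<in>C. coord E C x c * c)" by (rule coord_sum[OF E C x])
      also have "\<dots> = (\<Sum>c\<in>C. (\<Sum>b\<in>B. coord F B (coord E C x c) b * b) * c)"
        using coord_sum[OF F B coord_in[OF E C x]] by simp
      also have "\<dots> = (\<Sum>b\<in>B. \<Sum>c\<in>C. d (b * c) * (b * c))"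
        by (simp add: sum_distrib_right mult.assoc dp) (subst sum.swap, simp)
      also have "\<dots> = (\<Sum>v\<in>?BC. d v * v)" unfolding reix by (simp add: sum.cartesian_product)
      finally have eq: "x = (\<Sum>v\<in>?BC. d v * v)" .
      show "x \<in> lincomb_set F ?BC"
        by (rule lincomb_setI[OF eq]) (auto simp: dp coord_in[OF F B coord_in[OF E C x]])
    next
      fix x assume "x \<in> lincomb_set F ?BC"
      then show "x \<in> L" using lincomb_subset[OF L _ subBC, of F] FE EL by auto
    qed
  next
    fix c assume c: "\<forall>b\<in>?BC. c b \<in> F" "(\<Sum>b\<in>?BC. c b * b) = 0"
    then have "c (b * c') = 0" if "b \<in> B" "c' \<in> C" for b c'
      using ind[of "\<lambda>(b,c'). c (b * c')" b c'] that by (auto simp: reix)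
    then show "\<forall>b\<in>?BC. c b = 0" by auto
  qed
qed

text \<open>Computed in the product basis: the diagonal entry at \<open>b * c\<close> is the
  \<open>b\<close>-th diagonal entry of multiplication by the \<open>c\<close>-th diagonal entry of
  \<open>x\<close>. Summing over \<open>b\<close> gives the trace down to \<open>F\<close> of that
  entry, and additivity collects the sum over \<open>c\<close>.\<close>

lemma rel_trace_trans:
  assumes F: "is_subfield F" and E: "is_subfield E" and FE: "F \<subseteq> E" and EL: "E \<subseteq> L"
    and L: "is_subfield L" and B: "is_basis F E B" and C: "is_basis E L C" and x: "x \<in> L"
  shows "rel_trace F L x = rel_trace F E (rel_trace E L x)"
proof -
  let ?BC = "(\<lambda>(b,c). b * c) ` (B \<times> C)"
  have inj: "inj_on (\<lambda>(b,c). b * c) (B \<times> C)" and BC: "is_basis F L ?BC"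
    using basis_product[OF assms(1-7)] by auto
  have fin: "finite B" "finite C" and sub: "B \<subseteq> E" "C \<subseteq> L" using B C by (auto simp: is_basis_def)
  have co: "coord F ?BC (x * (b * c)) (b * c) = coord F B (coord E C (x * c) c * b) b"
    if bc: "b \<in> B" "c \<in> C" for b c
  proof -
    have xc: "x * c \<in> L" using x bc sub subfield_closed[OF L] by auto
    have inE: "coord E C (x * c) c' * b \<in> E" for c'
      using coord_in[OF E C xc] bc sub subfield_closed[OF E] by auto
    define d where "d = (\<lambda>v. let p = the_inv_into (B\<times>C) (\<lambda>(b,c). b * c) v
          in coord F B (coord E C (x * c) (snd p) * b) (fst p))"
    have dp: "d (b' * c') = coord F B (coord E C (x * c) c' * b) b'" if "b' \<in> B" "c' \<in> C" for b' c'
      using the_inv_into_f_f[OF inj, of "(b',c')"] that by (simp add: d_def)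
    have "x * (b * c) = b * (\<Sum>c'\<in>C. coord E C (x * c) c' * c')"
      using coord_sum[OF E C xc] by (simp add: algebra_simps)
    also have "\<dots> = (\<Sum>c'\<in>C. (coord E C (x * c) c' * b) * c')"
      by (simp add: sum_distrib_left algebra_simps)
    also have "\<dots> = (\<Sum>c'\<in>C. (\<Sum>b'\<in>B. coord F B (coord E C (x * c) c' * b) b' * b') * c')"
      using coord_sum[OF F B inE] by simp
    also have "\<dots> = (\<Sum>b'\<in>B. \<Sum>c'\<in>C. d (b' * c') * (b' * c'))"
      by (simp add: sum_distrib_right mult.assoc dp) (subst sum.swap, simp)
    also have "\<dots> = (\<Sum>v\<in>?BC. d v * v)"
      by (subst sum.reindex[OF inj]) (simp add: case_prod_unfold sum.cartesian_product)
    finally have eq: "x * (b * c) = (\<Sum>v\<in>?BC. d v * v)" .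
    have "coord F ?BC (x * (b * c)) (b * c) = d (b * c)"
      by (rule coord_unique[OF F BC _ eq]) (use bc in \<open>auto simp: dp coord_in[OF F B inE]\<close>)
    then show ?thesis using bc by (simp add: dp)
  qed
  have cE: "coord E C (x * c) c \<in> E" if "c \<in> C" for c
    using coord_in[OF E C, of "x * c"] x that sub subfield_closed[OF L] by auto
  have trs: "rel_trace F E (\<Sum>c\<in>C'. coord E C (x * c) c) = (\<Sum>c\<in>C'. rel_trace F E (coord E C (x * c) c))"
    if "C' \<subseteq> C" for C'
    using finite_subset[OF that fin(2)] that
  proof (induction C' rule: finite_induct)
    case empty
    have "rel_trace F E (0 * 0) = 0 * rel_trace F E 0"
      using subfield_closed[OF F] subfield_closed[OF E] by (intro rel_trace_scale[OF F E B FE])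
    then show ?case by simp
  next
    case (insert c C')
    then have "(\<Sum>c\<in>C'. coord E C (x * c) c) \<in> E" using cE by (intro subfield_sum[OF E]) auto
    then show ?case using insert cE by (simp add: rel_trace_add[OF F E B])
  qed
  have "rel_trace F L x = (\<Sum>v\<in>?BC. coord F ?BC (x * v) v)" by (rule rel_trace_eq[OF F L BC x])
  also have "\<dots> = (\<Sum>b\<in>B. \<Sum>c\<in>C. coord F ?BC (x * (b * c)) (b * c))"
    by (subst sum.reindex[OF inj]) (simp add: case_prod_unfold sum.cartesian_product)
  also have "\<dots> = (\<Sum>c\<in>C. \<Sum>b\<in>B. coord F B (coord E C (x * c) c * b) b)"
    by (subst sum.swap) (simp add: co)
  also have "\<dots> = (\<Sum>c\<in>C. rel_trace F E (coord E C (x * c) c))"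
    using cE by (intro sum.cong refl) (simp add: rel_trace_eq[OF F E B])
  also have "\<dots> = rel_trace F E (\<Sum>c\<in>C. coord E C (x * c) c)" using trs by simp
  also have "\<dots> = rel_trace F E (rel_trace E L x)" by (simp add: rel_trace_eq[OF E L C x])
  finally show ?thesis .
qed

lemma basis_of_larger_subfield:
  assumes F: "is_subfield F" and E: "is_subfield E" and FE: "F \<subseteq> E" and EL: "E \<subseteq> L"
    and L: "is_subfield L" and B: "is_basis F L B"
  shows "\<exists>C. is_basis E L C"
proof -
  have sp: "B \<subseteq> L" "finite B" "L = lincomb_set F B" using B by (auto simp: is_basis_def)
  have le: "lincomb_set E A \<subseteq> L" if "A \<subseteq> L" for A
    using lincomb_subset[OF L EL that] .
  have "lincomb_set F B \<subseteq> lincomb_set E B" using FE by (fastforce simp: lincomb_set_def)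
  then have B': "B \<subseteq> B \<and> lincomb_set E B = L" using le[OF sp(1)] sp by auto
  obtain C where C: "C \<subseteq> B" "lincomb_set E C = L"
    and min: "\<And>D. D \<subseteq> B \<Longrightarrow> lincomb_set E D = L \<Longrightarrow> card C \<le> card D"
    using ex_has_least_nat[of "\<lambda>C. C \<subseteq> B \<and> lincomb_set E C = L" B card, OF B'] by metis
  have fC: "finite C" using C sp finite_subset by auto
  have "c b = 0" if c: "\<forall>b\<in>C. c b \<in> E" "(\<Sum>b\<in>C. c b * b) = 0" and b: "b \<in> C" for c b
  proof (rule ccontr)
    assume nz: "c b \<noteq> 0"
    define D where "D = C - {b}"
    have CD: "C = insert b D" "b \<notin> D" "finite D" using b fC by (auto simp: D_def)
    have "c b * b = - (\<Sum>v\<in>D. c v * v)" using c(2) CD by (simp add: add_eq_0_iff2)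
    then have bb: "b = - (\<Sum>v\<in>D. c v * v) / c b" using nz by (simp add: field_simps)
    have "L \<subseteq> lincomb_set E D"
    proof
      fix x assume "x \<in> L"
      then obtain d where d: "\<forall>v\<in>C. d v \<in> E" "x = (\<Sum>v\<in>C. d v * v)"
        using C(2) by (auto simp: lincomb_set_def)
      have "x = d b * b + (\<Sum>v\<in>D. d v * v)" using d CD by simp
      also have "\<dots> = d b * (- (\<Sum>v\<in>D. c v * v) / c b) + (\<Sum>v\<in>D. d v * v)"
        using bb by simp
      also have "\<dots> = (\<Sum>v\<in>D. (d v - d b / c b * c v) * v)"
        by (simp add: algebra_simps sum_subtractf sum_distrib_left sum_distrib_right sum_divide_distrib)
      finally show "x \<in> lincomb_set E D"
        by (rule lincomb_setI) (use d c CD in \<open>auto intro!: subfield_closed[OF E]\<close>)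
    qed
    moreover have "D \<subseteq> B" using C CD by auto
    moreover from this have "lincomb_set E D \<subseteq> L" using sp(1) by (intro le) auto
    ultimately have "card C \<le> card D" by (intro min) auto
    then show False using CD by simp
  qed
  moreover have "C \<subseteq> L" using C(1) sp(1) by (rule order_trans)
  ultimately have "is_basis E L C" using C(2) fC unfolding is_basis_def
    by (intro conjI allI impI ballI) simp_all
  then show ?thesis ..
qed

lemma is_basis_self: "is_subfield F \<Longrightarrow> is_basis F F {1}"
proof -
  assume F: "is_subfield F"
  have "F \<subseteq> lincomb_set F {1}"
  proof
    fix x assume "x \<in> F"
    then show "x \<in> lincomb_set F {1}" by (intro lincomb_setI[where c = "\<lambda>_. x"]) auto
  qed
  then have eq: "F = lincomb_set F {1}"
    using lincomb_subset[OF F order_refl, of "{1}"] subfield_closed(2)[OF F] by blast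
  show ?thesis unfolding is_basis_def
    using subfield_closed(2)[OF F] by (intro conjI eq) auto
qed

lemma basis_nonempty:
  assumes "is_subfield E" "is_basis F E B"
  shows "B \<noteq> {}"
proof
  assume "B = {}"
  then have "E = lincomb_set F {}" using assms(2) by (simp only: is_basis_def)
  then have "1 \<in> lincomb_set F {}" using subfield_closed(2)[OF assms(1)] by metis
  then show False by (simp add: lincomb_set_def)
qed

lemma ext_degree_pos:
  assumes "is_subfield F" "is_subfield E" "is_basis F E B"
  shows "ext_degree F E > 0"
  using basis_nonempty[OF assms(2,3)] ext_degree_eq[OF assms(1,3)] assms(3)
  by (simp add: is_basis_def card_gt_0_iff)

section \<open>Non-archimedean absolute values\<close>

locale nonarch =
  fixes F :: "'a::field set" and g :: "'a \<Rightarrow> real"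
  assumes sub: "is_subfield F" and absval: "is_absval F g"
    and ultra: "\<And>x y. x \<in> F \<Longrightarrow> y \<in> F \<Longrightarrow> g (x + y) \<le> max (g x) (g y)"
begin

lemmas cl = subfield_closed[OF sub]

lemma nonneg: "x \<in> F \<Longrightarrow> 0 \<le> g x"
  and eq0: "x \<in> F \<Longrightarrow> g x = 0 \<longleftrightarrow> x = 0"
  and mult: "x \<in> F \<Longrightarrow> y \<in> F \<Longrightarrow> g (x * y) = g x * g y"
  using absval by (auto simp: is_absval_def)

lemma zero [simp]: "g 0 = 0"
  using eq0 cl(1) by blast

lemma pos: "x \<in> F \<Longrightarrow> x \<noteq> 0 \<Longrightarrow> 0 < g x"
  using nonneg[of x] eq0[of x] by linarith

lemma one [simp]: "g 1 = 1"
  using mult[OF cl(2) cl(2)] pos[OF cl(2)] by simp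

lemma minus: "x \<in> F \<Longrightarrow> g (- x) = g x"
proof -
  assume x: "x \<in> F"
  have m: "(-1::'a) \<in> F" using cl(7)[OF cl(2)] .
  have "g (-1) * g (-1) = 1" using mult[OF m m] by simp
  then have "g (-1) = 1" using nonneg[OF m] by (simp add: square_eq_1_iff)
  then show ?thesis using mult[OF m x] by simp
qed

lemma diff: "x \<in> F \<Longrightarrow> y \<in> F \<Longrightarrow> g (x - y) \<le> max (g x) (g y)"
  using ultra[of x "-y"] cl(7)[of y] minus[of y] by simp

lemma commute: "x \<in> F \<Longrightarrow> y \<in> F \<Longrightarrow> g (x - y) = g (y - x)"
  using minus[of "x - y"] cl(4) by simp

lemma power: "x \<in> F \<Longrightarrow> g (x ^ n) = g x ^ n"
  by (induction n) (auto simp: mult cl)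

lemma inv: "x \<in> F \<Longrightarrow> g (inverse x) = inverse (g x)"
proof (cases "x = 0")
  case False
  assume x: "x \<in> F"
  have "g x * g (inverse x) = 1" using mult[OF x cl(6)[OF x]] False by simp
  then show ?thesis using pos[OF x False] by (simp add: field_simps)
qed simp

lemma divide: "x \<in> F \<Longrightarrow> y \<in> F \<Longrightarrow> g (x / y) = g x / g y"
  by (simp add: divide_inverse mult inv cl)

lemma power_int: "x \<in> F \<Longrightarrow> g (x powi j) = g x powi j"
  by (auto simp: power_int_def power inv cl)

lemma sum_le:
  assumes "\<And>i. i \<in> I \<Longrightarrow> h i \<in> F" "\<And>i. i \<in> I \<Longrightarrow> g (h i) \<le> M" "0 \<le> M"
  shows "g (sum h I) \<le> M"
  using assms(1,2)
proof (induction I rule: infinite_finite_induct)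
  case (insert i I)
  then have "h i \<in> F" "sum h I \<in> F" "g (h i) \<le> M" "g (sum h I) \<le> M"
    using subfield_sum[OF sub, of I h] by auto
  then show ?case using ultra[of "h i" "sum h I"] insert(1,2) by simp
qed (use assms(3) in auto)

text \<open>Isosceles principle: since \<open>y = (x + y) - x\<close> and \<open>x\<close> is too
  small to account for the value of \<open>y\<close>, the sum must have it.\<close>

lemma add_eq_right:
  assumes "x \<in> F" "y \<in> F" "g x < g y"
  shows "g (x + y) = g y"
proof -
  have "g y = g ((x + y) - x)" by simp
  also have "\<dots> \<le> max (g (x + y)) (g x)" using assms cl by (intro diff) auto
  finally show ?thesis using ultra[OF assms(1,2)] assms(3) by linarith
qed

lemma diff_trans_lt:
  assumes "x \<in> F" "y \<in> F" "z \<in> F" "g (x - y) < r" "g (y - z) < r"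
  shows "g (x - z) < r"
  using ultra[of "x - y" "y - z"] cl(4)[OF assms(1,2)] cl(4)[OF assms(2,3)] assms(4,5) by simp

lemma diff_trans_le:
  assumes "x \<in> F" "y \<in> F" "z \<in> F" "g (x - y) \<le> r" "g (y - z) \<le> r"
  shows "g (x - z) \<le> r"
  using ultra[of "x - y" "y - z"] cl(4)[OF assms(1,2)] cl(4)[OF assms(2,3)] assms(4,5) by simp

lemma of_nat_le: "g (of_nat n) \<le> 1"
proof (induction n)
  case (Suc n)
  then show ?case using ultra[of 1 "of_nat n"] cl by auto
qed simp

lemma subset: "is_subfield F' \<Longrightarrow> F' \<subseteq> F \<Longrightarrow> nonarch F' g"
proof -
  assume F': "is_subfield F'" "F' \<subseteq> F"
  show "nonarch F' g"
  proof
    show "is_absval F' g" using absval F'(2) unfolding is_absval_def by (meson subsetD)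
    show "g (x + y) \<le> max (g x) (g y)" if "x \<in> F'" "y \<in> F'" for x y
      using ultra that F'(2) by blast
  qed (rule F')
qed

end

text \<open>Removes the factor \<open>n + 1\<close> that remains after the binomial expansion in the
  next proof.\<close>

lemma linear_less_exponential:
  fixes c :: real
  assumes "1 < c"
  shows "\<exists>n. real (Suc n) < c ^ n"
proof -
  have "filterlim (\<lambda>n. c ^ n / real n) at_top sequentially"
    using assms powr_realpow[of c] by real_asymp
  then have "eventually (\<lambda>n. 2 < c ^ n / real n \<and> 1 \<le> n) sequentially"
    by (intro eventually_conj eventually_ge_at_top) (auto simp: filterlim_at_top_dense)
  then obtain n where n: "2 < c ^ n / real n" "1 \<le> n" by (auto simp: eventually_sequentially)
  then have "2 * real n < c ^ n" by (simp add: field_simps)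
  then show ?thesis using n(2) by (intro exI[of _ n]) linarith
qed

text \<open>Binomial expansion gives \<open>g (x + y) ^ n \<le> (n + 1) max (g x) (g y) ^ n\<close>.\<close>
lemma absval_bounded_on_nat_imp_nonarch:
  fixes E :: "'a::field_char_0 set"
  assumes E: "is_subfield E" and g: "is_absval E g" and nat: "\<And>n. g (of_nat n) \<le> 1"
  shows "nonarch E g"
proof
  note cl = subfield_closed[OF E]
  have nonneg: "0 \<le> g x" if "x \<in> E" for x using g that by (auto simp: is_absval_def)
  have mult: "g (x * y) = g x * g y" if "x \<in> E" "y \<in> E" for x y
    using g that by (auto simp: is_absval_def)
  have add: "g (x + y) \<le> g x + g y" if "x \<in> E" "y \<in> E" for x y
    using g that by (auto simp: is_absval_def)
  have g0: "g 0 = 0" using g cl(1) by (auto simp: is_absval_def)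
  have g1: "g 1 = 1"
  proof -
    have "g 1 \<noteq> 0" using g cl(2) by (auto simp: is_absval_def)
    then show ?thesis using mult[OF cl(2) cl(2)] by simp
  qed
  have power: "g (x ^ n) = g x ^ n" if "x \<in> E" for x n
    using that by (induction n) (auto simp: mult cl g1)
  have sum: "g (sum h I) \<le> (\<Sum>i\<in>I. g (h i))" if "\<And>i. i \<in> I \<Longrightarrow> h i \<in> E" for h :: "nat \<Rightarrow> 'a" and I
    using that
  proof (induction I rule: infinite_finite_induct)
    case (insert i I)
    then show ?case using add[of "h i" "sum h I"] subfield_sum[OF E, of I h] by auto
  qed (use g0 in auto)
  show "g (x + y) \<le> max (g x) (g y)" if xy: "x \<in> E" "y \<in> E" for x y
  proof (rule ccontr)
    define M where "M = max (g x) (g y)"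
    assume "\<not> ?thesis"
    then have M: "M < g (x + y)" "0 \<le> M" using nonneg[OF xy(1)] by (auto simp: M_def)
    have bd: "g (x + y) ^ n \<le> real (Suc n) * M ^ n" for n
    proof -
      have "g (x + y) ^ n = g ((x + y) ^ n)" using xy by (simp add: power cl)
      also have "\<dots> = g (\<Sum>k\<le>n. of_nat (n choose k) * x ^ k * y ^ (n - k))"
        by (simp add: binomial_ring)
      also have "\<dots> \<le> (\<Sum>k\<le>n. g (of_nat (n choose k) * x ^ k * y ^ (n - k)))"
        using xy by (intro sum) (auto simp: cl)
      also have "\<dots> \<le> (\<Sum>k\<le>n. M ^ n)"
      proof (rule sum_mono)
        fix k assume k: "k \<in> {..n}"
        have "g (of_nat (n choose k) * x ^ k * y ^ (n - k)) = g (of_nat (n choose k)) * g x ^ k * g y ^ (n - k)"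
          using xy by (simp add: mult power cl)
        also have "\<dots> \<le> 1 * M ^ k * M ^ (n - k)"
          using nat xy nonneg M(2) cl(10) by (intro mult_mono power_mono) (auto simp: M_def)
        also have "\<dots> = M ^ n" using k by (simp add: power_add[symmetric])
        finally show "g (of_nat (n choose k) * x ^ k * y ^ (n - k)) \<le> M ^ n" .
      qed
      finally show ?thesis by simp
    qed
    show False
    proof (cases "M = 0")
      case True
      then show False using bd[of 1] M by simp
    next
      case False
      then have "1 < g (x + y) / M" using M by simp
      then obtain n where "real (Suc n) < (g (x + y) / M) ^ n" using linear_less_exponential by blast
      then show False using bd[of n] M False by (simp add: power_divide field_simps)
    qed
  qed
qed (use assms in auto)

section \<open>Extension of absolute values\<close>

text \<open>On \<open>F\<close> only an upper bound by \<open>f\<close> is imposed, a condition that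
  survives infima; equality is regained once the seminorm is multiplicative. The normalization at 1
  prevents an infimum from collapsing to zero, and vanishing outside \<open>E\<close> lets seminorms
  be compared and identified as total functions.\<close>

definition ext_seminorm :: "'a::field set \<Rightarrow> ('a \<Rightarrow> real) \<Rightarrow> 'a set \<Rightarrow> ('a \<Rightarrow> real) \<Rightarrow> bool" where
  "ext_seminorm F f E p \<longleftrightarrow> (\<forall>x. x \<notin> E \<longrightarrow> p x = 0) \<and> (\<forall>x\<in>E. 0 \<le> p x) \<and> p 0 = 0 \<and> p 1 = 1 \<and>
     (\<forall>x\<in>E. \<forall>y\<in>E. p (x * y) \<le> p x * p y \<and> p (x + y) \<le> max (p x) (p y)) \<and> (\<forall>c\<in>F. p c \<le> f c)"

text \<open>Let \<open>r\<close> and \<open>s\<close> decrease to \<open>a\<close> and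
  \<open>b\<close>. Submultiplicativity of infima is derived through this, without dividing by
  values that may be zero.\<close>

lemma le_mult_of_greater:
  fixes a b z :: real
  assumes "\<And>r s. a < r \<Longrightarrow> b < s \<Longrightarrow> z \<le> r * s"
  shows "z \<le> a * b"
proof -
  have "((\<lambda>t. (a + t) * (b + t)) \<longlongrightarrow> (a + 0) * (b + 0)) (at_right 0)"
    by (intro tendsto_intros)
  then have "z \<le> (a + 0) * (b + 0)"
    by (rule tendsto_lowerbound)
      (auto simp: eventually_at_right_field intro!: assms exI[of _ 1])
  then show ?thesis by simp
qed

text \<open>The condition \<open>dir\<close> serves two quite different families: for a chain of
  seminorms \<open>k\<close> is the smaller of two members, for the smoothing sequence of a single
  seminorm it is the sum of the two indices.\<close>

lemma ext_seminorm_Inf: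
  fixes a :: "'i \<Rightarrow> 'a::field \<Rightarrow> real"
  assumes E: "is_subfield E" and FE: "F \<subseteq> E" and I: "I \<noteq> {}"
    and nn: "\<And>i x. i \<in> I \<Longrightarrow> x \<in> E \<Longrightarrow> 0 \<le> a i x" and a01: "\<And>i. i \<in> I \<Longrightarrow> a i 0 = 0 \<and> a i 1 = 1"
    and dir: "\<And>i j. i \<in> I \<Longrightarrow> j \<in> I \<Longrightarrow>
       \<exists>k\<in>I. \<forall>x\<in>E. \<forall>y\<in>E. a k (x * y) \<le> a i x * a j y \<and> a k (x + y) \<le> max (a i x) (a j y)"
    and F: "\<And>i c. i \<in> I \<Longrightarrow> c \<in> F \<Longrightarrow> a i c \<le> f c"
  shows "ext_seminorm F f E (\<lambda>x. if x \<in> E then INF i\<in>I. a i x else 0)"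
proof -
  let ?P = "\<lambda>x. INF i\<in>I. a i x"
  note cl = subfield_closed[OF E]
  have bdd: "bdd_below ((\<lambda>i. a i x) ` I)" if "x \<in> E" for x
    using nn that by (intro bdd_belowI[of _ 0]) auto
  have lt: "?P x < r \<longleftrightarrow> (\<exists>i\<in>I. a i x < r)" if "x \<in> E" for x r
    using cINF_less_iff[OF I bdd[OF that]] .
  have lower: "?P x \<le> a i x" if "i \<in> I" "x \<in> E" for i x
    using cINF_lower[OF bdd[OF that(2)] that(1)] .
  have nonneg: "0 \<le> ?P x" if "x \<in> E" for x
    using nn that by (intro cINF_greatest[OF I]) auto
  have m: "?P (x * y) \<le> ?P x * ?P y" if xy: "x \<in> E" "y \<in> E" for x y
  proof (rule le_mult_of_greater)
    fix r s assume "?P x < r" "?P y < s"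
    then obtain i j where ij: "i \<in> I" "j \<in> I" "a i x < r" "a j y < s" using lt xy by blast
    obtain k where k: "k \<in> I" "a k (x * y) \<le> a i x * a j y" using dir[OF ij(1,2)] xy by blast
    have "0 \<le> a i x" "0 \<le> a j y" using ij nn xy by auto
    then have "a i x * a j y \<le> r * s" using ij by (intro mult_mono) auto
    then show "?P (x * y) \<le> r * s" using lower[OF k(1)] k(2) xy cl(5) by fastforce
  qed
  have ad: "?P (x + y) \<le> max (?P x) (?P y)" if xy: "x \<in> E" "y \<in> E" for x y
  proof (rule dense_ge)
    fix r assume "max (?P x) (?P y) < r"
    then have "?P x < r" "?P y < r" by simp_all
    then obtain i j where ij: "i \<in> I" "j \<in> I" "a i x < r" "a j y < r" using lt xy by blast
    obtain k where k: "k \<in> I" "a k (x + y) \<le> max (a i x) (a j y)" using dir[OF ij(1,2)] xy by blast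
    then show "?P (x + y) \<le> r" using lower[OF k(1) cl(3)[OF xy]] ij by linarith
  qed
  have z: "?P 0 = 0" "?P 1 = 1" using a01 I by (simp_all cong: INF_cong)
  have "?P c \<le> f c" if "c \<in> F" for c
  proof -
    obtain i where "i \<in> I" using I by auto
    then show ?thesis using lower[of i c] F[of i c] that FE by auto
  qed
  then show ?thesis unfolding ext_seminorm_def using nonneg m ad z FE cl(1,2,3,5) by auto
qed

text \<open>Zorn's lemma for the reversed pointwise order; a nonempty chain is bounded by its
  pointwise infimum, the empty one by \<open>p0\<close>.\<close>

lemma ext_seminorm_minimal_exists:
  assumes E: "is_subfield E" and FE: "F \<subseteq> E" and p0: "ext_seminorm F f E p0"
  shows "\<exists>p. ext_seminorm F f E p \<and> (\<forall>q. ext_seminorm F f E q \<longrightarrow> (\<forall>x. q x \<le> p x) \<longrightarrow> q = p)"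
proof -
  let ?A = "{p. ext_seminorm F f E p}" and ?P = "\<lambda>p q. \<forall>x. q x \<le> (p x :: real)"
  have "\<exists>m\<in>?A. \<forall>a\<in>?A. ?P m a \<longrightarrow> a = m"
  proof (rule predicate_Zorn)
    show "partial_order_on ?A (relation_of ?P ?A)"
      by (rule partial_order_on_relation_ofI) (auto intro: order_trans simp: fun_eq_iff antisym)
  next
    fix C assume C: "C \<in> Chains (relation_of ?P ?A)"
    show "\<exists>u\<in>?A. \<forall>a\<in>C. ?P a u"
    proof (cases "C = {}")
      case True
      then show ?thesis using p0 by auto
    next
      case False
      have CA: "ext_seminorm F f E a" if "a \<in> C" for a
        using C that by (auto simp: Chains_def relation_of_def)
      have tot: "(\<forall>x. a x \<le> b x) \<or> (\<forall>x. b x \<le> a x)" if "a \<in> C" "b \<in> C" for a b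
        using C that by (auto simp: Chains_def relation_of_def)
      let ?u = "\<lambda>x. if x \<in> E then INF a\<in>C. a x else 0"
      have "ext_seminorm F f E ?u"
      proof (rule ext_seminorm_Inf[OF E FE False])
        fix a b assume ab: "a \<in> C" "b \<in> C"
        obtain k where k: "k \<in> C" "\<And>x. k x \<le> a x" "\<And>x. k x \<le> b x"
          using tot[OF ab] ab by auto
        have kp: "ext_seminorm F f E k" using CA[OF k(1)] .
        have "k (x * y) \<le> a x * b y \<and> k (x + y) \<le> max (a x) (b y)" if xy: "x \<in> E" "y \<in> E" for x y
        proof
          have nn: "0 \<le> k x" "0 \<le> k y" and 1: "k (x * y) \<le> k x * k y" and 2: "k (x + y) \<le> max (k x) (k y)"
            using kp xy by (auto simp: ext_seminorm_def)
          have "k x * k y \<le> a x * b y"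
            by (rule mult_mono) (use k nn in \<open>auto intro: order_trans\<close>)
          with 1 show "k (x * y) \<le> a x * b y" by linarith
          show "k (x + y) \<le> max (a x) (b y)" using 2 k(2)[of x] k(3)[of y] by linarith
        qed
        then show "\<exists>k\<in>C. \<forall>x\<in>E. \<forall>y\<in>E. k (x * y) \<le> a x * b y \<and> k (x + y) \<le> max (a x) (b y)"
          using k(1) by blast
      qed (use CA in \<open>auto simp: ext_seminorm_def\<close>)
      moreover have "?u x \<le> a x" if a: "a \<in> C" for a x
      proof (cases "x \<in> E")
        case True
        then have "bdd_below ((\<lambda>a. a x) ` C)" using CA by (intro bdd_belowI[of _ 0]) (auto simp: ext_seminorm_def)
        then show ?thesis using True a by (auto intro: cINF_lower)
      next
        case False
        then show ?thesis using CA[OF a] by (auto simp: ext_seminorm_def)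
      qed
      ultimately show ?thesis by (intro bexI[of _ ?u] ballI allI) auto
    qed
  qed
  then show ?thesis by auto
qed

text \<open>The infimum of all admissible growth rates stands for the limit of
  \<open>p (x^n)^(1/n)\<close>, so no convergence has to be proved. The constants \<open>C\<close>
  simply multiply when two elements are combined.\<close>

lemma ext_seminorm_spectral:
  assumes E: "is_subfield E" and FE: "F \<subseteq> E" and p: "ext_seminorm F f E p"
  defines "R \<equiv> \<lambda>x. {r. 0 < r \<and> (\<exists>C. \<forall>n. p (x ^ n) \<le> C * r ^ n)}"
  defines "\<rho> \<equiv> \<lambda>x. if x \<in> E then Inf (R x) else 0"
  shows "ext_seminorm F f E \<rho>" "\<rho> x \<le> p x"
proof -
  note cl = subfield_closed[OF E]
  have nn: "0 \<le> p x" and pm: "p (x * y) \<le> p x * p y" and pa: "p (x + y) \<le> max (p x) (p y)"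
    if "x \<in> E" "y \<in> E" for x y using p that by (auto simp: ext_seminorm_def)
  have p01: "p 0 = 0" "p 1 = 1" and pF: "\<And>c. c \<in> F \<Longrightarrow> p c \<le> f c" and out: "\<And>x. x \<notin> E \<Longrightarrow> p x = 0"
    using p by (auto simp: ext_seminorm_def)
  have pw: "p (x ^ n) \<le> p x ^ n" if "x \<in> E" for x n
  proof (induction n)
    case (Suc n)
    have "p (x ^ Suc n) \<le> p x * p (x ^ n)" using pm[OF that cl(9)[OF that]] by simp
    also have "\<dots> \<le> p x * p x ^ n" using Suc nn[OF that that] by (intro mult_left_mono)
    finally show ?case by simp
  qed (simp add: p01)
  have inR: "r \<in> R x" if "x \<in> E" "p x < r" for x r
  proof -
    have "0 < r" using that nn[OF that(1) that(1)] by linarith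
    moreover have "p (x ^ n) \<le> 1 * r ^ n" for n
      using pw[OF that(1), of n] power_mono[of "p x" r n] that nn[OF that(1) that(1)] by linarith
    ultimately show ?thesis unfolding R_def by blast
  qed
  have ne: "R x \<noteq> {}" if "x \<in> E" for x using inR[OF that, of "p x + 1"] by auto
  have bdd: "bdd_below (R x)" for x by (intro bdd_belowI[of _ 0]) (auto simp: R_def)
  have up: "s \<in> R x" if "r \<in> R x" "r \<le> s" for r s x
  proof -
    obtain C where C: "0 < r" "\<And>n. p (x ^ n) \<le> C * r ^ n" using \<open>r \<in> R x\<close> by (auto simp: R_def)
    have "C \<ge> 1" using C(2)[of 0] p01 by simp
    then have "C * r ^ n \<le> C * s ^ n" for n using C(1) that(2) by (intro mult_left_mono power_mono) auto
    then have "p (x ^ n) \<le> C * s ^ n" for n using C(2) order_trans by blast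
    then show ?thesis using C(1) that(2) by (auto simp: R_def)
  qed
  have lt: "s \<in> R x" if x: "x \<in> E" "\<rho> x < s" for x s
  proof -
    obtain r where "r \<in> R x" "r < s"
      using x cInf_less_iff[OF ne[OF x(1)] bdd] by (auto simp: \<rho>_def)
    then show ?thesis using up by auto
  qed
  have le: "\<rho> x \<le> r" if "r \<in> R x" "x \<in> E" for x r
    using cInf_lower[OF that(1) bdd] that(2) by (simp add: \<rho>_def)
  have lep: "\<rho> x \<le> p x" for x
  proof (cases "x \<in> E")
    case True
    show ?thesis by (rule dense_ge, rule le[OF inR]) (use True in auto)
  qed (simp add: \<rho>_def out)
  have rnn: "0 \<le> \<rho> x" for x
    using ne by (auto simp: \<rho>_def R_def intro!: cInf_greatest)
  have R_D: "\<exists>C\<ge>1. \<forall>n. p (x ^ n) \<le> C * r ^ n" "0 < r" if "r \<in> R x" for r x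
  proof -
    obtain C where C: "0 < r" "\<And>n. p (x ^ n) \<le> C * r ^ n" using \<open>r \<in> R x\<close> by (auto simp: R_def)
    have "C \<ge> 1" using C(2)[of 0] p01 by simp
    then show "\<exists>C\<ge>1. \<forall>n. p (x ^ n) \<le> C * r ^ n" "0 < r" using C by auto
  qed
  have mult: "\<rho> (x * y) \<le> \<rho> x * \<rho> y" if xy: "x \<in> E" "y \<in> E" for x y
  proof (rule le_mult_of_greater)
    fix r s assume "\<rho> x < r" "\<rho> y < s"
    then have rs: "r \<in> R x" "s \<in> R y" using lt xy by auto
    obtain C where C: "C \<ge> 1" "\<And>n. p (x ^ n) \<le> C * r ^ n" using R_D[OF rs(1)] by blast
    obtain D where D: "D \<ge> 1" "\<And>n. p (y ^ n) \<le> D * s ^ n" using R_D[OF rs(2)] by blast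
    have pos: "0 < r" "0 < s" using R_D rs by auto
    have "p ((x * y) ^ n) \<le> (C * D) * (r * s) ^ n" for n
    proof -
      have "p ((x * y) ^ n) \<le> p (x ^ n) * p (y ^ n)"
        using xy cl by (simp add: power_mult_distrib pm)
      also have "\<dots> \<le> (C * r ^ n) * (D * s ^ n)"
        using C D pos nn cl xy by (intro mult_mono) auto
      finally show ?thesis by (simp add: power_mult_distrib algebra_simps)
    qed
    then have "r * s \<in> R (x * y)" using pos unfolding R_def by (auto intro!: exI[of _ "C * D"])
    then show "\<rho> (x * y) \<le> r * s" using le xy cl by auto
  qed
  have psum: "p (sum h I) \<le> M" if "finite I" "\<And>i. i \<in> I \<Longrightarrow> h i \<in> E" "\<And>i. i \<in> I \<Longrightarrow> p (h i) \<le> M" "0 \<le> M"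
    for h :: "nat \<Rightarrow> 'a" and I M
    using that
  proof (induction I rule: finite_induct)
    case (insert i I)
    then show ?case using pa[of "h i" "sum h I"] subfield_sum[OF E, of I h] by fastforce
  qed (simp add: p01)
  have pnat: "p (of_nat n) \<le> 1" for n
  proof (induction n)
    case (Suc n)
    then show ?case using pa[of 1 "of_nat n"] cl p01 by auto
  qed (simp add: p01)
  have add: "\<rho> (x + y) \<le> max (\<rho> x) (\<rho> y)" if xy: "x \<in> E" "y \<in> E" for x y
  proof (rule dense_ge)
    fix r assume "max (\<rho> x) (\<rho> y) < r"
    then have rs: "r \<in> R x" "r \<in> R y" using lt xy by auto
    obtain C where C: "C \<ge> 1" "\<And>n. p (x ^ n) \<le> C * r ^ n" using R_D[OF rs(1)] by blast
    obtain D where D: "D \<ge> 1" "\<And>n. p (y ^ n) \<le> D * r ^ n" using R_D[OF rs(2)] by blast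
    have pos: "0 < r" using R_D rs by auto
    \<comment> \<open>By the ultrametric inequality it suffices to bound each binomial term, and
      integers have seminorm at most 1, so no factor depending on \<open>n\<close> appears.\<close>
    have "p ((x + y) ^ n) \<le> (C * D) * r ^ n" for n
      unfolding binomial_ring
    proof (rule psum)
      fix k assume k: "k \<in> {..n}"
      have "p (of_nat (n choose k) * x ^ k * y ^ (n - k)) \<le> p (of_nat (n choose k) * x ^ k) * p (y ^ (n - k))"
        using xy cl by (intro pm) auto
      also have "\<dots> \<le> (p (of_nat (n choose k)) * p (x ^ k)) * p (y ^ (n - k))"
        using xy cl nn by (intro mult_right_mono pm) auto
      also have "\<dots> \<le> (1 * (C * r ^ k)) * (D * r ^ (n - k))"
        using pnat C D xy cl nn pos by (intro mult_mono) (auto intro!: mult_nonneg_nonneg)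
      also have "\<dots> = (C * D) * (r ^ k * r ^ (n - k))" by (simp add: algebra_simps)
      also have "\<dots> = (C * D) * r ^ n" using k by (simp add: power_add[symmetric])
      finally show "p (of_nat (n choose k) * x ^ k * y ^ (n - k)) \<le> (C * D) * r ^ n" .
    qed (use xy cl C D pos in auto)
    then have "r \<in> R (x + y)" using pos unfolding R_def by blast
    then show "\<rho> (x + y) \<le> r" using le xy cl by auto
  qed
  have one: "\<rho> 1 = 1"
  proof (rule antisym)
    show "\<rho> 1 \<le> 1" using lep[of 1] p01 by simp
    show "1 \<le> \<rho> 1"
    proof (rule ccontr)
      assume "\<not> ?thesis"
      then obtain r where r: "\<rho> 1 < r" "r < 1" using dense[of "\<rho> 1" 1] by auto
      then have rR: "r \<in> R 1" using lt cl by auto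
      obtain C where C: "C \<ge> 1" "\<And>n. p (1 ^ n) \<le> C * r ^ n" using R_D[OF rR] by blast
      have "(\<lambda>n. C * r ^ n) \<longlonglongrightarrow> C * 0"
        using r R_D(2)[OF rR] by (intro tendsto_intros LIMSEQ_power_zero) auto
      then have "1 \<le> C * 0" by (rule LIMSEQ_le_const) (use C(2) p01 in auto)
      then show False by simp
    qed
  qed
  have "\<rho> 0 = 0" using lep[of 0] rnn[of 0] p01 by simp
  moreover have "\<rho> c \<le> f c" if "c \<in> F" for c using lep[of c] pF[OF that] by linarith
  moreover have "\<rho> x = 0" if "x \<notin> E" for x using that by (simp add: \<rho>_def)
  ultimately show "ext_seminorm F f E \<rho>"
    unfolding ext_seminorm_def using rnn mult add one by (intro conjI allI ballI impI) simp_all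
  show "\<rho> x \<le> p x" by (rule lep)
qed

text \<open>A minimal seminorm equals its spectral radius, hence is power-multiplicative, and it equals
  every smoothing \<open>x \<mapsto> inf\<^sub>n p (x c\<^sup>n) / p c ^ n\<close>, hence is multiplicative.\<close>
lemma ext_seminorm_minimal_mult:
  assumes E: "is_subfield E" and FE: "F \<subseteq> E" and p: "ext_seminorm F f E p"
    and min: "\<And>q. ext_seminorm F f E q \<Longrightarrow> (\<And>x. q x \<le> p x) \<Longrightarrow> q = p"
    and x: "x \<in> E" and c: "c \<in> E"
  shows "p (x * c) = p x * p c"
proof -
  note cl = subfield_closed[OF E]
  have nn: "0 \<le> p x" and pm: "p (x * y) \<le> p x * p y" and pa: "p (x + y) \<le> max (p x) (p y)"
    if "x \<in> E" "y \<in> E" for x y using p that by (auto simp: ext_seminorm_def)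
  have p01: "p 0 = 0" "p 1 = 1" and pF: "\<And>c. c \<in> F \<Longrightarrow> p c \<le> f c" and out: "\<And>x. x \<notin> E \<Longrightarrow> p x = 0"
    using p by (auto simp: ext_seminorm_def)
  let ?R = "\<lambda>x. {r. 0 < r \<and> (\<exists>C. \<forall>n. p (x ^ n) \<le> C * r ^ n)}"
  have rho: "(if x \<in> E then Inf (?R x) else 0) = p x" for x
    by (rule fun_cong[OF min[OF ext_seminorm_spectral[OF E FE p]]])
  \<comment> \<open>A growth rate \<open>s < p x * p x\<close> of \<open>x * x\<close> would give
    the rate \<open>sqrt s\<close> for \<open>x\<close>. This lies below the spectral radius of
    \<open>x\<close>, which by minimality is \<open>p x\<close>.\<close>
  have sq: "p x * p x \<le> p (x * x)" if x: "x \<in> E" for x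
  proof (rule ccontr)
    assume "\<not> ?thesis"
    then obtain r where r: "p (x * x) < r" "r < p x * p x" using dense[of "p (x*x)" "p x * p x"] by auto
    have xx: "x * x \<in> E" using x cl by auto
    have r0: "0 < r" using r(1) nn[OF xx xx] by linarith
    have lt: "Inf (?R (x * x)) < r" using rho[of "x * x"] r xx by simp
    have ne: "?R (x * x) \<noteq> {}"
    proof -
      have "p ((x*x) ^ n) \<le> 1 * (p (x*x) + 1) ^ n" for n
      proof (induction n)
        case (Suc n)
        have "p ((x*x) ^ Suc n) \<le> p (x*x) * p ((x*x) ^ n)" using pm[OF xx cl(9)[OF xx]] by simp
        also have "\<dots> \<le> (p (x*x) + 1) * (p (x*x) + 1) ^ n"
          using Suc nn[OF xx xx] nn[OF cl(9)[OF xx]  cl(9)[OF xx]] by (intro mult_mono) auto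
        finally show ?case by simp
      qed (simp add: p01)
      moreover have "0 < p (x*x) + 1" using nn[OF xx xx] by linarith
      ultimately show ?thesis by blast
    qed
    have "bdd_below (?R (x * x))" by (intro bdd_belowI[of _ 0]) auto
    then obtain s where s: "s \<in> ?R (x * x)" "s < r" using lt cInf_less_iff[OF ne] by blast
    then obtain C where C: "0 < s" "\<And>n. p ((x * x) ^ n) \<le> C * s ^ n" by auto
    have C1: "1 \<le> C" using C(2)[of 0] p01 by simp
    define t where "t = sqrt s"
    have t: "0 < t" "t * t = s" using C(1) by (auto simp: t_def)
    \<comment> \<open>The second entry pays for the one factor \<open>x\<close> left over in an odd
      power.\<close>
    define D where "D = max C (C * p x / t)"
    have "p (x ^ n) \<le> D * t ^ n" for n
    proof (cases "even n")
      case True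
      then obtain m where m: "n = 2 * m" by auto
      have "p (x ^ n) \<le> C * t ^ n"
        using C(2)[of m] by (simp add: m power_mult power2_eq_square t)
      also have "\<dots> \<le> D * t ^ n" using t by (intro mult_right_mono) (auto simp: D_def)
      finally show ?thesis .
    next
      case False
      then obtain m where m: "n = Suc (2 * m)" by (auto elim!: oddE)
      have "p (x ^ n) \<le> p x * p ((x * x) ^ m)"
        using pm[OF x cl(9)[OF xx, of m]] by (simp add: m power_mult power2_eq_square)
      also have "\<dots> \<le> p x * (C * s ^ m)" using C(2) nn[OF x x] by (intro mult_left_mono)
      also have "\<dots> = (C * p x / t) * t ^ n"
        using t by (simp add: m power_mult power2_eq_square)
      also have "\<dots> \<le> D * t ^ n" using t by (intro mult_right_mono) (auto simp: D_def)
      finally show ?thesis .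
    qed
    then have "t \<in> ?R x" using t(1) by blast
    then have "Inf (?R x) \<le> t" by (intro cInf_lower bdd_belowI[of _ 0]) auto
    then have "p x \<le> t" using rho[of x] x by simp
    then have "p x * p x \<le> t * t" using nn[OF x x] t(1) by (intro mult_mono) auto
    then show False using t(2) s(2) r(2) by linarith
  qed
  show ?thesis
  proof (cases "c = 0")
    case True
    then show ?thesis using p01 by simp
  next
    case c0: False
    have pc: "0 < p c"
    proof -
      have "1 \<le> p c * p (inverse c)" using pm[OF c cl(6)[OF c]] c0 p01 by simp
      then show ?thesis using nn[OF c c] by (cases "p c = 0") auto
    qed
    have pw2: "p c ^ (2 ^ n) \<le> p (c ^ (2 ^ n))" for n
    proof (induction n)
      case (Suc n)
      have "p c ^ (2 ^ Suc n) = p c ^ (2 ^ n) * p c ^ (2 ^ n)" by (simp add: power_add[symmetric] mult_2)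
      also have "\<dots> \<le> p (c ^ (2 ^ n)) * p (c ^ (2 ^ n))" using Suc pc nn c cl by (intro mult_mono) auto
      also have "\<dots> \<le> p (c ^ (2 ^ n) * c ^ (2 ^ n))" using c cl by (intro sq) auto
      also have "\<dots> = p (c ^ (2 ^ Suc n))" by (simp add: power_add[symmetric] mult_2)
      finally show ?case .
    qed simp
    have pwle: "p (c ^ n) \<le> p c ^ n" for n
    proof (induction n)
      case (Suc n)
      have "p (c ^ Suc n) \<le> p c * p (c ^ n)" using pm[OF c cl(9)[OF c]] by simp
      also have "\<dots> \<le> p c * p c ^ n" using Suc pc by (intro mult_left_mono) auto
      finally show ?case by simp
    qed (simp add: p01)
    \<comment> \<open>Squares control only exponents \<open>2^n\<close>. For general
      \<open>n\<close> the complementary factor \<open>c ^ (2^n - n)\<close> is estimated from above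
      by submultiplicativity and cancelled.\<close>
    have pw: "p (c ^ n) = p c ^ n" for n
    proof (rule antisym[OF pwle])
      have n2: "n \<le> 2 ^ n" by (rule less_imp_le) (rule less_exp)
      have "p c ^ n * p c ^ (2 ^ n - n) \<le> p (c ^ (2 ^ n))" using pw2[of n] n2 by (simp add: power_add[symmetric])
      also have "\<dots> = p (c ^ n * c ^ (2 ^ n - n))" using n2 by (simp add: power_add[symmetric])
      also have "\<dots> \<le> p (c ^ n) * p (c ^ (2 ^ n - n))" using c cl by (intro pm) auto
      also have "\<dots> \<le> p (c ^ n) * p c ^ (2 ^ n - n)" using pwle nn c cl by (intro mult_left_mono) auto
      finally show "p c ^ n \<le> p (c ^ n)" using pc by simp
    qed
    let ?a = "\<lambda>n x. p (x * c ^ n) / p c ^ n"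
    have dec: "?a (n + m) x \<le> ?a n x" if x: "x \<in> E" for n m x
    proof -
      have "p (x * c ^ (n + m)) \<le> p (x * c ^ n) * p (c ^ m)"
        using pm[of "x * c ^ n" "c ^ m"] x c cl by (simp add: power_add mult.assoc)
      then show ?thesis using pc by (simp add: pw power_add field_simps)
    qed
    \<comment> \<open>The infimum of this decreasing sequence is again admissible, so minimality
      makes it equal to \<open>p\<close>; comparison with the term of index 1 gives the missing
      inequality \<open>p x * p c \<le> p (x * c)\<close>.\<close>
    have "ext_seminorm F f E (\<lambda>x. if x \<in> E then INF n\<in>UNIV. ?a n x else 0)"
    proof (rule ext_seminorm_Inf[OF E FE])
      fix i j :: nat
      have "?a (i + j) (x * y) \<le> ?a i x * ?a j y \<and> ?a (i + j) (x + y) \<le> max (?a i x) (?a j y)"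
        if xy: "x \<in> E" "y \<in> E" for x y
      proof
        have "p ((x * c ^ i) * (y * c ^ j)) \<le> p (x * c ^ i) * p (y * c ^ j)"
          using xy c cl by (intro pm) auto
        then show "?a (i + j) (x * y) \<le> ?a i x * ?a j y"
          using pc by (simp add: power_add field_simps)
        have "p (x * c ^ (i + j) + y * c ^ (i + j)) \<le> max (p (x * c ^ (i + j))) (p (y * c ^ (i + j)))"
          using xy c cl by (intro pa) auto
        then have "?a (i + j) (x + y) \<le> max (?a (i + j) x) (?a (i + j) y)"
          using pc by (auto simp: distrib_right le_max_iff_disj divide_right_mono)
        then show "?a (i + j) (x + y) \<le> max (?a i x) (?a j y)"
          using dec[OF xy(1), of i j] dec[OF xy(2), of j i] by (simp add: add.commute)
      qed
      then show "\<exists>k\<in>UNIV. \<forall>x\<in>E. \<forall>y\<in>E. ?a k (x * y) \<le> ?a i x * ?a j y \<and> ?a k (x + y) \<le> max (?a i x) (?a j y)"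
        by blast
    next
      fix i x assume "x \<in> E" then show "0 \<le> ?a i x" using pc nn c cl by auto
    next
      fix i show "?a i 0 = 0 \<and> ?a i 1 = 1" using pc by (simp add: p01 pw)
    next
      fix i :: nat and d assume d: "d \<in> F"
      then show "?a i d \<le> f d" using dec[of d 0 i] pF[OF d] FE by fastforce
    qed simp
    moreover have bdd: "bdd_below (range (\<lambda>n. ?a n x))" if "x \<in> E" for x
      using that nn pc c cl by (intro bdd_belowI[of _ 0]) auto
    have le: "(INF n\<in>UNIV. ?a n x) \<le> ?a n x" if "x \<in> E" for x n
      by (rule cINF_lower[OF bdd[OF that]]) simp
    have "(if x \<in> E then INF n\<in>UNIV. ?a n x else 0) \<le> p x" for x
      using le[of x 0] out by auto
    ultimately have "(\<lambda>x. if x \<in> E then INF n\<in>UNIV. ?a n x else 0) = p" by (intro min) auto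
    from fun_cong[OF this, of x] have "(INF n\<in>UNIV. ?a n x) = p x" by (simp only: x if_True)
    then have "p x \<le> p (x * c) / p c" using le[OF x, of 1] by simp
    then have "p x * p c \<le> p (x * c)" using pc by (simp add: field_simps)
    then show ?thesis using pm[OF x c] by simp
  qed
qed

text \<open>The largest matrix entry of multiplication by \<open>x\<close> is the initial seminorm:
  unlike the largest coordinate of \<open>x\<close>, it is submultiplicative by the ultrametric
  inequality, and it equals \<open>f\<close> on \<open>F\<close>. Minimization might lower the
  values on \<open>F\<close>, but the bound \<open>p \<le> f\<close> at \<open>c\<close> and at
  \<open>inverse c\<close>, together with multiplicativity, forces equality.\<close>

theorem nonarch_extension_exists:
  assumes f: "nonarch F f" and E: "is_subfield E" and FE: "F \<subseteq> E" and B: "is_basis F E B"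
  shows "\<exists>g. nonarch E g \<and> (\<forall>x\<in>F. g x = f x)"
proof -
  interpret nonarch F f by fact
  note clE = subfield_closed[OF E]
  have finB: "finite B" and BE: "B \<subseteq> E" and Bne: "B \<noteq> {}"
    using B basis_nonempty[OF E B] by (auto simp: is_basis_def)
  define N where "N = (\<lambda>x. Max ((\<lambda>(b,b'). f (coord F B (x * b) b')) ` (B \<times> B)))"
  have fin: "finite ((\<lambda>(b,b'). f (coord F B (x * b) b')) ` (B \<times> B))" for x using finB by simp
  have ne: "(\<lambda>(b,b'). f (coord F B (x * b) b')) ` (B \<times> B) \<noteq> {}" for x using Bne by simp
  have Nge: "f (coord F B (x * b) b') \<le> N x" if "b \<in> B" "b' \<in> B" for x b b'
    unfolding N_def by (rule Max_ge[OF fin]) (use that in auto)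
  have Nle: "N x \<le> r" if "\<And>b b'. b \<in> B \<Longrightarrow> b' \<in> B \<Longrightarrow> f (coord F B (x * b) b') \<le> r" for x r
    unfolding N_def using that by (subst Max_le_iff[OF fin ne]) auto
  obtain b0 where b0: "b0 \<in> B" using Bne by auto
  have xb: "x * b \<in> E" if "x \<in> E" "b \<in> B" for x b using that BE clE by auto
  have cF: "coord F B v b \<in> F" if "v \<in> E" for v b by (rule coord_in[OF sub B that])
  have Nnn: "0 \<le> N x" if "x \<in> E" for x
    using order_trans[OF nonneg[OF cF[OF xb[OF that b0]]] Nge[OF b0 b0]] .
  have Nc: "N c = f c" if c: "c \<in> F" for c
  proof (rule antisym)
    have co: "coord F B (c * b) b' = (if b' = b then c else 0)" if "b \<in> B" "b' \<in> B" for b b'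
    proof -
      have "coord F B (c * b) b' = c * coord F B b b'"
        using that BE c by (intro coord_scale[OF sub B]) auto
      then show ?thesis using coord_basis_element[OF sub B that(2,1)] by simp
    qed
    show "N c \<le> f c" by (rule Nle) (auto simp: co nonneg c)
    show "f c \<le> N c" using Nge[OF b0 b0, of c] co[OF b0 b0] by simp
  qed
  let ?p = "\<lambda>x. if x \<in> E then N x else 0"
  have "ext_seminorm F f E ?p"
    unfolding ext_seminorm_def
  proof (intro conjI allI impI ballI)
    fix x y assume xy: "x \<in> E" "y \<in> E"
    have "N (x * y) \<le> N x * N y"
    proof (rule Nle)
      fix b b'' assume b: "b \<in> B" "b'' \<in> B"
      have yb: "y * b \<in> E" by (rule xb[OF xy(2) b(1)])
      have "(x * y) * b = x * (\<Sum>b'\<in>B. coord F B (y * b) b' * b')"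
        using coord_sum[OF sub B yb] by (simp add: mult.assoc)
      then have eq: "(x * y) * b = (\<Sum>b'\<in>B. coord F B (y * b) b' * (x * b'))"
        by (simp add: sum_distrib_left algebra_simps)
      have "coord F B ((x * y) * b) b'' = (\<Sum>b'\<in>B. coord F B (y * b) b' * coord F B (x * b') b'')"
        unfolding eq using xb[OF xy(1)] cF[OF yb] by (intro coord_linear[OF sub B b(2) finB]) auto
      moreover have "f (\<Sum>b'\<in>B. coord F B (y * b) b' * coord F B (x * b') b'') \<le> N x * N y"
      proof (rule sum_le)
        fix b' assume b': "b' \<in> B"
        have inF: "coord F B (y * b) b' \<in> F" "coord F B (x * b') b'' \<in> F" using cF xb xy b b' by auto
        then show "coord F B (y * b) b' * coord F B (x * b') b'' \<in> F" by (rule cl)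
        have "f (coord F B (x * b') b'') * f (coord F B (y * b) b') \<le> N x * N y"
          using inF nonneg b b' Nnn xy by (intro mult_mono Nge) auto
        then show "f (coord F B (y * b) b' * coord F B (x * b') b'') \<le> N x * N y"
          using inF by (simp add: mult mult.commute)
      qed (use Nnn xy in auto)
      ultimately show "f (coord F B ((x * y) * b) b'') \<le> N x * N y" by simp
    qed
    then show "?p (x * y) \<le> ?p x * ?p y" using xy clE by simp
    have "N (x + y) \<le> max (N x) (N y)"
    proof (rule Nle)
      fix b b' assume b: "b \<in> B" "b' \<in> B"
      have "coord F B ((x + y) * b) b' = coord F B (x * b) b' + coord F B (y * b) b'"
        unfolding distrib_right using xb xy b by (intro coord_add[OF sub B]) auto
      also have "f \<dots> \<le> max (f (coord F B (x * b) b')) (f (coord F B (y * b) b'))"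
        using cF xb xy b by (intro ultra) auto
      also have "\<dots> \<le> max (N x) (N y)" using b by (intro max.mono Nge) auto
      finally show "f (coord F B ((x + y) * b) b') \<le> max (N x) (N y)" .
    qed
    then show "?p (x + y) \<le> max (?p x) (?p y)" using xy clE by simp
  next
    show "?p 0 = 0" using Nc[of 0] cl by simp
    show "?p 1 = 1" using Nc[of 1] cl clE by simp
    show "?p c \<le> f c" if "c \<in> F" for c using Nc[OF that] that FE by auto
  qed (use Nnn in auto)
  then obtain p where p: "ext_seminorm F f E p"
    and min: "\<And>q. ext_seminorm F f E q \<Longrightarrow> (\<And>x. q x \<le> p x) \<Longrightarrow> q = p"
    using ext_seminorm_minimal_exists[OF E FE] by blast
  have m: "p (x * y) = p x * p y" if "x \<in> E" "y \<in> E" for x y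
    using ext_seminorm_minimal_mult[OF E FE p min that] by blast
  have pp: "\<And>x. x \<in> E \<Longrightarrow> 0 \<le> p x" "p 0 = 0" "p 1 = 1" "\<And>c. c \<in> F \<Longrightarrow> p c \<le> f c"
    "\<And>x y. x \<in> E \<Longrightarrow> y \<in> E \<Longrightarrow> p (x + y) \<le> max (p x) (p y)"
    using p by (auto simp: ext_seminorm_def)
  have nz: "p x \<noteq> 0" if x: "x \<in> E" "x \<noteq> 0" for x
  proof
    assume "p x = 0"
    then show False using m[OF x(1) clE(6)[OF x(1)]] x(2) pp(3) by simp
  qed
  have "nonarch E p"
  proof
    have "p (x + y) \<le> p x + p y" if "x \<in> E" "y \<in> E" for x y
      using pp(5)[OF that] pp(1)[OF that(1)] pp(1)[OF that(2)] by linarith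
    then show "is_absval E p" unfolding is_absval_def using pp m nz by blast
  qed (use E pp in auto)
  moreover have "p c = f c" if c: "c \<in> F" for c
  proof (cases "c = 0")
    case False
    have "inverse (f c) = f (inverse c)" using inv[OF c] by simp
    also have "\<dots> \<ge> p (inverse c)" using pp(4) cl(6)[OF c] by blast
    finally have "p c * p (inverse c) \<le> p c * inverse (f c)" using pp(1) c FE by (intro mult_left_mono) auto
    moreover have "p c * p (inverse c) = 1" using m[of c "inverse c"] c cl(6)[OF c] FE False pp(3) by auto
    ultimately have "f c \<le> p c" using pos[OF c False] by (simp add: field_simps)
    then show ?thesis using pp(4)[OF c] by simp
  qed (simp add: pp)
  ultimately show ?thesis by blast
qed

section \<open>Local fields and their finite extensions\<close>

lemma power_int_strict_antimono:
  fixes u :: real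
  assumes "0 < u" "u < 1" "i < j"
  shows "u powi j < u powi i"
proof -
  have "u powi j = u powi i * u ^ nat (j - i)"
    using assms power_int_add[of u i "j - i"] by (simp add: power_int_def)
  moreover have "u ^ nat (j - i) < 1" using assms by (intro power_Suc_less_one[THEN order.strict_trans2, of u] | simp add: power_less_one_iff)+
  ultimately show ?thesis using zero_less_power_int[OF assms(1), of i] by simp
qed

lemma power_int_inj:
  fixes u :: real
  assumes "0 < u" "u < 1" "u powi i = u powi j"
  shows "i = j"
  using power_int_strict_antimono[OF assms(1,2), of i j] power_int_strict_antimono[OF assms(1,2), of j i] assms(3)
  by (cases i j rule: linorder_cases) auto

lemma power_int_le_iff:
  fixes u :: real
  assumes "0 < u" "u < 1"
  shows "u powi i \<le> u powi j \<longleftrightarrow> j \<le> i"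
  using power_int_strict_antimono[OF assms, of i j] power_int_strict_antimono[OF assms, of j i]
  by (cases i j rule: linorder_cases) auto

lemma powr_int_eq: "0 < (u::real) \<Longrightarrow> u powr real_of_int j = u powi j"
  by (rule powr_real_of_int') auto

lemma power_int_bracket:
  fixes u v :: real
  assumes "0 < u" "u < 1" "0 < v"
  shows "\<exists>j::int. u powi (j + 1) < v \<and> v \<le> u powi j"
proof -
  define j where "j = \<lfloor>log u v\<rfloor>"
  have v: "v = u powr (log u v)" using assms by simp
  have "u powr real_of_int (j + 1) < u powr (log u v)"
    using assms by (intro powr_less_mono') (auto simp: j_def)
  moreover have "u powr (log u v) \<le> u powr real_of_int j"
    using assms by (intro powr_mono') (auto simp: j_def)
  ultimately have "u powi (j + 1) < v" "v \<le> u powi j"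
    using v assms(1) by (simp_all only: powr_int_eq)
  then show ?thesis by blast
qed

text \<open>Uniformizer and its value are parameters, so that the same notion applies to
  \<open>k\<close> and to every layer with one common absolute value, which is not the normalized
  one of the layer.\<close>

locale local_field = nonarch F g for F :: "'a::field set" and g +
  fixes \<omega> :: 'a and \<theta> :: real
  assumes unif: "\<omega> \<in> F" "g \<omega> = \<theta>" and \<theta>: "0 < \<theta>" "\<theta> < 1"
    and vals: "\<And>x. x \<in> F \<Longrightarrow> x \<noteq> 0 \<Longrightarrow> \<exists>j::int. g x = \<theta> powi j"
    and complete: "\<And>s::nat \<Rightarrow> 'a. (\<And>i. s i \<in> F) \<Longrightarrow>
        (\<And>\<epsilon>. \<epsilon> > 0 \<Longrightarrow> \<exists>N. \<forall>i\<ge>N. \<forall>j\<ge>N. g (s i - s j) < \<epsilon>) \<Longrightarrow>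
        \<exists>l\<in>F. \<forall>\<epsilon>>0. \<exists>N. \<forall>i\<ge>N. g (s i - l) < \<epsilon>"
    and finite_residue: "finite (residue_classes F g)"
begin

lemma unif_powi: "\<omega> powi j \<in> F" "g (\<omega> powi j) = \<theta> powi j" "\<omega> powi j \<noteq> 0"
proof -
  show "\<omega> powi j \<in> F" "g (\<omega> powi j) = \<theta> powi j" using cl(11) power_int unif by auto
  have "g (\<omega> powi j) \<noteq> 0" using \<open>g (\<omega> powi j) = \<theta> powi j\<close> zero_less_power_int[OF \<theta>(1), of j] by linarith
  then show "\<omega> powi j \<noteq> 0" using zero by metis
qed

lemma lt_one: "x \<in> F \<Longrightarrow> g x < 1 \<Longrightarrow> g x \<le> \<theta>"
proof (cases "x = 0")
  case False
  assume x: "x \<in> F" "g x < 1"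
  obtain j where j: "g x = \<theta> powi j" using vals[OF x(1) False] by auto
  then have "\<theta> powi j < \<theta> powi 0" using x by simp
  then have "1 \<le> j" using power_int_le_iff[OF \<theta>, of 0 j] by (cases "1 \<le> j") auto
  then show ?thesis using power_int_le_iff[OF \<theta>, of j 1] by (simp add: j)
qed (use \<theta> in simp)

lemma nonarch_local_field_lf: "nonarch_local_field F g"
proof -
  have "\<exists>p\<in>F. 0 < g p \<and> g p < 1 \<and> (\<forall>x\<in>F. x \<noteq> 0 \<longrightarrow> (\<exists>j::int. g x = g p powr real_of_int j))"
    using unif \<theta> vals powr_int_eq[OF \<theta>(1)] by (intro bexI[of _ \<omega>]) auto
  moreover have "\<exists>l\<in>F. \<forall>\<epsilon>>0. \<exists>N. \<forall>i\<ge>N. g (s i - l) < \<epsilon>"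
    if "\<forall>i. s i \<in> F" "\<forall>\<epsilon>>0. \<exists>N. \<forall>i\<ge>N. \<forall>j\<ge>N. g (s i - s j) < \<epsilon>" for s :: "nat \<Rightarrow> 'a"
    by (rule complete) (use that in auto)
  ultimately show ?thesis
    unfolding nonarch_local_field_def using sub absval ultra finite_residue
    by (intro conjI allI impI ballI) simp_all
qed

section \<open>Total boundedness and separability of local fields\<close>

lemma residue_reps:
  "\<exists>R. finite R \<and> R \<subseteq> F \<and> (\<forall>x\<in>F. g x \<le> 1 \<longrightarrow> (\<exists>r\<in>R. g (x - r) < 1))"
proof -
  define R where "R = (\<lambda>C. SOME x. x \<in> C) ` residue_classes F g"
  have mem: "(SOME x. x \<in> C) \<in> C" if CR: "C \<in> residue_classes F g" for C
  proof -
    obtain x where "x \<in> F" "g x \<le> 1" "C = {y\<in>F. g y \<le> 1 \<and> g (y - x) < 1}"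
      using CR by (auto simp: residue_classes_def)
    then have "x \<in> C" by simp
    then show ?thesis by (rule someI)
  qed
  have "C \<subseteq> F" if "C \<in> residue_classes F g" for C using that by (auto simp: residue_classes_def)
  then have "R \<subseteq> F" using mem unfolding R_def by blast
  moreover have "\<exists>r\<in>R. g (x - r) < 1" if x: "x \<in> F" "g x \<le> 1" for x
  proof -
    let ?C = "{y\<in>F. g y \<le> 1 \<and> g (y - x) < 1}"
    have C: "?C \<in> residue_classes F g" using x by (auto simp: residue_classes_def)
    then have "(SOME y. y \<in> ?C) \<in> R" unfolding R_def by (rule imageI)
    moreover have "g (x - (SOME y. y \<in> ?C)) < 1"
      using mem[OF C] commute[of x] x(1) by simp
    ultimately show ?thesis by blast
  qed
  ultimately show ?thesis using finite_residue by (intro exI[of _ R]) (auto simp: R_def)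
qed

text \<open>Digit expansion: an approximation to within \<open>\<theta> ^ n\<close> leaves an error
  which, divided by \<open>\<omega> ^ n\<close>, is integral and has a residue representative as its
  next digit.\<close>

lemma totally_bounded_unit_ball:
  "\<exists>A. finite A \<and> A \<subseteq> F \<and> (\<forall>x\<in>F. g x \<le> 1 \<longrightarrow> (\<exists>a\<in>A. g (x - a) \<le> \<theta> ^ n))"
proof (induction n)
  case 0
  show ?case using cl(1) by (intro exI[of _ "{0}"]) auto
next
  case (Suc n)
  then obtain A where A: "finite A" "A \<subseteq> F" "\<And>x. x \<in> F \<Longrightarrow> g x \<le> 1 \<Longrightarrow> \<exists>a\<in>A. g (x - a) \<le> \<theta> ^ n" by blast
  obtain R where R: "finite R" "R \<subseteq> F" "\<And>x. x \<in> F \<Longrightarrow> g x \<le> 1 \<Longrightarrow> \<exists>r\<in>R. g (x - r) < 1"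
    using residue_reps by blast
  let ?A = "(\<lambda>(a,r). a + \<omega> ^ n * r) ` (A \<times> R)"
  have "\<exists>b\<in>?A. g (x - b) \<le> \<theta> ^ Suc n" if x: "x \<in> F" "g x \<le> 1" for x
  proof -
    obtain a where a: "a \<in> A" "g (x - a) \<le> \<theta> ^ n" using A(3)[OF x] by auto
    have w: "\<omega> ^ n \<in> F" "g (\<omega> ^ n) = \<theta> ^ n" "\<omega> ^ n \<noteq> 0"
      using cl(9) unif power zero \<theta> by auto
    have xa: "x - a \<in> F" using x a A cl by auto
    have y: "(x - a) / \<omega> ^ n \<in> F" "g ((x - a) / \<omega> ^ n) \<le> 1"
      using xa w a(2) \<theta> by (auto simp: divide cl)
    obtain r where r: "r \<in> R" "g ((x - a) / \<omega> ^ n - r) < 1" using R(3)[OF y] by auto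
    have rF: "r \<in> F" using r R by auto
    have "g ((x - a) / \<omega> ^ n - r) \<le> \<theta>" using r(2) y rF cl by (intro lt_one) auto
    moreover have "x - (a + \<omega> ^ n * r) = \<omega> ^ n * ((x - a) / \<omega> ^ n - r)"
      using w(3) by (simp add: field_simps)
    ultimately have "g (x - (a + \<omega> ^ n * r)) \<le> \<theta> ^ Suc n"
      using w y rF cl \<theta> by (simp add: mult)
    then show ?thesis using a(1) r(1) by (intro bexI[of _ "a + \<omega> ^ n * r"]) auto
  qed
  moreover have "?A \<subseteq> F" using A(2) R(2) unif(1) by (auto intro!: cl(3,5,9))
  ultimately show ?case using A(1) R(1) by (intro exI[of _ ?A]) auto
qed

lemma totally_bounded:
  assumes "0 < \<epsilon>"
  shows "\<exists>A. finite A \<and> A \<subseteq> F \<and> (\<forall>x\<in>F. g x \<le> r \<longrightarrow> (\<exists>a\<in>A. g (x - a) < \<epsilon>))"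
proof -
  obtain j where j: "max r 1 \<le> \<theta> powi j" 
    using power_int_bracket[OF \<theta>, of "max r 1"] by fastforce
  have tp: "0 < \<theta> powi j" using \<theta> by simp
  then have "0 < \<epsilon> / \<theta> powi j" using assms by simp
  then obtain n where n: "\<theta> ^ n < \<epsilon> / \<theta> powi j" using real_arch_pow_inv \<theta> by blast
  obtain A where A: "finite A" "A \<subseteq> F" "\<And>x. x \<in> F \<Longrightarrow> g x \<le> 1 \<Longrightarrow> \<exists>a\<in>A. g (x - a) \<le> \<theta> ^ n"
    using totally_bounded_unit_ball[of n] by blast
  have "\<exists>a\<in>(\<lambda>a. \<omega> powi j * a) ` A. g (x - a) < \<epsilon>" if x: "x \<in> F" "g x \<le> r" for x
  proof -
    have y: "x / \<omega> powi j \<in> F" using x unif_powi cl by auto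
    have "g (x / \<omega> powi j) \<le> 1" using x j tp by (simp add: divide unif_powi)
    then obtain a where a: "a \<in> A" "g (x / \<omega> powi j - a) \<le> \<theta> ^ n" using A(3)[OF y] by auto
    have aF: "a \<in> F" using a A by auto
    have "x - \<omega> powi j * a = \<omega> powi j * (x / \<omega> powi j - a)"
      using unif_powi(3) by (simp add: field_simps)
    then have "g (x - \<omega> powi j * a) = \<theta> powi j * g (x / \<omega> powi j - a)"
      using unif_powi y aF cl by (simp add: mult)
    also have "\<dots> \<le> \<theta> powi j * \<theta> ^ n" using a tp by (intro mult_left_mono) auto
    also have "\<dots> < \<epsilon>" using n tp by (simp add: field_simps)
    finally show ?thesis using a(1) by blast
  qed
  moreover have "(\<lambda>a. \<omega> powi j * a) ` A \<subseteq> F" using A unif_powi cl by auto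
  ultimately show ?thesis using A(1) by (intro exI[of _ "(\<lambda>a. \<omega> powi j * a) ` A"]) auto
qed

text \<open>Serves twice: to replace uncountably many almost-everywhere statements by countably
  many, and to list the balls that generate the Borel sets.\<close>

lemma separable: "\<exists>D. countable D \<and> D \<subseteq> F \<and> (\<forall>x\<in>F. \<forall>\<epsilon>>0. \<exists>d\<in>D. g (x - d) < \<epsilon>)"
proof -
  have "\<forall>n m::nat. \<exists>A. finite A \<and> A \<subseteq> F \<and> (\<forall>x\<in>F. g x \<le> real n \<longrightarrow> (\<exists>a\<in>A. g (x - a) < inverse (Suc m)))"
    by (intro allI totally_bounded) simp
  then obtain A where A: "\<And>n m::nat. finite (A n m) \<and> A n m \<subseteq> F \<and>
      (\<forall>x\<in>F. g x \<le> real n \<longrightarrow> (\<exists>a\<in>A n m. g (x - a) < inverse (Suc m)))" by metis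
  show ?thesis
  proof (intro exI[of _ "\<Union>n m. A n m"] conjI ballI allI impI)
    show "countable (\<Union>n m. A n m)" using A by (intro countable_UN countableI_type) (auto intro: countable_finite)
    show "(\<Union>n m. A n m) \<subseteq> F" using A by blast
    fix x and \<epsilon> :: real assume x: "x \<in> F" "0 < \<epsilon>"
    obtain n where n: "g x \<le> real n" using real_arch_simple by blast
    obtain m where m: "inverse (real (Suc m)) < \<epsilon>" using reals_Archimedean[OF x(2)] by auto
    obtain a where "a \<in> A n m" "g (x - a) < inverse (Suc m)" using A[of n m] x n by blast
    then show "\<exists>d\<in>\<Union>n m. A n m. g (x - d) < \<epsilon>" using m by (intro bexI[of _ a]) auto
  qed
qed

end

lemma nonarch_local_field_imp_local_field:
  assumes "nonarch_local_field F g"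
  shows "\<exists>\<omega>. local_field F g \<omega> (g \<omega>)"
proof -
  have "\<exists>p\<in>F. 0 < g p \<and> g p < 1 \<and> (\<forall>x\<in>F. x \<noteq> 0 \<longrightarrow> (\<exists>j::int. g x = g p powr real_of_int j))"
    using assms unfolding nonarch_local_field_def by (elim conjE)
  then obtain p where p: "p \<in> F" "0 < g p" "g p < 1"
    and v: "\<forall>x\<in>F. x \<noteq> 0 \<longrightarrow> (\<exists>j::int. g x = g p powr real_of_int j)"
    by (elim bexE conjE)
  have "local_field F g p (g p)"
  proof
    show "is_subfield F" "is_absval F g" "finite (residue_classes F g)"
      using assms by (auto simp: nonarch_local_field_def)
    show "g (x + y) \<le> max (g x) (g y)" if "x \<in> F" "y \<in> F" for x y
      using assms that by (auto simp: nonarch_local_field_def)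
    show "\<exists>j::int. g x = g p powi j" if "x \<in> F" "x \<noteq> 0" for x
      using v that powr_int_eq[OF p(2)] by auto
    show "\<exists>l\<in>F. \<forall>\<epsilon>>0. \<exists>N. \<forall>i\<ge>N. g (s i - l) < \<epsilon>"
      if "\<And>i. s i \<in> F" "\<And>\<epsilon>. \<epsilon> > 0 \<Longrightarrow> \<exists>N. \<forall>i\<ge>N. \<forall>j\<ge>N. g (s i - s j) < \<epsilon>" for s :: "nat \<Rightarrow> 'a"
    proof -
      have "\<forall>i. s i \<in> F" "\<forall>\<epsilon>>0. \<exists>N. \<forall>i\<ge>N. \<forall>j\<ge>N. g (s i - s j) < \<epsilon>" using that by auto
      then show ?thesis
        using assms[unfolded nonarch_local_field_def, THEN conjunct2, THEN conjunct2, THEN conjunct2,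
            THEN conjunct2, THEN conjunct1, rule_format, of s] by simp
    qed
  qed (use p in auto)
  then show ?thesis ..
qed

text \<open>Together with the ultrametric inequality this says that the value of a combination is
  the largest of the values of its terms.\<close>

definition orthogonal_over :: "'a::field set \<Rightarrow> ('a \<Rightarrow> real) \<Rightarrow> 'a set \<Rightarrow> bool" where
  "orthogonal_over F g B \<longleftrightarrow> finite B \<and> 0 \<notin> B \<and>
     (\<forall>c. (\<forall>b\<in>B. c b \<in> F) \<longrightarrow> (\<forall>b\<in>B. g (c b) * g b \<le> g (\<Sum>b\<in>B. c b * b)))"

section \<open>Orthogonal families in a finite extension\<close>

locale local_field_ext = local_field F g \<omega> \<theta> + E: nonarch E g
  for F :: "'a::field set" and g and \<omega> and \<theta> and E :: "'a set" +
  fixes B0 :: "'a set"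
  assumes FE: "F \<subseteq> E" and B0: "is_basis F E B0"
begin

lemma FE': "x \<in> F \<Longrightarrow> x \<in> E" using FE by auto

lemma orthogonal_indep:
  assumes "orthogonal_over F g B" "B \<subseteq> E"
  shows "indep F B"
  unfolding indep_def
proof (intro conjI allI impI ballI)
  show "finite B" using assms by (simp add: orthogonal_over_def)
  fix c b assume c: "\<forall>b\<in>B. c b \<in> F" "(\<Sum>b\<in>B. c b * b) = 0" and b: "b \<in> B"
  have "g (c b) * g b \<le> g 0" using assms(1) c b unfolding orthogonal_over_def by metis
  moreover have "0 < g b" using assms b by (intro E.pos) (auto simp: orthogonal_over_def)
  ultimately have "g (c b) \<le> 0" by (simp add: mult_le_0_iff)
  then show "c b = 0" using pos[of "c b"] c b by force
qed

lemma indep_card: "indep F B \<Longrightarrow> B \<subseteq> E \<Longrightarrow> card B \<le> card B0"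
  using B0 by (intro indep_card_le[OF sub]) (auto simp: is_basis_def)

text \<open>Nonzero terms of pairwise different value cannot cancel, by the isosceles principle. The
  second conjunct carries the induction: a partial sum has the value of one of its terms, hence a
  value different from that of the next one.\<close>

lemma distinct_values_sum:
  assumes "finite I" "\<And>i. i \<in> I \<Longrightarrow> h i \<in> E"
    "\<And>i j. i \<in> I \<Longrightarrow> j \<in> I \<Longrightarrow> i \<noteq> j \<Longrightarrow> h i \<noteq> 0 \<Longrightarrow> h j \<noteq> 0 \<Longrightarrow> g (h i) \<noteq> g (h j)"
  shows "(\<forall>i\<in>I. g (h i) \<le> g (sum h I)) \<and> (sum h I \<noteq> 0 \<longrightarrow> (\<exists>j\<in>I. h j \<noteq> 0 \<and> g (sum h I) = g (h j)))"
  using assms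
proof (induction I rule: finite_induct)
  case (insert i I)
  have IH: "(\<forall>i\<in>I. g (h i) \<le> g (sum h I)) \<and> (sum h I \<noteq> 0 \<longrightarrow> (\<exists>j\<in>I. h j \<noteq> 0 \<and> g (sum h I) = g (h j)))"
    using insert.prems by (intro insert.IH) auto
  have hi: "h i \<in> E" and S: "sum h I \<in> E" using insert.prems subfield_sum[OF E.sub, of I h] by auto
  have eq: "sum h (insert i I) = h i + sum h I" using insert by simp
  consider "h i = 0" | "sum h I = 0" | "h i \<noteq> 0" "sum h I \<noteq> 0" by blast
  then show ?case
  proof cases
    case 1
    then show ?thesis using IH E.nonneg[OF S] by (auto simp: eq)
  next
    case 2
    then have "g (h j) \<le> g (h i)" if "j \<in> I" for j using IH that E.nonneg[OF hi] by fastforce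
    then show ?thesis using 2 by (auto simp: eq)
  next
    case 3
    then obtain j where j: "j \<in> I" "h j \<noteq> 0" "g (sum h I) = g (h j)" using IH by auto
    have ne: "g (h i) \<noteq> g (sum h I)" using j insert.prems(2)[of i j] 3 insert.hyps by auto
    show ?thesis
    proof (cases "g (h i) < g (sum h I)")
      case True
      then have "g (h i + sum h I) = g (sum h I)" using E.add_eq_right[OF hi S] by simp
      then show ?thesis using IH j True by (auto simp: eq)
    next
      case False
      then have lt: "g (sum h I) < g (h i)" using ne by simp
      then have "g (h i + sum h I) = g (h i)" using E.add_eq_right[OF S hi lt] by (simp add: add.commute)
      then show ?thesis using IH 3 lt by (fastforce simp: eq)
    qed
  qed
qed simp

text \<open>Coefficients in \<open>F\<close> change values only within a coset of the value group of
  \<open>F\<close>, so the terms of any combination keep different values.\<close>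

lemma distinct_cosets_orthogonal:
  assumes "finite X" "X \<subseteq> E - {0}"
    and d: "\<And>x y j. x \<in> X \<Longrightarrow> y \<in> X \<Longrightarrow> x \<noteq> y \<Longrightarrow> g x \<noteq> \<theta> powi j * g y"
  shows "orthogonal_over F g X"
  unfolding orthogonal_over_def
proof (intro conjI allI impI ballI)
  fix c x assume c: "\<forall>b\<in>X. c b \<in> F" and x: "x \<in> X"
  have "(\<forall>i\<in>X. g (c i * i) \<le> g (\<Sum>i\<in>X. c i * i))"
  proof (rule distinct_values_sum[THEN conjunct1])
    fix y z assume yz: "y \<in> X" "z \<in> X" "y \<noteq> z" "c y * y \<noteq> 0" "c z * z \<noteq> 0"
    show "g (c y * y) \<noteq> g (c z * z)"
    proof
      assume eq: "g (c y * y) = g (c z * z)"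
      obtain i j where ij: "g (c y) = \<theta> powi i" "g (c z) = \<theta> powi j"
        using vals[of "c y"] vals[of "c z"] c yz by auto
      have "\<theta> powi i * g y = \<theta> powi j * g z"
        using eq yz c assms(2) ij by (simp add: E.mult FE' subset_eq)
      then have "g y = \<theta> powi (j - i) * g z"
        using \<theta> by (simp add: power_int_diff field_simps)
      then show False using d[OF yz(1,2,3)] by blast
    qed
  qed (use assms c FE' E.cl in auto)
  then show "g (c x) * g x \<le> g (\<Sum>b\<in>X. c b * b)"
    using x c assms(2) FE' by (auto simp: E.mult subset_eq)
qed (use assms in auto)

text \<open>The ratio of two values strictly between \<open>\<theta>\<close> and 1 lies strictly
  between \<open>\<theta>\<close> and its inverse, so distinct ones lie in distinct cosets of the
  value group of \<open>F\<close>. Elements representing them are therefore independent, at most as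
  many as the degree, and a largest value below 1 exists.\<close>

lemma uniformizer_exists:
  "\<exists>\<pi>\<in>E. 0 < g \<pi> \<and> g \<pi> < 1 \<and> (\<forall>x\<in>E. g x < 1 \<longrightarrow> g x \<le> g \<pi>)"
proof -
  define V where "V = {v. \<exists>x\<in>E. v = g x \<and> \<theta> < g x \<and> g x < 1}"
  have bound: "card V' \<le> card B0" if V': "V' \<subseteq> V" "finite V'" for V'
  proof -
    have "\<forall>v\<in>V'. \<exists>x\<in>E. v = g x \<and> \<theta> < g x \<and> g x < 1" using V' by (auto simp: V_def)
    then obtain h where h: "\<And>v. v \<in> V' \<Longrightarrow> h v \<in> E \<and> v = g (h v) \<and> \<theta> < v \<and> v < 1" by metis
    have inj: "inj_on h V'" using h by (intro inj_onI) metis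
    have "orthogonal_over F g (h ` V')"
    proof (rule distinct_cosets_orthogonal)
      show "h ` V' \<subseteq> E - {0}" using h \<theta> by fastforce
      fix x y and j :: int assume "x \<in> h ` V'" "y \<in> h ` V'" "x \<noteq> y"
      then obtain v w where vw: "x = h v" "y = h w" "v \<in> V'" "w \<in> V'" "v \<noteq> w" by auto
      have gv: "g x = v" "g y = w" "\<theta> < v" "v < 1" "\<theta> < w" "w < 1" using vw h by metis+
      show "g x \<noteq> \<theta> powi j * g y"
      proof
        assume eq: "g x = \<theta> powi j * g y"
        consider "j = 0" | "1 \<le> j" | "j \<le> -1" by linarith
        then show False
        proof cases
          case 1
          then show False using eq gv vw by simp
        next
          case 2
          then have "\<theta> powi j \<le> \<theta> powi 1" using power_int_le_iff[OF \<theta>, of j 1] by simp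
          then have "\<theta> powi j * w \<le> \<theta> * w" using gv \<theta> by (intro mult_right_mono) auto
          also have "\<dots> < \<theta>" using gv \<theta> by simp
          finally show False using eq gv by simp
        next
          case 3
          then have "inverse \<theta> \<le> \<theta> powi j" using power_int_le_iff[OF \<theta>, of "-1" j] by (simp add: power_int_minus)
          then have "inverse \<theta> * w \<le> \<theta> powi j * w" using gv \<theta> by (intro mult_right_mono) auto
          moreover have "1 < inverse \<theta> * w" using gv \<theta> by (simp add: field_simps)
          ultimately show False using eq gv by simp
        qed
      qed
    qed (use V' in auto)
    then have "card (h ` V') \<le> card B0"
      using h by (intro indep_card orthogonal_indep) auto
    then show ?thesis using card_image[OF inj] by simp
  qed
  have finV: "finite V" using finite_if_finite_subsets_card_bdd[of V "card B0"] bound by blast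
  \<comment> \<open>\<open>\<theta>\<close> is included because no value need lie strictly between
    it and 1.\<close>
  define u where "u = Max (insert \<theta> V)"
  have uin: "u \<in> insert \<theta> V" unfolding u_def by (rule Max_in) (use finV in auto)
  then obtain \<pi> where \<pi>: "\<pi> \<in> E" "g \<pi> = u" using unif FE' by (auto simp: V_def)
  have "0 < u" "u < 1" using uin \<theta> by (auto simp: V_def)
  moreover have "g x \<le> u" if x: "x \<in> E" "g x < 1" for x
  proof (cases "g x \<le> \<theta>")
    case True
    then show ?thesis unfolding u_def by (rule order_trans[OF _ Max_ge]) (use finV in auto)
  next
    case False
    then have "g x \<in> V" using x by (auto simp: V_def)
    then show ?thesis using Max_ge[of "insert \<theta> V" "g x"] finV by (simp add: u_def)
  qed
  ultimately show ?thesis using \<pi> by blast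
qed

text \<open>Linear independence of the reductions over the residue field of \<open>F\<close>,
  phrased through lifts so that no residue field has to be constructed.\<close>

definition res_indep :: "'a set \<Rightarrow> bool" where
  "res_indep W \<longleftrightarrow> finite W \<and> W \<subseteq> {x\<in>E. g x \<le> 1} \<and>
     (\<forall>c. (\<forall>w\<in>W. c w \<in> F \<and> g (c w) \<le> 1) \<longrightarrow> g (\<Sum>w\<in>W. c w * w) < 1 \<longrightarrow> (\<forall>w\<in>W. g (c w) < 1))"

text \<open>Divide by the coefficient of largest value: one coefficient becomes a unit, so the
  reduced combination cannot vanish.\<close>

lemma res_indepD:
  assumes W: "res_indep W" and c: "\<And>w. w \<in> W \<Longrightarrow> c w \<in> F" and w: "w \<in> W"
  shows "g (c w) \<le> g (\<Sum>w\<in>W. c w * w)"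
proof -
  have fin: "finite W" and WE: "W \<subseteq> E" using W by (auto simp: res_indep_def)
  have "Max ((\<lambda>w. g (c w)) ` W) \<in> (\<lambda>w. g (c w)) ` W" using fin w by (intro Max_in) auto
  then obtain w0 where w0': "w0 \<in> W" "Max ((\<lambda>w. g (c w)) ` W) = g (c w0)" by auto
  have w0: "w0 \<in> W" "\<And>w. w \<in> W \<Longrightarrow> g (c w) \<le> g (c w0)"
    using w0'(1) fin unfolding w0'(2)[symmetric] by (auto intro: Max_ge)
  let ?S = "\<Sum>w\<in>W. c w * w"
  have S: "?S \<in> E" using c WE FE' by (auto intro!: subfield_sum[OF E.sub] E.cl(5))
  show ?thesis
  proof (cases "c w0 = 0")
    case True
    then have "g (c w) \<le> 0" using w0(2)[OF w] by simp
    then show ?thesis using E.nonneg[OF S] by linarith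
  next
    case False
    have p: "0 < g (c w0)" using pos c w0 False by auto
    have "\<not> g ?S < g (c w0)"
    proof
      assume lt: "g ?S < g (c w0)"
      have "(\<Sum>w\<in>W. c w / c w0 * w) = ?S / c w0" by (simp add: sum_divide_distrib)
      then have "g (\<Sum>w\<in>W. c w / c w0 * w) = g ?S / g (c w0)"
        using E.divide[OF S] FE' c w0 by simp
      then have "g (\<Sum>w\<in>W. c w / c w0 * w) < 1" using lt p by simp
      moreover have "\<forall>w\<in>W. c w / c w0 \<in> F \<and> g (c w / c w0) \<le> 1"
        using c w0 p by (auto simp: divide cl)
      ultimately have "\<forall>w\<in>W. g (c w / c w0) < 1"
        using W unfolding res_indep_def by (auto dest!: spec[of _ "\<lambda>w. c w / c w0"])
      then have "g (c w0 / c w0) < 1" using w0(1) by blast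
      then show False using False by simp
    qed
    then show ?thesis using w0(2)[OF w] by linarith
  qed
qed

lemma res_indep_norm_one:
  assumes W: "res_indep W" and w: "w \<in> W"
  shows "g w = 1"
proof -
  have fin: "finite W" using W by (auto simp: res_indep_def)
  let ?c = "\<lambda>v. if v = w then 1 else 0 :: 'a"
  have "g (?c w) \<le> g (\<Sum>v\<in>W. ?c v * v)"
    by (rule res_indepD[OF W _ w]) (use cl in auto)
  moreover have "(\<Sum>v\<in>W. ?c v * v) = (\<Sum>v\<in>W. if v = w then v else 0)" by (rule sum.cong) auto
  moreover have "\<dots> = w" using fin w by simp
  ultimately have "1 \<le> g w" by simp
  then show ?thesis using W w by (auto simp: res_indep_def)
qed

lemma res_indep_orthogonal: "res_indep W \<Longrightarrow> orthogonal_over F g W"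
proof -
  assume W: "res_indep W"
  have "0 \<notin> W" using res_indep_norm_one[OF W, of 0] by auto
  moreover have "finite W" using W by (simp add: res_indep_def)
  moreover have "g (c w) * g w \<le> g (\<Sum>w\<in>W. c w * w)" if "\<forall>w\<in>W. c w \<in> F" "w \<in> W" for c w
    using res_indepD[OF W, of c w] res_indep_norm_one[OF W that(2)] that by simp
  ultimately show ?thesis unfolding orthogonal_over_def by blast
qed

text \<open>Residue-independent sets are orthogonal, so their cardinality is bounded by the degree
  and a maximal one exists. If an integral \<open>x\<close> cannot be added to it, there is a
  residual relation whose coefficient at \<open>x\<close> is a unit, and solving for
  \<open>x\<close> gives the expansion.\<close>

lemma residue_basis_exists:
  "\<exists>W. res_indep W \<and> (\<forall>x\<in>E. g x \<le> 1 \<longrightarrow>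
      (\<exists>c. (\<forall>w\<in>W. c w \<in> F \<and> g (c w) \<le> 1) \<and> g (x - (\<Sum>w\<in>W. c w * w)) < 1))"
proof -
  have "res_indep {}" by (simp add: res_indep_def)
  moreover have "card W < Suc (card B0)" if "res_indep W" for W
  proof -
    have "W \<subseteq> E" using that by (auto simp: res_indep_def)
    then show ?thesis using indep_card[OF orthogonal_indep[OF res_indep_orthogonal[OF that]]] by simp
  qed
  ultimately obtain W where W: "res_indep W" and max: "\<And>W'. res_indep W' \<Longrightarrow> card W' \<le> card W"
    using ex_has_greatest_nat[of res_indep "{}" card "Suc (card B0)"] by auto
  have fin: "finite W" and WE: "W \<subseteq> E" and W1: "\<And>w. w \<in> W \<Longrightarrow> g w \<le> 1" using W by (auto simp: res_indep_def)
  have "\<exists>c. (\<forall>w\<in>W. c w \<in> F \<and> g (c w) \<le> 1) \<and> g (x - (\<Sum>w\<in>W. c w * w)) < 1" if x: "x \<in> E" "g x \<le> 1" for x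
  proof (cases "x \<in> W")
    case True
    let ?c = "\<lambda>v. if v = x then 1 else 0 :: 'a"
    have "(\<Sum>v\<in>W. ?c v * v) = (\<Sum>v\<in>W. if v = x then v else 0)" by (rule sum.cong) auto
    also have "\<dots> = x" using fin True by simp
    finally show ?thesis using cl by (intro exI[of _ ?c]) auto
  next
    case False
    have "\<not> res_indep (insert x W)" using max[of "insert x W"] fin False by auto
    then obtain c where c: "\<And>w. w \<in> insert x W \<Longrightarrow> c w \<in> F \<and> g (c w) \<le> 1"
        "g (\<Sum>w\<in>insert x W. c w * w) < 1" "\<exists>w\<in>insert x W. \<not> g (c w) < 1"
      using x fin WE W1 unfolding res_indep_def by auto
    let ?S = "\<Sum>w\<in>W. c w * w"
    have S: "?S \<in> E" using c(1) WE FE' by (auto intro!: subfield_sum[OF E.sub] E.cl(5))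
    have cx: "c x \<in> F" "c x \<in> E" using c(1)[of x] FE' by auto
    have lt: "g (c x * x + ?S) < 1" using c(2) fin False by simp
    have "\<not> g (c x) < 1"
    proof
      assume l: "g (c x) < 1"
      have "g (c x * x) < 1"
        using l x cx E.nonneg[OF x(1)] nonneg[OF cx(1)] mult_le_one[of "g x" "g (c x)"]
          mult_left_le[of "g x" "g (c x)"] by (simp add: E.mult)
      moreover have "?S = (c x * x + ?S) - c x * x" by simp
      then have "g ?S \<le> max (g (c x * x + ?S)) (g (c x * x))"
        using E.diff[of "c x * x + ?S" "c x * x"] S cx x E.cl by simp
      ultimately have "g ?S < 1" using lt by linarith
      then have "\<forall>w\<in>W. g (c w) < 1" using W c(1) unfolding res_indep_def by blast
      then show False using c(3) l by auto
    qed
    then have cx1: "g (c x) = 1" using c(1)[of x] by auto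
    then have cx0: "c x \<noteq> 0" using zero by auto
    let ?d = "\<lambda>w. - c w / c x"
    have "x - (\<Sum>w\<in>W. ?d w * w) = (c x * x + ?S) / c x"
      using cx0 by (simp add: sum_negf sum_divide_distrib[symmetric] add_divide_distrib)
    then have "g (x - (\<Sum>w\<in>W. ?d w * w)) < 1"
      using lt cx1 cx x S E.cl by (simp add: E.divide)
    moreover have "\<forall>w\<in>W. ?d w \<in> F \<and> g (?d w) \<le> 1"
      using c(1) cx1 cx by (auto simp: divide minus cl)
    ultimately show ?thesis by (intro exI[of _ ?d] conjI)
  qed
  then show ?thesis using W by blast
qed

text \<open>Orthogonality makes each coordinate sequence Cauchy in \<open>F\<close>. The statement
  concerns the span rather than \<open>E\<close>, because it is used to prove that the span is all
  of \<open>E\<close>; afterwards it also yields completeness of \<open>E\<close>.\<close>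

lemma orthogonal_complete:
  assumes B: "orthogonal_over F g B" "B \<subseteq> E"
    and s: "\<And>n::nat. s n \<in> lincomb_set F B"
    and cau: "\<And>\<epsilon>. \<epsilon> > 0 \<Longrightarrow> \<exists>N. \<forall>i\<ge>N. \<forall>j\<ge>N. g (s i - s j) < \<epsilon>"
  shows "\<exists>l\<in>lincomb_set F B. \<forall>\<epsilon>>0. \<exists>N. \<forall>i\<ge>N. g (s i - l) < \<epsilon>"
proof -
  have fin: "finite B" and B0': "0 \<notin> B" using B by (auto simp: orthogonal_over_def)
  have bpos: "0 < g b" if "b \<in> B" for b using that B(2) B0' E.pos by blast
  have "\<forall>n. \<exists>c. (\<forall>b\<in>B. c b \<in> F) \<and> s n = (\<Sum>b\<in>B. c b * b)" using s by (auto simp: lincomb_set_def)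
  then obtain c where c: "\<And>n b. b \<in> B \<Longrightarrow> c n b \<in> F" "\<And>n. s n = (\<Sum>b\<in>B. c n b * b)" by metis
  have ge: "g (c i b - c j b) * g b \<le> g (s i - s j)" if b: "b \<in> B" for i j b
  proof -
    have "s i - s j = (\<Sum>b\<in>B. (c i b - c j b) * b)"
      by (simp add: c(2) algebra_simps sum_subtractf)
    moreover have "\<forall>b\<in>B. c i b - c j b \<in> F" using c(1) cl by auto
    ultimately show ?thesis
      using B(1) b unfolding orthogonal_over_def by (auto dest!: spec[of _ "\<lambda>b. c i b - c j b"])
  qed
  have "\<exists>l\<in>F. \<forall>\<epsilon>>0. \<exists>N. \<forall>i\<ge>N. g (c i b - l) < \<epsilon>" if b: "b \<in> B" for b
  proof (rule complete)
    fix \<epsilon> :: real assume "0 < \<epsilon>"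
    then have "0 < \<epsilon> * g b" using bpos[OF b] by simp
    then obtain N where N: "\<And>i j. i \<ge> N \<Longrightarrow> j \<ge> N \<Longrightarrow> g (s i - s j) < \<epsilon> * g b" using cau by blast
    have "g (c i b - c j b) < \<epsilon>" if "i \<ge> N" "j \<ge> N" for i j
      using order.strict_trans1[OF ge[OF b] N[OF that]] bpos[OF b] by simp
    then show "\<exists>N. \<forall>i\<ge>N. \<forall>j\<ge>N. g (c i b - c j b) < \<epsilon>" by blast
  qed (use c b in auto)
  then obtain l where l: "\<And>b. b \<in> B \<Longrightarrow> l b \<in> F"
      "\<And>b \<epsilon>. b \<in> B \<Longrightarrow> 0 < \<epsilon> \<Longrightarrow> \<exists>N. \<forall>i\<ge>N. g (c i b - l b) < \<epsilon>" by metis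
  let ?l = "\<Sum>b\<in>B. l b * b"
  have "\<exists>N. \<forall>i\<ge>N. g (s i - ?l) < \<epsilon>" if \<epsilon>: "0 < \<epsilon>" for \<epsilon>
  proof -
    have "\<forall>b\<in>B. \<exists>N. \<forall>i\<ge>N. g (c i b - l b) < \<epsilon> / 2 / g b"
      using l(2) \<epsilon> bpos by simp
    then obtain N where N: "\<And>b i. b \<in> B \<Longrightarrow> i \<ge> N b \<Longrightarrow> g (c i b - l b) < \<epsilon> / 2 / g b" by metis
    have "g (s i - ?l) < \<epsilon>" if i: "i \<ge> Max (insert 0 (N ` B))" for i
    proof -
      have "s i - ?l = (\<Sum>b\<in>B. (c i b - l b) * b)"
        by (simp add: c(2) algebra_simps sum_subtractf)
      also have "g \<dots> \<le> \<epsilon> / 2"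
      proof (rule E.sum_le)
        fix b assume b: "b \<in> B"
        have inF: "c i b - l b \<in> F" using c(1) l(1) b cl by auto
        then show "(c i b - l b) * b \<in> E" using b B(2) FE' E.cl by auto
        have "N b \<le> i" using i fin b by auto
        then have "g (c i b - l b) * g b < \<epsilon> / 2"
          using N[OF b] bpos[OF b] by (simp add: field_simps)
        then show "g ((c i b - l b) * b) \<le> \<epsilon> / 2"
          using inF FE' b B(2) by (auto simp: E.mult subset_eq)
      qed (use \<epsilon> in simp)
      finally show ?thesis using \<epsilon> by simp
    qed
    then show ?thesis by blast
  qed
  moreover have "?l \<in> lincomb_set F B" using l(1) by (intro lincomb_setI) auto
  ultimately show ?thesis by blast
qed

end

lemma (in nonarch) residue_class_eq_iff:
  assumes x: "x \<in> F" "g x \<le> 1" and y: "y \<in> F"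
  shows "{z\<in>F. g z \<le> 1 \<and> g (z - x) < 1} = {z\<in>F. g z \<le> 1 \<and> g (z - y) < 1} \<longleftrightarrow> g (x - y) < 1"
proof
  assume "{z\<in>F. g z \<le> 1 \<and> g (z - x) < 1} = {z\<in>F. g z \<le> 1 \<and> g (z - y) < 1}"
  moreover have "x \<in> {z\<in>F. g z \<le> 1 \<and> g (z - x) < 1}" using x by simp
  ultimately show "g (x - y) < 1" by auto
next
  assume xy: "g (x - y) < 1"
  then have yx: "g (y - x) < 1" using commute[OF x(1) y] by simp
  have "g (z - x) < 1 \<longleftrightarrow> g (z - y) < 1" if "z \<in> F" for z
    using diff_trans_lt[OF that x(1) y _ xy] diff_trans_lt[OF that y x(1) _ yx] by blast
  then show "{z\<in>F. g z \<le> 1 \<and> g (z - x) < 1} = {z\<in>F. g z \<le> 1 \<and> g (z - y) < 1}" by auto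
qed

section \<open>The basis of residue lifts times powers of a uniformizer, and its
  consequences\<close>

locale local_field_ext_res = local_field_ext F g \<omega> \<theta> E B0
  for F :: "'a::field set" and g and \<omega> and \<theta> and E :: "'a set" and B0 +
  fixes \<pi> :: 'a and u :: real and W :: "'a set"
  assumes pi: "\<pi> \<in> E" "g \<pi> = u" and u: "0 < u" "u < 1"
    and u_max: "\<And>x. x \<in> E \<Longrightarrow> g x < 1 \<Longrightarrow> g x \<le> u"
    and W: "res_indep W"
    and W_span: "\<And>x. x \<in> E \<Longrightarrow> g x \<le> 1 \<Longrightarrow>
      \<exists>c. (\<forall>w\<in>W. c w \<in> F \<and> g (c w) \<le> 1) \<and> g (x - (\<Sum>w\<in>W. c w * w)) < 1"
begin

lemma W_props: "finite W" "W \<subseteq> E" "\<And>w. w \<in> W \<Longrightarrow> g w = 1"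
  using W res_indep_norm_one[OF W] by (auto simp: res_indep_def)

lemma pi_nz: "\<pi> \<noteq> 0"
  using pi u zero by auto

lemma pi_powi: "\<pi> powi j \<in> E" "g (\<pi> powi j) = u powi j" "\<pi> powi j \<noteq> 0"
  using E.cl(11) E.power_int pi pi_nz by auto

text \<open>Bracketing the value between consecutive powers of \<open>u\<close> reduces it to the
  range above \<open>u\<close> and up to 1, where maximality of \<open>u\<close> leaves only
  1.\<close>

lemma E_vals: assumes "x \<in> E" "x \<noteq> 0" shows "\<exists>j::int. g x = u powi j"
proof -
  obtain j where j: "u powi (j + 1) < g x" "g x \<le> u powi j"
    using power_int_bracket[OF u E.pos[OF assms]] by blast
  have p: "0 < u powi j" using u by simp
  have "g (x / \<pi> powi j) = g x / u powi j" using assms pi_powi by (simp add: E.divide)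
  moreover have "u < g x / u powi j" using j(1) p u by (simp add: power_int_add field_simps)
  moreover have "x / \<pi> powi j \<in> E" using assms pi_powi E.cl by auto
  ultimately have "\<not> g x / u powi j < 1" using u_max[of "x / \<pi> powi j"] by auto
  then show ?thesis using j(2) p by (intro exI[of _ j]) (simp add: field_simps)
qed

lemma ramification_exists: "\<exists>e. 0 < e \<and> \<theta> = u ^ e"
proof -
  obtain i where "g \<omega> = u powi i" using E_vals[of \<omega>] unif(1) FE' unif_powi(3)[of 1] by auto
  then have i: "\<theta> = u powi i" by (simp add: unif)
  have "0 < i"
  proof (rule ccontr)
    assume "\<not> ?thesis"
    then have "u powi 0 \<le> u powi i" by (subst power_int_le_iff[OF u]) simp
    then show False using i \<theta> by simp
  qed
  then show ?thesis using i by (intro exI[of _ "nat i"]) (auto simp: power_int_def)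
qed

end

locale local_field_ext_data = local_field_ext_res F g \<omega> \<theta> E B0 \<pi> u W
  for F :: "'a::field set" and g and \<omega> and \<theta> and E :: "'a set" and B0 and \<pi> and u and W +
  fixes e :: nat
  assumes e: "0 < e" "\<theta> = u ^ e"
begin

lemma theta_powi: "\<theta> powi i = u powi (int e * i)"
  by (simp add: e(2) power_int_mult)

abbreviation bas :: "'a \<times> nat \<Rightarrow> 'a" where "bas p \<equiv> fst p * \<pi> ^ snd p"
abbreviation "Ind \<equiv> W \<times> {..<e}"

lemma bas: "p \<in> Ind \<Longrightarrow> bas p \<in> E" "p \<in> Ind \<Longrightarrow> g (bas p) = u ^ snd p"
  using W_props pi E.cl by (auto simp: E.mult E.power subset_eq)

text \<open>Group the sum by powers of \<open>\<pi>\<close>. Each inner sum is a combination of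
  residue-independent units, so its value lies in the value group of \<open>F\<close>, generated by
  \<open>u ^ e\<close>. After multiplication by \<open>\<pi> ^ j\<close> with \<open>j < e\<close>
  the exponents of \<open>u\<close> differ modulo \<open>e\<close>, so the groups cannot
  cancel.\<close>

lemma bas_orthogonal:
  assumes c: "\<And>p. p \<in> Ind \<Longrightarrow> c p \<in> F" and p: "p \<in> Ind"
  shows "g (c p) * g (bas p) \<le> g (\<Sum>p\<in>Ind. c p * bas p)"
proof -
  define h where "h = (\<lambda>j. (\<Sum>w\<in>W. c (w,j) * w) * \<pi> ^ j)"
  have inner: "(\<Sum>w\<in>W. c (w,j) * w) \<in> E" if "j < e" for j
    using that c W_props FE' by (auto intro!: subfield_sum[OF E.sub] E.cl(5))
  have hE: "h j \<in> E" if "j < e" for j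
    unfolding h_def using inner[OF that] E.cl pi by auto
  have gh: "g (h j) = g (\<Sum>w\<in>W. c (w,j) * w) * u ^ j" if "j < e" for j
    using inner[OF that] E.cl pi by (simp add: h_def E.mult E.power)
  have eq: "(\<Sum>p\<in>Ind. c p * bas p) = sum h {..<e}"
  proof -
    have "(\<Sum>p\<in>Ind. c p * bas p) = (\<Sum>w\<in>W. \<Sum>j<e. c (w,j) * (w * \<pi> ^ j))"
      by (subst sum.cartesian_product) (simp add: case_prod_unfold)
    also have "\<dots> = (\<Sum>j<e. \<Sum>w\<in>W. c (w,j) * (w * \<pi> ^ j))" by (rule sum.swap)
    also have "\<dots> = sum h {..<e}" by (simp add: h_def sum_distrib_right mult.assoc)
    finally show ?thesis .
  qed
  have val: "\<exists>i::int. g (\<Sum>w\<in>W. c (w,j) * w) = \<theta> powi i"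
    if j: "j < e" "(\<Sum>w\<in>W. c (w,j) * w) \<noteq> 0" for j
  proof -
    let ?S = "\<Sum>w\<in>W. c (w,j) * w"
    have cF: "c (w,j) \<in> F" if "w \<in> W" for w using c that j by auto
    have "Max ((\<lambda>w. g (c (w,j))) ` W) \<in> (\<lambda>w. g (c (w,j))) ` W"
      using W_props(1) j(2) by (intro Max_in) auto
    then obtain w0 where w0: "w0 \<in> W" "Max ((\<lambda>w. g (c (w,j))) ` W) = g (c (w0,j))" by auto
    have mx: "g (c (w,j)) \<le> g (c (w0,j))" if "w \<in> W" for w
      using W_props(1) that unfolding w0(2)[symmetric] by auto
    have "g ?S \<le> g (c (w0,j))"
      using cF W_props FE' mx nonneg[OF cF[OF w0(1)]] by (intro E.sum_le) (auto simp: E.mult E.cl subset_eq)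
    moreover have "g (c (w0,j)) \<le> g ?S" using res_indepD[OF W, of "\<lambda>w. c (w,j)" w0] cF w0 by simp
    ultimately have eq: "g ?S = g (c (w0,j))" by simp
    have "c (w0,j) \<noteq> 0" using E.pos[OF inner[OF j(1)] j(2)] eq zero by auto
    then show ?thesis using vals[OF cF[OF w0(1)]] eq by simp
  qed
  have all: "\<forall>j\<in>{..<e}. g (h j) \<le> g (sum h {..<e})"
  proof (rule distinct_values_sum[THEN conjunct1])
    fix i j assume ij: "i \<in> {..<e}" "j \<in> {..<e}" "i \<noteq> j" "h i \<noteq> 0" "h j \<noteq> 0"
    obtain a where a: "g (\<Sum>w\<in>W. c (w,i) * w) = \<theta> powi a" using val[of i] ij by (auto simp: h_def)
    obtain b where b: "g (\<Sum>w\<in>W. c (w,j) * w) = \<theta> powi b" using val[of j] ij by (auto simp: h_def)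
    show "g (h i) \<noteq> g (h j)"
    proof
      assume "g (h i) = g (h j)"
      then have "u powi (int e * a + int i) = u powi (int e * b + int j)"
        using ij u by (simp add: gh a b theta_powi power_int_add)
      then have eq': "int e * a + int i = int e * b + int j" by (rule power_int_inj[OF u])
      have "(int e * a + int i) mod int e = int i" "(int e * b + int j) mod int e = int j"
        using ij by auto
      then show False using eq' ij(3) by simp
    qed
  qed (use hE in auto)
  obtain w j where wj: "p = (w,j)" "w \<in> W" "j < e" using p by auto
  have "g (c (w,j)) \<le> g (\<Sum>w\<in>W. c (w,j) * w)"
    using res_indepD[OF W, of "\<lambda>w. c (w,j)" w] c wj by auto
  then have "g (c (w,j)) * u ^ j \<le> g (h j)" using gh[OF wj(3)] u by (simp add: mult_right_mono)
  also have "\<dots> \<le> g (sum h {..<e})" using all wj by auto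
  finally show ?thesis using eq wj bas(2)[OF p] by simp
qed

lemma bas_inj: "inj_on bas Ind"
proof (rule inj_onI, rule ccontr)
  fix p q assume pq: "p \<in> Ind" "q \<in> Ind" "bas p = bas q" "p \<noteq> q"
  let ?c = "\<lambda>r. if r = p then 1 else if r = q then - 1 else 0 :: 'a"
  have "(\<Sum>r\<in>Ind. ?c r * bas r) = (\<Sum>r\<in>Ind. (if r = p then bas p else 0) - (if r = q then bas q else 0))"
    using pq(4) by (intro sum.cong) auto
  also have "\<dots> = 0" using pq W_props(1) by (simp add: sum_subtractf)
  finally have z: "(\<Sum>r\<in>Ind. ?c r * bas r) = 0" .
  have "g (?c p) * g (bas p) \<le> g (\<Sum>r\<in>Ind. ?c r * bas r)"
    by (rule bas_orthogonal[OF _ pq(1)]) (use cl in auto)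
  then show False unfolding z using bas(2)[OF pq(1)] zero_less_power[OF u(1), of "snd p"] by simp
qed

definition B where "B = bas ` Ind"

lemma B_sum: "(\<Sum>b\<in>B. c b * b) = (\<Sum>p\<in>Ind. c (bas p) * bas p)"
  unfolding B_def by (subst sum.reindex[OF bas_inj]) simp

lemma B_orthogonal: "orthogonal_over F g B"
  unfolding orthogonal_over_def
proof (intro conjI allI impI ballI)
  show "finite B" using W_props(1) by (simp add: B_def)
  show "0 \<notin> B"
  proof
    assume "0 \<in> B"
    then obtain p where p: "p \<in> Ind" "0 = bas p" unfolding B_def by blast
    have "u ^ snd p = g 0" unfolding p(2) by (rule bas(2)[OF p(1), symmetric])
    then show False using zero_less_power[OF u(1), of "snd p"] u(1) zero by linarith
  qed
  fix c b assume c: "\<forall>b\<in>B. c b \<in> F" and "b \<in> B"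
  then obtain p where p: "p \<in> Ind" "b = bas p" by (auto simp: B_def)
  show "g (c b) * g b \<le> g (\<Sum>b\<in>B. c b * b)"
    unfolding B_sum p(2) by (rule bas_orthogonal[OF _ p(1)]) (use c in \<open>auto simp: B_def\<close>)
qed

lemma B_sub: "B \<subseteq> E"
  using bas(1) by (auto simp: B_def)

lemma lat_I:
  assumes c: "\<And>p. p \<in> Ind \<Longrightarrow> c p \<in> F"
  shows "(\<Sum>p\<in>Ind. c p * bas p) \<in> lincomb_set F B"
proof (rule lincomb_setI[where c = "\<lambda>b. c (the_inv_into Ind bas b)"])
  show "(\<Sum>p\<in>Ind. c p * bas p) = (\<Sum>b\<in>B. c (the_inv_into Ind bas b) * b)"
    unfolding B_sum by (rule sum.cong) (simp_all add: the_inv_into_f_f[OF bas_inj])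
next
  fix b assume "b \<in> B"
  then obtain p where p: "p \<in> Ind" "b = bas p" unfolding B_def by blast
  show "c (the_inv_into Ind bas b) \<in> F" unfolding p(2) the_inv_into_f_f[OF bas_inj p(1)] by (rule c[OF p(1)])
qed

lemma lat_add: "x \<in> lincomb_set F B \<Longrightarrow> y \<in> lincomb_set F B \<Longrightarrow> x + y \<in> lincomb_set F B"
proof -
  assume "x \<in> lincomb_set F B" "y \<in> lincomb_set F B"
  then obtain c d where "x = (\<Sum>b\<in>B. c b * b)" "\<forall>b\<in>B. c b \<in> F" "y = (\<Sum>b\<in>B. d b * b)" "\<forall>b\<in>B. d b \<in> F"
    by (auto simp: lincomb_set_def)
  then show ?thesis
    by (intro lincomb_setI[where c = "\<lambda>b. c b + d b"]) (auto simp: distrib_right sum.distrib cl)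
qed

text \<open>Division with remainder of the exponent by \<open>e\<close> gives an element
  \<open>\<omega> powi t * \<pi> ^ j\<close> of the same value as \<open>x\<close>. The quotient is
  a unit, whose residual expansion leaves an error of value below 1, hence at most
  \<open>u\<close>.\<close>

lemma approx:
  assumes x: "x \<in> E"
  shows "\<exists>y\<in>lincomb_set F B. g (x - y) \<le> u * g x"
proof (cases "x = 0")
  case True
  have "0 \<in> lincomb_set F B" using lat_I[of "\<lambda>_. 0"] cl by simp
  then show ?thesis using True by (intro bexI[of _ 0]) auto
next
  case False
  obtain i where i: "g x = u powi i" using E_vals[OF x False] by auto
  define j where "j = nat (i mod int e)"
  define t where "t = i div int e"
  have j: "j < e" "int j = i mod int e" using e(1) by (auto simp: j_def nat_less_iff)
  have it: "i = int e * t + int j" using j(2) by (simp add: t_def)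
  define s where "s = \<omega> powi t * \<pi> ^ j"
  have sE: "s \<in> E" "s \<noteq> 0" using unif_powi FE' pi pi_nz E.cl by (auto simp: s_def)
  have gs: "g s = g x"
    using unif_powi FE' pi E.cl u by (simp add: s_def E.mult E.power i it theta_powi power_int_add)
  have gx: "0 < g x" by (rule E.pos[OF x False])
  have "x / s \<in> E" "g (x / s) \<le> 1" using x sE gs gx E.cl by (auto simp: E.divide)
  then obtain c where c: "\<forall>w\<in>W. c w \<in> F \<and> g (c w) \<le> 1" "g (x / s - (\<Sum>w\<in>W. c w * w)) < 1"
    using W_span by blast
  let ?S = "\<Sum>w\<in>W. c w * w"
  have S: "?S \<in> E" using c W_props FE' by (auto intro!: subfield_sum[OF E.sub] E.cl(5))
  define d where "d = (\<lambda>p. if snd p = j then \<omega> powi t * c (fst p) else 0)"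
  have dF: "d p \<in> F" if "p \<in> Ind" for p using that c unif_powi cl by (auto simp: d_def)
  have "(\<Sum>p\<in>Ind. d p * bas p) = (\<Sum>w\<in>W. \<Sum>j'<e. d (w,j') * (w * \<pi> ^ j'))"
    by (subst sum.cartesian_product) (simp add: case_prod_unfold)
  also have "\<dots> = (\<Sum>w\<in>W. \<Sum>j'<e. if j' = j then \<omega> powi t * c w * (w * \<pi> ^ j') else 0)"
    by (intro sum.cong refl) (simp add: d_def)
  also have "\<dots> = (\<Sum>w\<in>W. \<omega> powi t * c w * (w * \<pi> ^ j))" using j(1) by simp
  also have "\<dots> = s * ?S" by (simp add: s_def sum_distrib_left algebra_simps)
  finally have y: "s * ?S \<in> lincomb_set F B" using lat_I[of d, OF dF] by simp
  have "x - s * ?S = s * (x / s - ?S)" using sE by (simp add: field_simps)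
  then have "g (x - s * ?S) = g x * g (x / s - ?S)"
    using sE x S E.cl gs by (simp add: E.mult)
  also have "\<dots> \<le> g x * u"
    using u_max[OF _ c(2)] x sE S E.cl gx by (intro mult_left_mono) auto
  finally show ?thesis using y by (intro bexI[of _ "s * ?S"]) (simp_all add: mult.commute)
qed

text \<open>Repeated correction leaves the error at most \<open>u ^ n * g x\<close>, so
  \<open>x\<close> is a limit of combinations. The span is complete because it has an orthogonal
  basis over the complete field \<open>F\<close>, so it contains the limit.\<close>

lemma B_basis: "is_basis F E B"
proof -
  have lat_sub: "lincomb_set F B \<subseteq> E" by (rule lincomb_subset[OF E.sub FE B_sub])
  have "x \<in> lincomb_set F B" if x: "x \<in> E" for x
  proof -
    obtain Y where Y: "\<And>z. z \<in> E \<Longrightarrow> Y z \<in> lincomb_set F B \<and> g (z - Y z) \<le> u * g z"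
      using approx by metis
    define s where "s = rec_nat 0 (\<lambda>_ s. s + Y (x - s))"
    have s0: "s 0 = 0" and sS: "s (Suc n) = s n + Y (x - s n)" for n by (simp_all add: s_def)
    have z: "0 \<in> lincomb_set F B" using lat_I[of "\<lambda>_. 0"] cl by simp
    have sL: "s n \<in> lincomb_set F B \<and> g (x - s n) \<le> u ^ n * g x" for n
    proof (induction n)
      case 0
      then show ?case using s0 z by simp
    next
      case (Suc n)
      have xs: "x - s n \<in> E" using x Suc lat_sub E.cl by auto
      have "g (x - s (Suc n)) = g ((x - s n) - Y (x - s n))" by (simp add: sS algebra_simps)
      also have "\<dots> \<le> u * g (x - s n)" using Y[OF xs] by simp
      also have "\<dots> \<le> u * (u ^ n * g x)" using Suc u by (intro mult_left_mono) auto
      finally show ?case using Suc Y[OF xs] sS lat_add by (auto simp: algebra_simps)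
    qed
    have sE: "s n \<in> E" for n using sL lat_sub by auto
    have small: "\<exists>N. \<forall>n\<ge>N. g (x - s n) < \<epsilon>" if "0 < \<epsilon>" for \<epsilon>
    proof -
      have "(\<lambda>n. u ^ n * g x) \<longlonglongrightarrow> 0 * g x"
        using u by (intro tendsto_intros LIMSEQ_power_zero) auto
      then have "eventually (\<lambda>n. u ^ n * g x < \<epsilon>) sequentially"
        using that by (intro order_tendstoD) auto
      then obtain N where "\<forall>n\<ge>N. u ^ n * g x < \<epsilon>" by (auto simp: eventually_sequentially)
      then show ?thesis using sL order.strict_trans1 by blast
    qed
    have cau: "\<exists>N. \<forall>i\<ge>N. \<forall>j\<ge>N. g (s i - s j) < \<epsilon>" if \<epsilon>: "0 < \<epsilon>" for \<epsilon>
    proof -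
      obtain N where "\<forall>n\<ge>N. g (x - s n) < \<epsilon>" using small[OF \<epsilon>] by blast
      then have "g (s i - s j) < \<epsilon>" if "i \<ge> N" "j \<ge> N" for i j
        using that by (intro E.diff_trans_lt[OF sE x sE]) (auto simp: E.commute[OF sE x])
      then show ?thesis by blast
    qed
    obtain l where l: "l \<in> lincomb_set F B" "\<forall>\<epsilon>>0. \<exists>N. \<forall>i\<ge>N. g (s i - l) < \<epsilon>"
      using orthogonal_complete[OF B_orthogonal B_sub, of s] sL cau by blast
    have lE: "l \<in> E" using l lat_sub by auto
    have "g (x - l) \<le> 0"
    proof (rule dense_ge)
      fix \<epsilon> :: real assume \<epsilon>: "0 < \<epsilon>"
      obtain N1 where N1: "\<forall>i\<ge>N1. g (s i - l) < \<epsilon>" using l \<epsilon> by blast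
      obtain N2 where N2: "\<forall>n\<ge>N2. g (x - s n) < \<epsilon>" using small[OF \<epsilon>] by blast
      have "g (x - l) < \<epsilon>"
        by (rule E.diff_trans_lt[OF x sE lE, of "max N1 N2"]) (use N1 N2 in auto)
      then show "g (x - l) \<le> \<epsilon>" by simp
    qed
    then have "x - l = 0" using E.pos[of "x - l"] x lE E.cl by force
    then show ?thesis using l by simp
  qed
  then have "E = lincomb_set F B" using lat_sub by blast
  then show ?thesis unfolding is_basis_alt using orthogonal_indep[OF B_orthogonal B_sub] B_sub by blast
qed

lemma degree_eq: "ext_degree F E = e * card W"
  using ext_degree_eq[OF sub B_basis] card_image[OF bas_inj] by (simp add: B_def card_cartesian_product)

text \<open>Residue classes of \<open>E\<close> correspond to functions from \<open>W\<close> to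
  residue classes of \<open>F\<close>: choose lifts of the coefficients and form the combination.
  Residual independence gives injectivity, the residual expansion gives surjectivity.\<close>

lemma residue_card_eq: "finite (residue_classes E g)" "residue_card E g = residue_card F g ^ card W"
proof -
  define cF where "cF = (\<lambda>x. {y\<in>F. g y \<le> 1 \<and> g (y - x) < 1})"
  define cE where "cE = (\<lambda>x. {y\<in>E. g y \<le> 1 \<and> g (y - x) < 1})"
  have RF: "residue_classes F g = cF ` {x\<in>F. g x \<le> 1}" and RE: "residue_classes E g = cE ` {x\<in>E. g x \<le> 1}"
    by (simp_all add: residue_classes_def cF_def cE_def)
  have cF_eq: "cF x = cF y \<longleftrightarrow> g (x - y) < 1" if "x \<in> F" "y \<in> F" "g x \<le> 1" for x y
    unfolding cF_def by (rule residue_class_eq_iff[OF that(1,3,2)])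
  have cE_eq: "cE x = cE y \<longleftrightarrow> g (x - y) < 1" if "x \<in> E" "y \<in> E" "g x \<le> 1" for x y
    unfolding cE_def by (rule E.residue_class_eq_iff[OF that(1,3,2)])
  have "\<forall>C\<in>residue_classes F g. \<exists>x\<in>F. g x \<le> 1 \<and> cF x = C" unfolding RF by auto
  then obtain rep where rep: "\<And>C. C \<in> residue_classes F g \<Longrightarrow> rep C \<in> F \<and> g (rep C) \<le> 1 \<and> cF (rep C) = C"
    by metis
  define S where "S = (\<lambda>c. \<Sum>w\<in>W. c w * w)"
  have SE: "S c \<in> E" if "\<And>w. w \<in> W \<Longrightarrow> c w \<in> F" for c
    unfolding S_def using that W_props FE' by (auto intro!: subfield_sum[OF E.sub] E.cl(5))
  have S1: "g (S c) \<le> 1" if "\<And>w. w \<in> W \<Longrightarrow> c w \<in> F \<and> g (c w) \<le> 1" for c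
    unfolding S_def using that W_props FE' by (intro E.sum_le) (auto simp: E.mult E.cl subset_eq)
  have S_eq: "g (S c - S d) < 1 \<longleftrightarrow> (\<forall>w\<in>W. g (c w - d w) < 1)"
    if c: "\<And>w. w \<in> W \<Longrightarrow> c w \<in> F" and d: "\<And>w. w \<in> W \<Longrightarrow> d w \<in> F" for c d
  proof -
    have eq: "S c - S d = (\<Sum>w\<in>W. (c w - d w) * w)" by (simp add: S_def algebra_simps sum_subtractf)
    have cd: "c w - d w \<in> F" if "w \<in> W" for w using c d that cl by auto
    show ?thesis
    proof
      assume "g (S c - S d) < 1"
      then show "\<forall>w\<in>W. g (c w - d w) < 1"
        using res_indepD[OF W, of "\<lambda>w. c w - d w"] cd eq by fastforce
    next
      assume a: "\<forall>w\<in>W. g (c w - d w) < 1"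
      have "g (S c - S d) \<le> \<theta>" unfolding eq
      proof (rule E.sum_le)
        fix w assume w: "w \<in> W"
        show "(c w - d w) * w \<in> E" using cd[OF w] w W_props FE' E.cl by auto
        show "g ((c w - d w) * w) \<le> \<theta>"
          using lt_one[OF cd[OF w]] a w W_props FE' cd[OF w] by (auto simp: E.mult subset_eq)
      qed (use \<theta> in simp)
      then show "g (S c - S d) < 1" using \<theta> by simp
    qed
  qed
  define \<Phi> where "\<Phi> = (\<lambda>\<phi>. cE (S (\<lambda>w. rep (\<phi> w))))"
  have "bij_betw \<Phi> (W \<rightarrow>\<^sub>E residue_classes F g) (residue_classes E g)"
    unfolding bij_betw_def
  proof
    show "inj_on \<Phi> (W \<rightarrow>\<^sub>E residue_classes F g)"
    proof (rule inj_onI)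
      fix \<phi> \<psi> assume p: "\<phi> \<in> W \<rightarrow>\<^sub>E residue_classes F g" "\<psi> \<in> W \<rightarrow>\<^sub>E residue_classes F g"
        and eq: "\<Phi> \<phi> = \<Phi> \<psi>"
      have r: "rep (\<phi> w) \<in> F \<and> g (rep (\<phi> w)) \<le> 1 \<and> cF (rep (\<phi> w)) = \<phi> w"
              "rep (\<psi> w) \<in> F \<and> g (rep (\<psi> w)) \<le> 1 \<and> cF (rep (\<psi> w)) = \<psi> w" if "w \<in> W" for w
        using p that by (auto intro!: rep)
      have "g (S (\<lambda>w. rep (\<phi> w)) - S (\<lambda>w. rep (\<psi> w))) < 1"
        using eq unfolding \<Phi>_def by (subst (asm) cE_eq) (use r in \<open>auto intro!: SE S1\<close>)
      then have "\<forall>w\<in>W. g (rep (\<phi> w) - rep (\<psi> w)) < 1" by (subst (asm) S_eq) (use r in auto)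
      then have "\<phi> w = \<psi> w" if "w \<in> W" for w
        using cF_eq[of "rep (\<phi> w)" "rep (\<psi> w)"] r[OF that] that by auto
      then show "\<phi> = \<psi>" using p by (intro PiE_ext) auto
    qed
    show "\<Phi> ` (W \<rightarrow>\<^sub>E residue_classes F g) = residue_classes E g"
    proof (intro equalityI subsetI)
      fix C assume "C \<in> \<Phi> ` (W \<rightarrow>\<^sub>E residue_classes F g)"
      then obtain \<phi> where \<phi>: "\<phi> \<in> W \<rightarrow>\<^sub>E residue_classes F g" "C = \<Phi> \<phi>" by auto
      have r: "rep (\<phi> w) \<in> F \<and> g (rep (\<phi> w)) \<le> 1" if "w \<in> W" for w
        using rep[of "\<phi> w"] \<phi> that by auto
      then have "S (\<lambda>w. rep (\<phi> w)) \<in> E" "g (S (\<lambda>w. rep (\<phi> w))) \<le> 1" using SE S1 by auto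
      then show "C \<in> residue_classes E g" unfolding RE \<phi>(2) \<Phi>_def by blast
    next
      fix C assume "C \<in> residue_classes E g"
      then obtain x where x: "x \<in> E" "g x \<le> 1" "C = cE x" unfolding RE by auto
      obtain c where c: "\<forall>w\<in>W. c w \<in> F \<and> g (c w) \<le> 1" "g (x - S c) < 1"
        using W_span[OF x(1,2)] unfolding S_def by blast
      define \<phi> where "\<phi> = (\<lambda>w\<in>W. cF (c w))"
      have \<phi>: "\<phi> \<in> W \<rightarrow>\<^sub>E residue_classes F g" using c by (auto simp: \<phi>_def RF)
      have r: "rep (\<phi> w) \<in> F" "g (rep (\<phi> w)) \<le> 1" "g (c w - rep (\<phi> w)) < 1" if "w \<in> W" for w
      proof -
        have "cF (c w) \<in> residue_classes F g" using c that by (auto simp: RF)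
        then have *: "rep (\<phi> w) \<in> F \<and> g (rep (\<phi> w)) \<le> 1 \<and> cF (rep (\<phi> w)) = cF (c w)"
          using rep that by (simp add: \<phi>_def)
        then show "rep (\<phi> w) \<in> F" "g (rep (\<phi> w)) \<le> 1" by auto
        show "g (c w - rep (\<phi> w)) < 1" using * cF_eq[of "c w" "rep (\<phi> w)"] c that by auto
      qed
      have ScE: "S c \<in> E" and SrE: "S (\<lambda>w. rep (\<phi> w)) \<in> E" using c r by (auto intro!: SE)
      have "g (S c - S (\<lambda>w. rep (\<phi> w))) < 1" using c r by (subst S_eq) auto
      then have "g (x - S (\<lambda>w. rep (\<phi> w))) < 1" by (rule E.diff_trans_lt[OF x(1) ScE SrE c(2)])
      then have "cE x = \<Phi> \<phi>" unfolding \<Phi>_def using x r SrE by (subst cE_eq) (auto intro!: S1)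
      then show "C \<in> \<Phi> ` (W \<rightarrow>\<^sub>E residue_classes F g)" using \<phi> x by auto
    qed
  qed
  moreover have "finite (W \<rightarrow>\<^sub>E residue_classes F g)" using W_props(1) finite_residue by (intro finite_PiE) auto
  moreover have "card (W \<rightarrow>\<^sub>E residue_classes F g) = residue_card F g ^ card W"
    unfolding residue_card_def by (rule card_funcsetE[OF W_props(1)])
  ultimately show "finite (residue_classes E g)" "residue_card E g = residue_card F g ^ card W"
    using bij_betw_finite bij_betw_same_card unfolding residue_card_def by metis+
qed

lemma local_field_E: "local_field E g \<pi> u"
proof
  show "\<exists>j::int. g x = u powi j" if "x \<in> E" "x \<noteq> 0" for x using E_vals[OF that] .
  show "finite (residue_classes E g)" by (rule residue_card_eq(1))
  have E: "E = lincomb_set F B" using B_basis by (simp add: is_basis_def)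
  show "\<exists>l\<in>E. \<forall>\<epsilon>>0. \<exists>N. \<forall>i\<ge>N. g (s i - l) < \<epsilon>"
    if "\<And>i. s i \<in> E" "\<And>\<epsilon>. \<epsilon> > 0 \<Longrightarrow> \<exists>N. \<forall>i\<ge>N. \<forall>j\<ge>N. g (s i - s j) < \<epsilon>" for s :: "nat \<Rightarrow> 'a"
  proof -
    have "\<And>i. s i \<in> lincomb_set F B" using that(1) E by metis
    from orthogonal_complete[OF B_orthogonal B_sub this that(2)] show ?thesis using E by metis
  qed
qed (use pi u in auto)

text \<open>In the orthogonal basis a diagonal entry times the value of \<open>b\<close> is at most
  the value of \<open>x * b\<close>, so every diagonal entry is at most the value of
  \<open>x\<close>.\<close>

lemma trace_le:
  assumes x: "x \<in> E"
  shows "g (rel_trace F E x) \<le> g x"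
  unfolding rel_trace_eq[OF sub E.sub B_basis x]
proof (rule sum_le)
  fix b assume b: "b \<in> B"
  have bE: "b \<in> E" "b \<noteq> 0" using b B_sub B_orthogonal by (auto simp: orthogonal_over_def)
  have xb: "x * b \<in> E" using x bE E.cl by auto
  show "coord F B (x * b) b \<in> F" by (rule coord_in[OF sub B_basis xb])
  have "g (coord F B (x * b) b) * g b \<le> g (\<Sum>b'\<in>B. coord F B (x * b) b' * b')"
    using B_orthogonal b coord_in[OF sub B_basis xb] unfolding orthogonal_over_def by blast
  also have "\<dots> = g x * g b" using coord_sum[OF sub B_basis xb] x bE by (simp add: E.mult[symmetric])
  finally show "g (coord F B (x * b) b) \<le> g x" using E.pos[OF bE] by simp
qed (rule E.nonneg[OF x])

text \<open>The sup norm in the orthogonal basis dominates every other absolute value up to a constant;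
  multiplicativity removes the constant.\<close>
lemma absval_le:
  assumes g': "nonarch E g'" and eq: "\<And>c. c \<in> F \<Longrightarrow> g' c = g c" and x: "x \<in> E"
  shows "g' x \<le> g x"
proof -
  interpret E': nonarch E g' by fact
  have fin: "finite B" and B0: "0 \<notin> B" using B_orthogonal by (auto simp: orthogonal_over_def)
  have bpos: "0 < g b" "0 \<le> g' b" if "b \<in> B" for b using that B_sub B0 E.pos E'.nonneg by (blast, auto)
  define C where "C = 1 + (\<Sum>b\<in>B. g' b / g b)"
  have Cb: "g' b \<le> C * g b" if b: "b \<in> B" for b
  proof -
    have "g' b / g b \<le> (\<Sum>b\<in>B. g' b / g b)" using fin b bpos by (intro member_le_sum) (auto intro!: divide_nonneg_pos)
    then show ?thesis using bpos[OF b] by (simp add: C_def field_simps)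
  qed
  have C: "0 < C" using bpos by (auto simp: C_def intro!: add_pos_nonneg sum_nonneg divide_nonneg_pos)
  have le: "g' y \<le> C * g y" if y: "y \<in> E" for y
  proof -
    have "g' (\<Sum>b\<in>B. coord F B y b * b) \<le> C * g y"
    proof (rule E'.sum_le)
      fix b assume b: "b \<in> B"
      have cF: "coord F B y b \<in> F" by (rule coord_in[OF sub B_basis y])
      show "coord F B y b * b \<in> E" using cF b B_sub FE' E.cl by auto
      have "g (coord F B y b) * g b \<le> g (\<Sum>b'\<in>B. coord F B y b' * b')"
        using B_orthogonal b coord_in[OF sub B_basis y] unfolding orthogonal_over_def by blast
      then have le: "g (coord F B y b) * g b \<le> g y" using coord_sum[OF sub B_basis y] by simp
      have "g' (coord F B y b * b) = g (coord F B y b) * g' b"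
        using cF b B_sub FE' by (auto simp: E'.mult eq subset_eq)
      also have "\<dots> \<le> g (coord F B y b) * (C * g b)" using Cb[OF b] nonneg[OF cF] by (intro mult_left_mono)
      also have "\<dots> \<le> C * g y" using le C by (simp add: mult.left_commute)
      finally show "g' (coord F B y b * b) \<le> C * g y" .
    qed (use C E.nonneg[OF y] in auto)
    then show ?thesis using coord_sum[OF sub B_basis y] by simp
  qed
  show ?thesis
  proof (rule ccontr)
    assume "\<not> ?thesis"
    then have lt: "g x < g' x" by simp
    then have x0: "x \<noteq> 0" using zero by auto
    have p: "0 < g x" using E.pos[OF x x0] .
    then have "1 < g' x / g x" using lt by simp
    then obtain n where "C < (g' x / g x) ^ n" using real_arch_pow by blast
    moreover have "g' x ^ n \<le> C * g x ^ n"
      using le[OF E.cl(9)[OF x, of n]] by (simp add: E.power[OF x] E'.power[OF x])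
    ultimately show False using p by (simp add: power_divide field_simps)
  qed
qed

end

context local_field_ext
begin

lemma data_exists: "\<exists>\<pi> u W e. local_field_ext_data F g \<omega> \<theta> E B0 \<pi> u W e"
proof -
  obtain \<pi> where pi: "\<pi> \<in> E" "0 < g \<pi>" "g \<pi> < 1" "\<forall>x\<in>E. g x < 1 \<longrightarrow> g x \<le> g \<pi>"
    using uniformizer_exists by blast
  obtain W where W: "res_indep W" "\<forall>x\<in>E. g x \<le> 1 \<longrightarrow>
      (\<exists>c. (\<forall>w\<in>W. c w \<in> F \<and> g (c w) \<le> 1) \<and> g (x - (\<Sum>w\<in>W. c w * w)) < 1)"
    using residue_basis_exists by blast
  have "local_field_ext_res F g \<omega> \<theta> E B0 \<pi> (g \<pi>) W"
    by unfold_locales (use pi W in auto)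
  then interpret L: local_field_ext_res F g \<omega> \<theta> E B0 \<pi> "g \<pi>" W .
  obtain e where "0 < e" "\<theta> = g \<pi> ^ e" using L.ramification_exists by blast
  then have "local_field_ext_data F g \<omega> \<theta> E B0 \<pi> (g \<pi>) W e" by unfold_locales
  then show ?thesis by blast
qed

end

lemma local_field_extI:
  assumes "local_field F g \<omega> \<theta>" "nonarch E g" "F \<subseteq> E" "is_basis F E B0"
  shows "local_field_ext F g \<omega> \<theta> E B0"
proof -
  interpret local_field F g \<omega> \<theta> by fact
  interpret E: nonarch E g by fact
  show ?thesis by unfold_locales (use assms in auto)
qed

section \<open>Uniqueness of the extended absolute value\<close>

lemma nonarch_local_field_cong:
  assumes F: "nonarch_local_field F f" and eq: "\<And>x. x \<in> F \<Longrightarrow> h x = f x"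
  shows "nonarch_local_field F h"
proof -
  obtain \<omega> where "local_field F f \<omega> (f \<omega>)" using nonarch_local_field_imp_local_field[OF F] by blast
  then interpret L: local_field F f \<omega> "f \<omega>" .
  have res: "residue_classes F h = residue_classes F f"
    unfolding residue_classes_def using eq L.cl(4) by (intro image_cong) auto
  have "local_field F h \<omega> (f \<omega>)"
  proof
    show "is_subfield F" by (rule L.sub)
    show "is_absval F h" using L.absval eq L.cl unfolding is_absval_def by simp
    show "h (x + y) \<le> max (h x) (h y)" if "x \<in> F" "y \<in> F" for x y
      using L.ultra[OF that] eq that L.cl by simp
    show "\<omega> \<in> F" "h \<omega> = f \<omega>" "0 < f \<omega>" "f \<omega> < 1" using L.unif eq L.\<theta> by auto
    show "\<exists>j::int. h x = f \<omega> powi j" if "x \<in> F" "x \<noteq> 0" for x using L.vals[OF that] eq that by simp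
    show "finite (residue_classes F h)" using L.finite_residue res by simp
    show "\<exists>l\<in>F. \<forall>\<epsilon>>0. \<exists>N. \<forall>i\<ge>N. h (s i - l) < \<epsilon>"
      if s: "\<And>i. s i \<in> F" "\<And>\<epsilon>. \<epsilon> > 0 \<Longrightarrow> \<exists>N. \<forall>i\<ge>N. \<forall>j\<ge>N. h (s i - s j) < \<epsilon>" for s :: "nat \<Rightarrow> 'a"
    proof -
      have hf: "h (s i - l) = f (s i - l)" if "l \<in> F" for i l using eq s(1) that L.cl by simp
      have "\<exists>l\<in>F. \<forall>\<epsilon>>0. \<exists>N. \<forall>i\<ge>N. f (s i - l) < \<epsilon>"
        by (rule L.complete) (use s hf in auto)
      then show ?thesis using hf by auto
    qed
  qed
  then show ?thesis by (rule local_field.nonarch_local_field_lf)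
qed

text \<open>The comparison \<open>absval_le\<close> is one-sided, but either absolute value may play
  the part of the reference for which orthogonal bases are built.\<close>

lemma nonarch_extension_unique:
  assumes F: "nonarch_local_field F f" and FE: "F \<subseteq> E" and B: "is_basis F E B0"
    and g: "nonarch E g" "\<And>c. c \<in> F \<Longrightarrow> g c = f c" and g': "nonarch E g'" "\<And>c. c \<in> F \<Longrightarrow> g' c = f c"
    and x: "x \<in> E"
  shows "g x = g' x"
proof -
  have le: "h' x \<le> h x" if h: "nonarch E h" "\<And>c. c \<in> F \<Longrightarrow> h c = f c"
      and h': "nonarch E h'" "\<And>c. c \<in> F \<Longrightarrow> h' c = f c" for h h'
  proof -
    have "nonarch_local_field F h" using nonarch_local_field_cong[OF F] h(2) by simp
    then obtain \<omega> where "local_field F h \<omega> (h \<omega>)" using nonarch_local_field_imp_local_field by blast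
    then have "local_field_ext F h \<omega> (h \<omega>) E B0" using h(1) FE B by (rule local_field_extI)
    then obtain \<pi> u W e where "local_field_ext_data F h \<omega> (h \<omega>) E B0 \<pi> u W e"
      using local_field_ext.data_exists by blast
    then show ?thesis using local_field_ext_data.absval_le[OF _ h'(1) _ x] h(2) h'(2) by metis
  qed
  show ?thesis using le[OF g g'] le[OF g' g] by (rule antisym[rotated])
qed

section \<open>The tower of fields\<close>

declare One_nat_def [simp del]

locale tower =
  fixes abs1 :: "'a::field_char_0 \<Rightarrow> real" and K :: "nat \<Rightarrow> 'a set"
  assumes tower: "tower_setup abs1 K"
begin

lemma lf1: "nonarch_local_field (K 1) abs1" and norm1: "normalized_absval (K 1) abs1"
  and K_sub: "1 \<le> n \<Longrightarrow> is_subfield (K n)" and K_step: "1 \<le> n \<Longrightarrow> K n \<subseteq> K (Suc n)"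
  and K_basis1: "1 \<le> n \<Longrightarrow> \<exists>B. is_basis (K 1) (K n) B"
  using tower by (auto simp: tower_setup_def)

lemma K_mono: "1 \<le> n \<Longrightarrow> n \<le> m \<Longrightarrow> K n \<subseteq> K m"
proof (induction m rule: nat_induct)
  case (Suc m)
  then show ?case using K_step[of m] by (cases "n = Suc m") auto
qed auto

lemma K_mono': "1 \<le> n \<Longrightarrow> n \<le> m \<Longrightarrow> x \<in> K n \<Longrightarrow> x \<in> K m"
  using K_mono by blast

lemma K_basis:
  assumes "1 \<le> n" "n \<le> m"
  shows "\<exists>B. is_basis (K n) (K m) B"
proof -
  have m: "1 \<le> m" using assms by simp
  obtain B where "is_basis (K 1) (K m) B" using K_basis1[OF m] by blast
  then show ?thesis
    using basis_of_larger_subfield[OF K_sub K_sub _ _ K_sub] K_mono assms m by blast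
qed

section \<open>The union of the layers and its absolute value\<close>

lemma Kunion_I: "1 \<le> n \<Longrightarrow> x \<in> K n \<Longrightarrow> x \<in> Kunion K"
  by (auto simp: Kunion_def)

lemma Kunion_two: "x \<in> Kunion K \<Longrightarrow> y \<in> Kunion K \<Longrightarrow> \<exists>n\<ge>1. x \<in> K n \<and> y \<in> K n"
proof -
  assume "x \<in> Kunion K" "y \<in> Kunion K"
  then obtain i j where "1 \<le> i" "x \<in> K i" "1 \<le> j" "y \<in> K j" by (auto simp: Kunion_def)
  then show ?thesis using K_mono'[of i "max i j" x] K_mono'[of j "max i j" y]
    by (intro exI[of _ "max i j"]) auto
qed

lemma Kunion_sub: "is_subfield (Kunion K)"
proof -
  have "x + y \<in> Kunion K \<and> x - y \<in> Kunion K \<and> x * y \<in> Kunion K"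
    if xy: "x \<in> Kunion K" "y \<in> Kunion K" for x y
  proof -
    obtain n where n: "1 \<le> n" "x \<in> K n" "y \<in> K n" using Kunion_two[OF xy] by blast
    show ?thesis using subfield_closed(3,4,5)[OF K_sub[OF n(1)] n(2,3)] Kunion_I[OF n(1)] by simp
  qed
  moreover have "inverse x \<in> Kunion K" if x: "x \<in> Kunion K" for x
  proof -
    obtain n where n: "1 \<le> n" "x \<in> K n" using Kunion_two[OF x x] by blast
    show ?thesis using subfield_closed(6)[OF K_sub[OF n(1)] n(2)] Kunion_I[OF n(1)] by simp
  qed
  ultimately show ?thesis
    using subfield_closed(1,2)[OF K_sub[of 1]] Kunion_I[of 1] unfolding is_subfield_def by simp
qed

abbreviation N where "N \<equiv> nrm abs1 K"

lemma nonarch1: "nonarch (K 1) abs1"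
  using nonarch_local_field_imp_local_field[OF lf1] by (auto simp: local_field_def)

text \<open>\<open>nrm\<close> is characterized among all absolute values, so the uniqueness result
  for ultrametric ones applies only after this: integers lie in \<open>K 1\<close>, where the value
  is that of \<open>abs1\<close>.\<close>

lemma nonarch_of_absval:
  assumes n: "1 \<le> n" and g: "is_absval (K n) g" and eq: "\<forall>x\<in>K 1. g x = abs1 x"
  shows "nonarch (K n) g"
proof (rule absval_bounded_on_nat_imp_nonarch[OF K_sub[OF n] g])
  interpret L: nonarch "K 1" abs1 by (rule nonarch1)
  show "g (of_nat i) \<le> 1" for i using eq L.of_nat_le L.cl by simp
qed

lemma ext_unique:
  assumes n: "1 \<le> n" and g: "nonarch (K n) g" "\<forall>x\<in>K 1. g x = abs1 x"
    and h: "nonarch (K n) h" "\<forall>x\<in>K 1. h x = abs1 x" and x: "x \<in> K n"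
  shows "g x = h x"
proof -
  obtain B where B: "is_basis (K 1) (K n) B" using K_basis1[OF n] by blast
  show ?thesis
    by (rule nonarch_extension_unique[OF lf1 K_mono[OF _ n] B g(1) _ h(1) _ x]) (use g h in auto)
qed

text \<open>The extensions to the layers agree on overlaps by uniqueness, so they glue; the value at
  \<open>x\<close> is read off in the least layer containing it.\<close>

lemma nrm_exists_unique:
  "\<exists>!g. is_absval (Kunion K) g \<and> (\<forall>x\<in>K 1. g x = abs1 x) \<and> (\<forall>x. x \<notin> Kunion K \<longrightarrow> g x = 0)"
proof -
  have "\<forall>n\<ge>1. \<exists>h. nonarch (K n) h \<and> (\<forall>x\<in>K 1. h x = abs1 x)"
  proof (intro allI impI)
    fix n :: nat assume n: "1 \<le> n"
    obtain B where B: "is_basis (K 1) (K n) B" using K_basis1[OF n] by blast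
    show "\<exists>h. nonarch (K n) h \<and> (\<forall>x\<in>K 1. h x = abs1 x)"
      by (rule nonarch_extension_exists[OF nonarch1 K_sub[OF n] K_mono[OF _ n] B]) simp
  qed
  then obtain h where h: "\<And>n. 1 \<le> n \<Longrightarrow> nonarch (K n) (h n)" "\<And>n x. 1 \<le> n \<Longrightarrow> x \<in> K 1 \<Longrightarrow> h n x = abs1 x"
    by metis
  have compat: "h n x = h m x" if "1 \<le> n" "n \<le> m" "x \<in> K n" for n m x
  proof -
    have m: "1 \<le> m" using that by simp
    have r: "nonarch (K n) (h m)" by (rule nonarch.subset[OF h(1)[OF m] K_sub[OF that(1)] K_mono[OF that(1,2)]])
    show ?thesis
      by (rule ext_unique[OF that(1) h(1)[OF that(1)] _ r _ that(3)]) (simp_all add: h(2) that(1) m)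
  qed
  define G where "G = (\<lambda>x. if x \<in> Kunion K then h (LEAST n. 1 \<le> n \<and> x \<in> K n) x else 0)"
  have Gh: "G x = h n x" if n: "1 \<le> n" "x \<in> K n" for n x
  proof -
    let ?m = "LEAST n. 1 \<le> n \<and> x \<in> K n"
    have "1 \<le> ?m \<and> x \<in> K ?m" by (rule LeastI[of "\<lambda>n. 1 \<le> n \<and> x \<in> K n" n]) (use n in simp)
    moreover have "?m \<le> n" by (rule Least_le) (use n in simp)
    ultimately show ?thesis using compat[of ?m n x] Kunion_I[OF n] by (simp add: G_def)
  qed
  have "is_absval (Kunion K) G"
    unfolding is_absval_def
  proof (intro conjI ballI)
    fix x assume x: "x \<in> Kunion K"
    obtain n where n: "1 \<le> n" "x \<in> K n" using Kunion_two[OF x x] by blast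
    interpret L: nonarch "K n" "h n" by (rule h(1)[OF n(1)])
    show "0 \<le> G x" "(G x = 0) = (x = 0)" using Gh[OF n] L.nonneg[OF n(2)] L.eq0[OF n(2)] by auto
  next
    fix x y assume xy: "x \<in> Kunion K" "y \<in> Kunion K"
    obtain n where n: "1 \<le> n" "x \<in> K n" "y \<in> K n" using Kunion_two[OF xy] by blast
    interpret L: nonarch "K n" "h n" by (rule h(1)[OF n(1)])
    have "G x = h n x" "G y = h n y" "G (x * y) = h n (x * y)" "G (x + y) = h n (x + y)"
      using Gh[OF n(1)] n L.cl by auto
    then show "G (x * y) = G x * G y" "G (x + y) \<le> G x + G y"
      using L.mult[OF n(2,3)] L.absval n(2,3) by (auto simp: is_absval_def)
  qed
  moreover have "\<forall>x\<in>K 1. G x = abs1 x" using Gh[of 1] h(2)[of 1] by simp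
  moreover have "\<forall>x. x \<notin> Kunion K \<longrightarrow> G x = 0" by (simp add: G_def)
  moreover have "g = G" if g: "is_absval (Kunion K) g" "\<forall>x\<in>K 1. g x = abs1 x" "\<forall>x. x \<notin> Kunion K \<longrightarrow> g x = 0" for g
  proof
    fix x
    show "g x = G x"
    proof (cases "x \<in> Kunion K")
      case True
      obtain n where n: "1 \<le> n" "x \<in> K n" using Kunion_two[OF True True] by blast
      have "K n \<subseteq> Kunion K" using Kunion_I[OF n(1)] by blast
      then have "is_absval (K n) g" using g(1) unfolding is_absval_def by (meson subsetD)
      then have "nonarch (K n) g" by (rule nonarch_of_absval[OF n(1) _ g(2)])
      then have "g x = h n x" by (rule ext_unique[OF n(1) _ g(2) h(1)[OF n(1)] _ n(2)]) (use h(2) n in auto)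
      then show ?thesis using Gh[OF n] by simp
    qed (use g(3) in \<open>simp add: G_def\<close>)
  qed
  ultimately show ?thesis by blast
qed

lemma nrm_props:
  shows N_absval: "is_absval (Kunion K) N" and N_abs1: "x \<in> K 1 \<Longrightarrow> N x = abs1 x"
    and N_out: "x \<notin> Kunion K \<Longrightarrow> N x = 0"
  using theI'[OF nrm_exists_unique] unfolding nrm_def by blast+

sublocale N: nonarch "Kunion K" N
proof (rule absval_bounded_on_nat_imp_nonarch[OF Kunion_sub N_absval])
  interpret L: nonarch "K 1" abs1 by (rule nonarch1)
  show "N (of_nat i) \<le> 1" for i using N_abs1 L.of_nat_le L.cl by simp
qed

lemma nonarch_K: "1 \<le> n \<Longrightarrow> nonarch (K n) N"
  using N.subset K_sub Kunion_I by blast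

lemma N_nonneg: "0 \<le> N x"
  using N.nonneg N_out by (cases "x \<in> Kunion K") auto

abbreviation q where "q \<equiv> qres abs1 K 1"

lemma q_residue: "q = residue_card (K 1) abs1"
proof -
  have "x - y \<in> K 1" if "x \<in> K 1" "y \<in> K 1" for x y using subfield_closed(4)[OF K_sub that] by simp
  then have "residue_classes (K 1) N = residue_classes (K 1) abs1"
    unfolding residue_classes_def using N_abs1 by (intro image_cong) auto
  then show ?thesis by (simp add: qres_def residue_card_def)
qed

lemma q_ge2: "2 \<le> q"
proof -
  interpret L: nonarch "K 1" abs1 by (rule nonarch1)
  let ?c = "\<lambda>x. {y\<in>K 1. abs1 y \<le> 1 \<and> abs1 (y - x) < 1}"
  have "?c 1 \<noteq> ?c 0" using L.residue_class_eq_iff[of 1 0] L.cl by simp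
  then have c2: "card {?c 1, ?c 0} = 2" by (simp only: card_2_iff) blast
  have rc: "?c x \<in> residue_classes (K 1) abs1" if "x \<in> K 1" "abs1 x \<le> 1" for x
    unfolding residue_classes_def by (rule imageI) (use that in simp)
  have S: "{?c 1, ?c 0} \<subseteq> residue_classes (K 1) abs1"
    by (intro insert_subsetI empty_subsetI rc) (simp_all add: L.cl)
  have "finite (residue_classes (K 1) abs1)" using lf1 by (simp add: nonarch_local_field_def)
  from card_mono[OF this S] show ?thesis unfolding c2 q_residue residue_card_def .
qed

text \<open>The uniformizer is taken from \<open>normalized_absval\<close>, so its value is exactly
  \<open>1 / q\<close>. Every radius and index below is expressed through this number.\<close>

lemma local_field_K1: "\<exists>\<omega>. local_field (K 1) N \<omega> (1 / real q)"
proof -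
  obtain p where p: "p \<in> K 1" "abs1 p = 1 / real q"
      "\<forall>x\<in>K 1. x \<noteq> 0 \<longrightarrow> (\<exists>j::int. abs1 x = abs1 p powr real_of_int j)"
    using norm1 unfolding normalized_absval_def q_residue by auto
  have lfN: "nonarch_local_field (K 1) N" using nonarch_local_field_cong[OF lf1] N_abs1 by simp
  obtain \<omega> where "local_field (K 1) N \<omega> (N \<omega>)" using nonarch_local_field_imp_local_field[OF lfN] by blast
  then interpret L: local_field "K 1" N \<omega> "N \<omega>" .
  have "local_field (K 1) N p (1 / real q)"
  proof
    show "p \<in> K 1" "N p = 1 / real q" "0 < 1 / real q" "1 / real q < 1"
      using p q_ge2 N_abs1 by auto
    show "\<exists>j::int. N x = (1 / real q) powi j" if x: "x \<in> K 1" "x \<noteq> 0" for x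
    proof -
      obtain j :: int where "abs1 x = (1 / real q) powr real_of_int j" using p x by auto
      then show ?thesis using powr_int_eq[of "1 / real q" j] q_ge2 N_abs1[OF x(1)] by auto
    qed
  qed (use L.complete L.finite_residue in auto)
  then show ?thesis ..
qed

lemma K_ext_data:
  assumes n: "1 \<le> n"
  shows "\<exists>\<omega> B0 \<pi> u W e. local_field_ext_data (K 1) N \<omega> (1 / real q) (K n) B0 \<pi> u W e"
proof -
  obtain \<omega> where w: "local_field (K 1) N \<omega> (1 / real q)" using local_field_K1 by blast
  obtain B where B: "is_basis (K 1) (K n) B" using K_basis1[OF n] by blast
  have "local_field_ext (K 1) N \<omega> (1 / real q) (K n) B"
    by (rule local_field_extI[OF w nonarch_K[OF n] K_mono[OF _ n] B]) simp
  then show ?thesis using local_field_ext.data_exists by blast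
qed

lemma K_local_field:
  assumes n: "1 \<le> n"
  shows "\<exists>\<pi>. local_field (K n) N \<pi> (N \<pi>)"
proof -
  obtain \<omega> B0 \<pi> u W e where "local_field_ext_data (K 1) N \<omega> (1 / real q) (K n) B0 \<pi> u W e"
    using K_ext_data[OF n] by blast
  then interpret L: local_field_ext_data "K 1" N \<omega> "1 / real q" "K n" B0 \<pi> u W e .
  show ?thesis using L.local_field_E L.pi by auto
qed

lemma rel_trace_bound:
  assumes n: "1 \<le> n" "n \<le> m" and x: "x \<in> K m"
  shows "N (rel_trace (K n) (K m) x) \<le> N x"
proof -
  have m: "1 \<le> m" using n by simp
  obtain \<omega> where w: "local_field (K n) N \<omega> (N \<omega>)" using K_local_field[OF n(1)] by blast
  obtain B where B: "is_basis (K n) (K m) B" using K_basis[OF n] by blast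
  have "local_field_ext (K n) N \<omega> (N \<omega>) (K m) B"
    by (rule local_field_extI[OF w nonarch_K[OF m] K_mono[OF n] B])
  then obtain \<pi> u W e where "local_field_ext_data (K n) N \<omega> (N \<omega>) (K m) B \<pi> u W e"
    using local_field_ext.data_exists by blast
  then show ?thesis using local_field_ext_data.trace_le x by blast
qed

lemma mdeg_pos: "1 \<le> n \<Longrightarrow> 0 < mdeg K n"
  unfolding mdeg_def using ext_degree_pos[OF K_sub K_sub] K_basis1 by blast

lemma mdeg_1: "mdeg K 1 = 1"
  unfolding mdeg_def using ext_degree_eq[OF K_sub[OF order_refl] is_basis_self[OF K_sub[OF order_refl]]] by simp

subsection \<open>The normalized traces\<close>

abbreviation T where "T \<equiv> Tn_rel K"

lemma T_in: "1 \<le> n \<Longrightarrow> n \<le> m \<Longrightarrow> x \<in> K m \<Longrightarrow> T n m x \<in> K n"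
  unfolding Tn_rel_def using K_basis[of n m] K_sub[of n] K_sub[of m]
  by (auto intro!: subfield_closed(5,8,10) rel_trace_in)

lemma T_add: "1 \<le> n \<Longrightarrow> n \<le> m \<Longrightarrow> x \<in> K m \<Longrightarrow> y \<in> K m \<Longrightarrow> T n m (x + y) = T n m x + T n m y"
  unfolding Tn_rel_def using K_basis[of n m] rel_trace_add[OF K_sub K_sub, of n m _ x y]
  by (auto simp: distrib_left add_divide_distrib)

lemma T_scale: "1 \<le> n \<Longrightarrow> n \<le> m \<Longrightarrow> a \<in> K n \<Longrightarrow> x \<in> K m \<Longrightarrow> T n m (a * x) = a * T n m x"
proof -
  assume n: "1 \<le> n" "n \<le> m" and x: "a \<in> K n" "x \<in> K m"
  obtain B where B: "is_basis (K n) (K m) B" using K_basis[OF n] by blast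
  have m: "1 \<le> m" using n by simp
  show ?thesis
    using rel_trace_scale[OF K_sub[OF n(1)] K_sub[OF m] B K_mono[OF n] x] by (simp add: Tn_rel_def)
qed

lemma T_diff:
  assumes "1 \<le> n" "n \<le> m" "x \<in> K m" "y \<in> K m"
  shows "T n m (x - y) = T n m x - T n m y"
proof -
  have m: "1 \<le> m" using assms by simp
  have "x - y \<in> K m" using subfield_closed(4)[OF K_sub[OF m]] assms by blast
  then show ?thesis using T_add[OF assms(1,2) _ assms(4), of "x - y"] by simp
qed

text \<open>The degree factors telescope: the ratio of degrees is a rational scalar, hence passes
  through the trace to \<open>K 1\<close>.\<close>

lemma T_trans:
  assumes "1 \<le> n" "n \<le> m" "x \<in> K m"
  shows "T 1 n (T n m x) = T 1 m x"
proof -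
  have m: "1 \<le> m" using assms by simp
  obtain B where B: "is_basis (K 1) (K n) B" using K_basis1[OF assms(1)] by blast
  obtain C where C: "is_basis (K n) (K m) C" using K_basis[OF assms(1,2)] by blast
  have tr: "rel_trace (K 1) (K m) x = rel_trace (K 1) (K n) (rel_trace (K n) (K m) x)"
    by (rule rel_trace_trans[OF K_sub K_sub _ _ K_sub B C assms(3)]) (use assms m K_mono in auto)
  have y: "rel_trace (K n) (K m) x \<in> K n" by (rule rel_trace_in[OF K_sub K_sub C assms(3)]) (use assms m in auto)
  have c: "of_nat (mdeg K n) / of_nat (mdeg K m) \<in> K 1" using subfield_closed(8,10)[OF K_sub[of 1]] by simp
  have "rel_trace (K 1) (K n) (of_nat (mdeg K n) / of_nat (mdeg K m) * rel_trace (K n) (K m) x)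
     = of_nat (mdeg K n) / of_nat (mdeg K m) * rel_trace (K 1) (K n) (rel_trace (K n) (K m) x)"
    by (rule rel_trace_scale[OF K_sub K_sub B _ c y]) (use assms K_mono in auto)
  then show ?thesis using mdeg_pos[OF assms(1)] by (simp add: Tn_rel_def tr)
qed

lemma N_mdeg_pos: "1 \<le> n \<Longrightarrow> 0 < N (of_nat (mdeg K n))"
  using mdeg_pos[of n] N.cl(10) by (intro N.pos) auto

lemma T_bound:
  assumes "1 \<le> n" "n \<le> m" "x \<in> K m"
  shows "N (T n m x) \<le> N (of_nat (mdeg K n)) / N (of_nat (mdeg K m)) * N x"
proof -
  have m: "1 \<le> m" using assms by simp
  obtain C where C: "is_basis (K n) (K m) C" using K_basis[OF assms(1,2)] by blast
  have "rel_trace (K n) (K m) x \<in> Kunion K"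
    using rel_trace_in[OF K_sub K_sub C assms(3)] assms m Kunion_I by auto
  then have "N (T n m x) = N (of_nat (mdeg K n)) / N (of_nat (mdeg K m)) * N (rel_trace (K n) (K m) x)"
    by (simp add: Tn_rel_def N.mult N.divide N.cl)
  also have "\<dots> \<le> N (of_nat (mdeg K n)) / N (of_nat (mdeg K m)) * N x"
    using rel_trace_bound[OF assms] N_nonneg by (intro mult_left_mono) auto
  finally show ?thesis .
qed

subsection \<open>Invariants of the layers\<close>

lemma K_invariants:
  assumes n: "1 \<le> n"
  obtains \<pi> u e f where "local_field (K n) N \<pi> u" "0 < e" "u ^ e = 1 / real q" "qres abs1 K n = q ^ f"
    "mdeg K n = e * f" "0 < f"
proof -
  obtain \<omega> B0 \<pi> u W e where "local_field_ext_data (K 1) N \<omega> (1 / real q) (K n) B0 \<pi> u W e"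
    using K_ext_data[OF n] by blast
  then interpret L: local_field_ext_data "K 1" N \<omega> "1 / real q" "K n" B0 \<pi> u W e .
  have m: "mdeg K n = e * card W" unfolding mdeg_def by (rule L.degree_eq)
  then have "0 < card W" using mdeg_pos[OF n] by (cases "card W") auto
  moreover have "qres abs1 K n = q ^ card W" unfolding qres_def by (rule L.residue_card_eq(2))
  ultimately show ?thesis using that L.local_field_E L.e m by metis
qed

lemma unif_abs_eq:
  assumes n: "1 \<le> n" and L: "local_field (K n) N \<pi> u"
  shows "unif_abs abs1 K n = u"
  unfolding unif_abs_def
proof (rule cSup_eq_maximum)
  interpret local_field "K n" N \<pi> u by fact
  show "u \<in> {r. \<exists>x\<in>K n. r = N x \<and> 0 < r \<and> r < 1}" using unif \<theta> by auto
  show "r \<le> u" if "r \<in> {r. \<exists>x\<in>K n. r = N x \<and> 0 < r \<and> r < 1}" for r using lt_one that by auto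
qed

text \<open>From \<open>q_n = q^f\<close>, \<open>u^e = 1/q\<close> and \<open>m_n = e f\<close> one
  gets \<open>q_n^(1/m_n) = 1/u\<close>. This turns the real exponents of the theorem into integer
  powers of the value of a uniformizer.\<close>

lemma qres_powr:
  assumes n: "1 \<le> n" and L: "local_field (K n) N \<pi> u"
  shows "real (qres abs1 K n) powr (real_of_int j / real (mdeg K n)) = u powi (- j)"
proof -
  obtain \<pi>' u' e f where I: "local_field (K n) N \<pi>' u'" "0 < e" "u' ^ e = 1 / real q" "qres abs1 K n = q ^ f"
    "mdeg K n = e * f" "0 < f" by (rule K_invariants[OF n])
  have uu: "u' = u" using unif_abs_eq[OF n L] unif_abs_eq[OF n I(1)] by simp
  have u: "0 < u" using L by (simp add: local_field_def local_field_axioms_def)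
  have rq: "real q = inverse (u ^ e)" using I(3) by (simp add: uu)
  have "real (qres abs1 K n) = inverse (u ^ e) ^ f" unfolding rq[symmetric] by (simp add: I(4))
  also have "\<dots> = inverse u ^ mdeg K n" by (simp add: I(5) power_mult power_inverse)
  also have "\<dots> = inverse u powr real (mdeg K n)" using u by (simp add: powr_realpow)
  finally have "real (qres abs1 K n) powr (real_of_int j / real (mdeg K n)) = inverse u powr real_of_int j"
    using mdeg_pos[OF n] by (simp add: powr_powr)
  also have "\<dots> = inverse u powi j" using u by (intro powr_int_eq) simp
  also have "\<dots> = u powi (- j)" by (simp add: power_int_minus power_int_inverse)
  finally show ?thesis .
qed

text \<open>The cosets counted by \<open>ram\<close> are the sets of powers of \<open>u\<close> with
  exponent in a fixed class modulo \<open>e\<close>.\<close>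

lemma ram_eq:
  assumes n: "1 \<le> n" and L: "local_field (K n) N \<pi> u" and e: "0 < e" "u ^ e = 1 / real q"
  shows "ram abs1 K n = e"
proof -
  interpret L: local_field "K n" N \<pi> u by fact
  obtain \<omega> where "local_field (K 1) N \<omega> (1 / real q)" using local_field_K1 by blast
  then interpret L1: local_field "K 1" N \<omega> "1 / real q" .
  have V1: "abs1 ` (K 1 - {0}) = range (\<lambda>j::int. (1 / real q) powi j)"
  proof (intro equalityI subsetI)
    fix r assume "r \<in> abs1 ` (K 1 - {0})"
    then obtain x where x: "x \<in> K 1" "x \<noteq> 0" "r = N x" using N_abs1 by auto
    then show "r \<in> range (\<lambda>j::int. (1 / real q) powi j)" using L1.vals[OF x(1,2)] by auto
  next
    fix r assume "r \<in> range (\<lambda>j::int. (1 / real q) powi j)"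
    then obtain j :: int where j: "r = (1 / real q) powi j" by auto
    show "r \<in> abs1 ` (K 1 - {0})"
      by (rule image_eqI[of _ _ "\<omega> powi j"]) (use L1.unif_powi[of j] N_abs1 j in auto)
  qed
  have Vn: "N ` (K n - {0}) = range (\<lambda>j::int. u powi j)"
  proof (intro equalityI subsetI)
    fix r assume "r \<in> N ` (K n - {0})"
    then show "r \<in> range (\<lambda>j::int. u powi j)" using L.vals by auto
  next
    fix r assume "r \<in> range (\<lambda>j::int. u powi j)"
    then obtain j :: int where j: "r = u powi j" by auto
    show "r \<in> N ` (K n - {0})"
      by (rule image_eqI[of _ _ "\<pi> powi j"]) (use L.unif_powi[of j] j in auto)
  qed
  have \<theta>j: "(1 / real q) powi j = u powi (int e * j)" for j
    unfolding e(2)[symmetric] by (simp add: power_int_mult)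
  define c where "c = (\<lambda>i::int. range (\<lambda>j::int. u powi (i + int e * j)))"
  have u0: "u \<noteq> 0" using L.\<theta> by simp
  have coset: "(\<lambda>s. u powi i * s) ` range (\<lambda>j::int. (1 / real q) powi j) = c i" for i
    unfolding c_def image_image \<theta>j using u0 by (simp add: power_int_add)
  have "(\<lambda>r. (\<lambda>s. r * s) ` range (\<lambda>j::int. (1 / real q) powi j)) ` range (\<lambda>j::int. u powi j) = range c"
    unfolding coset[symmetric] by blast
  then have "(\<lambda>r. (\<lambda>s. r * s) ` (abs1 ` (K 1 - {0}))) ` (N ` (K n - {0})) = range c"
    unfolding V1 Vn .
  moreover have "range c = c ` {0..<int e}"
  proof (intro equalityI subsetI)
    fix X assume "X \<in> range c"
    then obtain i where i: "X = c i" by auto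
    have "c i = c (i mod int e)"
    proof (intro equalityI subsetI)
      fix r assume "r \<in> c i"
      then obtain j where j: "r = u powi (i + int e * j)" by (auto simp: c_def)
      have "i + int e * j = i mod int e + int e * (i div int e + j)"
        by (simp add: distrib_left algebra_simps)
      then show "r \<in> c (i mod int e)" using j by (auto simp: c_def)
    next
      fix r assume "r \<in> c (i mod int e)"
      then obtain j where j: "r = u powi (i mod int e + int e * j)" by (auto simp: c_def)
      have "i mod int e + int e * j = i + int e * (j - i div int e)"
        by (simp add: right_diff_distrib minus_mult_div_eq_mod)
      then show "r \<in> c i" using j by (auto simp: c_def)
    qed
    then show "X \<in> c ` {0..<int e}" using i e(1) by auto
  qed auto
  moreover have "inj_on c {0..<int e}"
  proof (rule inj_onI)
    fix i j assume ij: "i \<in> {0..<int e}" "j \<in> {0..<int e}" "c i = c j"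
    have "u powi (i + int e * 0) \<in> c i" unfolding c_def by blast
    then obtain t where "u powi i = u powi (j + int e * t)" using ij(3) by (auto simp: c_def)
    then have "i = j + int e * t" by (rule power_int_inj[OF L.\<theta>])
    then have "i mod int e = j mod int e" by simp
    then show "i = j" using ij by simp
  qed
  ultimately show ?thesis unfolding ram_def using card_image[of c "{0..<int e}"] by simp
qed

subsection \<open>The different\<close>

definition kap :: "nat \<Rightarrow> real" where
  "kap n = real (qres abs1 K n) powr (real (diff_exp abs1 K n) / real (mdeg K n)) * N (of_nat (mdeg K n))"

text \<open>The set is closed under passing to smaller values, contains the integers because traces
  do not increase values, and is bounded because the trace of 1 is the degree, nonzero in
  characteristic 0. As the value group is discrete, such a set is a closed ball, of radius at least
  1.\<close>

lemma inv_different_ball: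
  assumes n: "1 \<le> n" and L: "local_field (K n) N \<pi> u"
  shows "\<exists>d. inv_different abs1 K n = {x\<in>K n. N x \<le> u powi (- int d)}"
proof -
  interpret L: local_field "K n" N \<pi> u by fact
  define I where "I = inv_different abs1 K n"
  obtain B where B: "is_basis (K 1) (K n) B" using K_basis1[OF n] by blast
  have tr1: "rel_trace (K 1) (K n) x \<in> K 1" if "x \<in> K n" for x
    by (rule rel_trace_in[OF K_sub K_sub B that]) (use n in auto)
  have I_iff: "x \<in> I \<longleftrightarrow> x \<in> K n \<and> (\<forall>y\<in>K n. N y \<le> 1 \<longrightarrow> N (rel_trace (K 1) (K n) (x * y)) \<le> 1)" for x
    using tr1 N_abs1 L.cl(5) by (auto simp: I_def inv_different_def)
  have down: "x \<in> I" if y: "y \<in> I" and x: "x \<in> K n" "N x \<le> N y" for x y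
  proof (cases "y = 0")
    case True
    then have "N x \<le> 0" using x by simp
    then have "x = y" using L.pos[OF x(1)] True by force
    then show ?thesis using y by simp
  next
    case False
    have yK: "y \<in> K n" using y I_iff by auto
    have xy: "x / y \<in> K n" "N (x / y) \<le> 1" using x yK False L.cl L.pos[OF yK False] by (auto simp: L.divide)
    have "N (rel_trace (K 1) (K n) (x * z)) \<le> 1" if z: "z \<in> K n" "N z \<le> 1" for z
    proof -
      have "(x / y) * z \<in> K n" by (rule L.cl(5)[OF xy(1) z(1)])
      moreover have "N ((x / y) * z) \<le> 1"
        unfolding L.mult[OF xy(1) z(1)] by (rule mult_le_one[OF xy(2) L.nonneg[OF z(1)] z(2)])
      moreover have "x * z = y * ((x / y) * z)" using False by simp
      ultimately show ?thesis using y I_iff[of y] by metis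
    qed
    then show ?thesis using I_iff x by blast
  qed
  have unit: "x \<in> I" if "x \<in> K n" "N x \<le> 1" for x
    unfolding I_iff
  proof (intro conjI ballI impI)
    fix y assume y: "y \<in> K n" "N y \<le> 1"
    have "x * y \<in> K n" using that y L.cl by auto
    then have "N (rel_trace (K 1) (K n) (x * y)) \<le> N (x * y)" using n by (intro rel_trace_bound) auto
    also have "\<dots> \<le> 1" using that y L.nonneg by (simp add: L.mult mult_le_one)
    finally show "N (rel_trace (K 1) (K n) (x * y)) \<le> 1" .
  qed (rule that)
  obtain \<omega> where "local_field (K 1) N \<omega> (1 / real q)" using local_field_K1 by blast
  then interpret L1: local_field "K 1" N \<omega> "1 / real q" .
  \<comment> \<open>An element \<open>c\<close> of \<open>k\<close> with value just below that of
    \<open>x\<close> equals \<open>x\<close> times an integral factor, and its trace is the degree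
    times \<open>c\<close>. Values in \<open>k\<close> jump by factors of \<open>q\<close>, whence
    the numerator.\<close>
  define M where "M = real q / N (of_nat (mdeg K n))"
  have bounded: "N x \<le> M" if x: "x \<in> I" for x
  proof (cases "x = 0")
    case True
    then show ?thesis using N_mdeg_pos[OF n] by (simp add: M_def)
  next
    case False
    have xK: "x \<in> K n" using x I_iff by auto
    obtain j :: int where j: "(1 / real q) powi (j + 1) < N x" "N x \<le> (1 / real q) powi j"
      using power_int_bracket[OF L1.\<theta> L.pos[OF xK False]] by blast
    define c where "c = \<omega> powi (j + 1)"
    have c: "c \<in> K 1" "N c = (1 / real q) powi (j + 1)" "c \<in> K n"
      using L1.unif_powi K_mono'[of 1 n] n by (auto simp: c_def)
    have "c / x \<in> K n" "N (c / x) \<le> 1"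
      using c xK False L.cl j(1) L.pos[OF xK False] by (auto simp: L.divide)
    then have "N (rel_trace (K 1) (K n) (x * (c / x))) \<le> 1" using x I_iff[of x] by blast
    moreover have "rel_trace (K 1) (K n) (x * (c / x)) = c * of_nat (mdeg K n)"
    proof -
      have "x * (c / x) = c * 1" using False by simp
      moreover have "rel_trace (K 1) (K n) (c * 1) = c * rel_trace (K 1) (K n) 1"
        by (rule rel_trace_scale[OF K_sub K_sub B K_mono c(1) L.cl(2)]) (use n in auto)
      moreover have "rel_trace (K 1) (K n) 1 = of_nat (mdeg K n)"
        unfolding mdeg_def by (rule rel_trace_one[OF K_sub K_sub B]) (use n in auto)
      ultimately show ?thesis by simp
    qed
    ultimately have "N c * N (of_nat (mdeg K n)) \<le> 1" using c L.cl(10) by (simp add: L.mult)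
    moreover have "N x / real q \<le> N c"
    proof -
      have "(1 / real q) powi (j + 1) = (1 / real q) powi j / real q"
        using q_ge2 by (subst power_int_add) auto
      then show ?thesis using j(2) c(2) by (simp add: divide_right_mono)
    qed
    then have "N x / real q * N (of_nat (mdeg K n)) \<le> N c * N (of_nat (mdeg K n))"
      using N_nonneg by (intro mult_right_mono) auto
    ultimately have "N x / real q * N (of_nat (mdeg K n)) \<le> 1" by linarith
    then show ?thesis using N_mdeg_pos[OF n] q_ge2 by (simp add: M_def field_simps)
  qed
  have "\<exists>D. \<forall>d. \<pi> powi (- int d) \<in> I \<longrightarrow> d \<le> D"
  proof -
    obtain D where "M < inverse u ^ D" using real_arch_pow[of "inverse u" M] L.\<theta> by (auto simp: one_less_inverse)
    have "d \<le> D" if "\<pi> powi (- int d) \<in> I" for d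
    proof (rule ccontr)
      assume "\<not> d \<le> D"
      then have "u powi (- int D) \<le> u powi (- int d)" using power_int_le_iff[OF L.\<theta>] by simp
      also have "\<dots> \<le> M" using bounded[OF that] L.unif_powi by simp
      finally show False using \<open>M < inverse u ^ D\<close> by (simp add: power_int_minus power_inverse)
    qed
    then show ?thesis by blast
  qed
  moreover have "\<pi> powi (- int 0) \<in> I" using unit[OF L.cl(2)] by simp
  ultimately obtain d where d: "\<pi> powi (- int d) \<in> I" "\<And>d'. \<pi> powi (- int d') \<in> I \<Longrightarrow> d' \<le> d"
    using ex_has_greatest_nat[of "\<lambda>d. \<pi> powi (- int d) \<in> I" 0 id] by (metis id_apply le_imp_less_Suc)
  have "I = {x\<in>K n. N x \<le> u powi (- int d)}"
  proof (intro equalityI subsetI)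
    fix x assume x: "x \<in> I"
    have xK: "x \<in> K n" using x I_iff by auto
    have "N x \<le> u powi (- int d)"
    proof (rule ccontr)
      assume a: "\<not> ?thesis"
      have x0: "x \<noteq> 0" using a L.\<theta> by auto
      obtain j where j: "N x = u powi j" using L.vals[OF xK x0] by blast
      then have "\<not> u powi j \<le> u powi (- int d)" using a by simp
      then have "j < - int d" using power_int_le_iff[OF L.\<theta>] by simp
      then have jj: "j = - int (nat (- j))" "d < nat (- j)" by auto
      have "\<pi> powi j \<in> I" by (rule down[OF x]) (use L.unif_powi j in auto)
      then show False using d(2)[of "nat (- j)"] jj by simp
    qed
    then show "x \<in> {x\<in>K n. N x \<le> u powi (- int d)}" using xK by simp
  next
    fix x assume "x \<in> {x\<in>K n. N x \<le> u powi (- int d)}"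
    then show "x \<in> I" by (intro down[OF d(1)]) (auto simp: L.unif_powi)
  qed
  then show ?thesis unfolding I_def by blast
qed

text \<open>The elements that carry the ball of radius \<open>u^(-d)\<close> into the integers form
  the ball of radius \<open>u^d\<close>. Different exponents give different balls, since the radius
  is attained by a power of the uniformizer; so the description in \<open>diff_exp\<close> returns
  this \<open>d\<close>.\<close>

lemma kap_eq:
  assumes n: "1 \<le> n" and L: "local_field (K n) N \<pi> u"
  obtains d where "inv_different abs1 K n = {x\<in>K n. N x \<le> u powi (- int d)}"
    "kap n = u powi (- int d) * N (of_nat (mdeg K n))"
proof -
  interpret L: local_field "K n" N \<pi> u by fact
  obtain d where d: "inv_different abs1 K n = {x\<in>K n. N x \<le> u powi (- int d)}"
    using inv_different_ball[OF n L] by blast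
  have ball: "different abs1 K n = {x\<in>K n. N x \<le> u ^ d}"
  proof (intro equalityI subsetI)
    fix x assume x: "x \<in> different abs1 K n"
    have "N (x * \<pi> powi (- int d)) \<le> 1"
      using x d L.unif_powi[of "- int d"] by (auto simp: different_def)
    then have "N x * u powi (- int d) \<le> 1" using x L.unif_powi by (simp add: different_def L.mult)
    then show "x \<in> {x\<in>K n. N x \<le> u ^ d}"
      using x L.\<theta> by (simp add: different_def power_int_minus field_simps)
  next
    fix x assume x: "x \<in> {x\<in>K n. N x \<le> u ^ d}"
    have "N (x * y) \<le> 1" if y: "y \<in> inv_different abs1 K n" for y
    proof -
      have yK: "y \<in> K n" "N y \<le> u powi (- int d)" using y d by auto
      have "N (x * y) = N x * N y" using x yK by (simp add: L.mult)
      also have "\<dots> \<le> u ^ d * u powi (- int d)" using x yK L.nonneg L.\<theta> by (intro mult_mono) auto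
      also have "\<dots> = 1" using L.\<theta> by (simp add: power_int_minus)
      finally show ?thesis .
    qed
    then show "x \<in> different abs1 K n" using x by (simp add: different_def)
  qed
  have "diff_exp abs1 K n = d"
    unfolding diff_exp_def unif_abs_eq[OF n L]
  proof (rule the_equality)
    show "different abs1 K n = {x\<in>K n. N x \<le> u ^ d}" by (rule ball)
    fix d' assume d': "different abs1 K n = {x\<in>K n. N x \<le> u ^ d'}"
    have w: "\<pi> ^ i \<in> K n" "N (\<pi> ^ i) = u ^ i" for i using L.cl(9) L.unif L.power by auto
    have "\<pi> ^ d \<in> different abs1 K n" "\<pi> ^ d' \<in> different abs1 K n"
      using w by (simp add: ball, simp add: d')
    then have "u ^ d \<le> u ^ d'" "u ^ d' \<le> u ^ d" using ball d' w by (metis (mono_tags, lifting) mem_Collect_eq)+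
    then have "u powi int d = u powi int d'" by simp
    then show "d' = d" using power_int_inj[OF L.\<theta>] by fastforce
  qed
  then have "kap n = u powi (- int d) * N (of_nat (mdeg K n))"
    unfolding kap_def using qres_powr[OF n L, of "int d"] by simp
  then show ?thesis using that d by blast
qed

lemma kap_pos: "1 \<le> n \<Longrightarrow> 0 < kap n"
proof -
  assume n: "1 \<le> n"
  obtain \<pi> u where L: "local_field (K n) N \<pi> u" using K_invariants[OF n] by metis
  interpret L: local_field "K n" N \<pi> u by fact
  show ?thesis using kap_eq[OF n L] N_mdeg_pos[OF n] L.\<theta> by (metis mult_pos_pos zero_less_power_int)
qed

text \<open>\<open>T 1 n\<close> is the trace divided by the degree \<open>m_n\<close>, so the
  right-hand side says that \<open>z / m_n\<close> lies in the inverse different. This explains the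
  factor \<open>\<parallel>m_n\<parallel>\<close> in the definition of \<open>S\<close>.\<close>

lemma N_le_kap_iff:
  assumes n: "1 \<le> n" and z: "z \<in> K n"
  shows "N z \<le> kap n \<longleftrightarrow> (\<forall>a\<in>K n. N a \<le> 1 \<longrightarrow> N (T 1 n (a * z)) \<le> 1)"
proof -
  obtain \<pi> u where L: "local_field (K n) N \<pi> u" using K_invariants[OF n] by metis
  interpret L: local_field "K n" N \<pi> u by fact
  obtain d where d: "inv_different abs1 K n = {x\<in>K n. N x \<le> u powi (- int d)}"
    "kap n = u powi (- int d) * N (of_nat (mdeg K n))" using kap_eq[OF n L] .
  obtain B where B: "is_basis (K 1) (K n) B" using K_basis1[OF n] by blast
  let ?m = "of_nat (mdeg K n) :: 'a"
  have m0: "?m \<noteq> 0" "?m \<in> K 1" "?m \<in> K n" using mdeg_pos[OF n] subfield_closed(10)[OF K_sub[of 1]] L.cl(10) by auto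
  have zm: "z / ?m \<in> K n" using z m0 L.cl by auto
  have tr: "rel_trace (K 1) (K n) (z / ?m * a) = T 1 n (a * z)" if a: "a \<in> K n" for a
  proof -
    have "rel_trace (K 1) (K n) (inverse ?m * (a * z)) = inverse ?m * rel_trace (K 1) (K n) (a * z)"
      by (rule rel_trace_scale[OF K_sub K_sub B K_mono])
        (use n m0 a z L.cl subfield_closed(6)[OF K_sub[of 1]] in auto)
    then show ?thesis using mdeg_1 by (simp add: Tn_rel_def field_simps)
  qed
  have T1: "T 1 n (a * z) \<in> K 1" if "a \<in> K n" for a using T_in[of 1 n] n that z L.cl by auto
  have "N z \<le> kap n \<longleftrightarrow> N (z / ?m) \<le> u powi (- int d)"
    using z m0 N_mdeg_pos[OF n] by (simp add: L.divide d(2) pos_divide_le_eq)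
  also have "\<dots> \<longleftrightarrow> z / ?m \<in> inv_different abs1 K n" using d(1) zm by simp
  also have "\<dots> \<longleftrightarrow> (\<forall>a\<in>K n. N a \<le> 1 \<longrightarrow> abs1 (T 1 n (a * z)) \<le> 1)"
    unfolding inv_different_def using zm tr by auto
  also have "\<dots> \<longleftrightarrow> (\<forall>a\<in>K n. N a \<le> 1 \<longrightarrow> N (T 1 n (a * z)) \<le> 1)"
    using T1 N_abs1 by auto
  finally show ?thesis .
qed

end

section \<open>Compatible sequences and their topology\<close>

context tower
begin

abbreviation "KB \<equiv> KBar K"

lemma KB_D: "y \<in> KB \<Longrightarrow> y 0 = 0" "y \<in> KB \<Longrightarrow> 1 \<le> n \<Longrightarrow> y n \<in> K n"
    "y \<in> KB \<Longrightarrow> 1 \<le> n \<Longrightarrow> n < m \<Longrightarrow> y n = T n m (y m)"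
  by (auto simp: KBar_def)

lemma KB_Kunion: "y \<in> KB \<Longrightarrow> y n \<in> Kunion K"
proof -
  assume y: "y \<in> KB"
  show ?thesis
  proof (cases "n = 0")
    case True
    then have "y n = 0" using KB_D(1)[OF y] by simp
    then show ?thesis using N.cl(1) by simp
  next
    case False
    then have n: "1 \<le> n" by linarith
    show ?thesis by (rule Kunion_I[OF n KB_D(2)[OF y n]])
  qed
qed

lemma KB_add: "x \<in> KB \<Longrightarrow> y \<in> KB \<Longrightarrow> (\<lambda>n. x n + y n) \<in> KB"
  and KB_diff: "x \<in> KB \<Longrightarrow> y \<in> KB \<Longrightarrow> (\<lambda>n. x n - y n) \<in> KB"
proof -
  assume xy: "x \<in> KB" "y \<in> KB"
  have in1: "x n + y n \<in> K n" "x n - y n \<in> K n" if "1 \<le> n" for n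
    using KB_D(2)[OF xy(1) that] KB_D(2)[OF xy(2) that] subfield_closed(3,4)[OF K_sub[OF that]] by auto
  have t: "x n + y n = T n m (x m + y m)" "x n - y n = T n m (x m - y m)" if nm: "1 \<le> n" "n < m" for n m
  proof -
    have m: "1 \<le> m" "n \<le> m" using nm by auto
    show "x n + y n = T n m (x m + y m)" "x n - y n = T n m (x m - y m)"
      using T_add[OF nm(1) m(2) KB_D(2)[OF xy(1) m(1)] KB_D(2)[OF xy(2) m(1)]]
        T_diff[OF nm(1) m(2) KB_D(2)[OF xy(1) m(1)] KB_D(2)[OF xy(2) m(1)]]
        KB_D(3)[OF xy(1) nm] KB_D(3)[OF xy(2) nm] by auto
  qed
  show "(\<lambda>n. x n + y n) \<in> KB" "(\<lambda>n. x n - y n) \<in> KB"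
    using in1 t KB_D(1)[OF xy(1)] KB_D(1)[OF xy(2)] unfolding KBar_def by auto
qed

lemma KB_coord_bound: "\<exists>C>0. \<forall>x\<in>KB. \<forall>j\<in>{1..i}. N (x j) \<le> C * N (x i)"
proof -
  \<comment> \<open>The summand 1 settles the case \<open>j = i\<close> and keeps the constant
    positive.\<close>
  define C where "C = 1 + (\<Sum>j\<in>{1..i}. N (of_nat (mdeg K j)) / N (of_nat (mdeg K i)))"
  have t: "0 \<le> N (of_nat (mdeg K j)) / N (of_nat (mdeg K i))" for j using N_nonneg by auto
  have "N (x j) \<le> C * N (x i)" if x: "x \<in> KB" and j: "j \<in> {1..i}" for x j
  proof (cases "j = i")
    case True
    have "1 \<le> C" unfolding C_def using t by (simp add: sum_nonneg)
    then have "1 * N (x i) \<le> C * N (x i)" using N_nonneg by (rule mult_right_mono)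
    then show ?thesis using True by simp
  next
    case False
    then have jj: "1 \<le> j" "j < i" "1 \<le> i" using j by auto
    have "N (x j) \<le> N (of_nat (mdeg K j)) / N (of_nat (mdeg K i)) * N (x i)"
      using T_bound[of j i "x i"] KB_D(3)[OF x jj(1,2)] KB_D(2)[OF x jj(3)] jj by simp
    also have "\<dots> \<le> C * N (x i)"
    proof (rule mult_right_mono[OF _ N_nonneg])
      have "N (of_nat (mdeg K j)) / N (of_nat (mdeg K i)) \<le> (\<Sum>j\<in>{1..i}. N (of_nat (mdeg K j)) / N (of_nat (mdeg K i)))"
        by (rule member_le_sum[OF j]) (use t in auto)
      then show "N (of_nat (mdeg K j)) / N (of_nat (mdeg K i)) \<le> C" by (simp add: C_def)
    qed
    finally show ?thesis .
  qed
  moreover have "0 < C" unfolding C_def using t by (intro add_pos_nonneg sum_nonneg) auto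
  ultimately show ?thesis by blast
qed

text \<open>\<open>pairing\<close> uses the least layer containing \<open>a\<close>. Linearity of
  \<open>T\<close> over that layer and transitivity of the trace allow any higher layer instead,
  which is the form in which the pairing is always used.\<close>

lemma pairing_eq:
  assumes n: "1 \<le> n" and a: "a \<in> K n" and y: "y \<in> KB"
  shows "pairing K a y = T 1 n (a * y n)"
proof -
  let ?m = "LEAST n. 1 \<le> n \<and> a \<in> K n"
  have m: "1 \<le> ?m \<and> a \<in> K ?m" by (rule LeastI[of "\<lambda>n. 1 \<le> n \<and> a \<in> K n" n]) (use n a in simp)
  have mn: "?m \<le> n" by (rule Least_le) (use n a in simp)
  have p: "pairing K a y = T 1 ?m (a * y ?m)" by (simp add: pairing_def Let_def)
  show ?thesis
  proof (cases "?m = n")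
    case False
    then have lt: "?m < n" using mn by simp
    have yn: "y n \<in> K n" by (rule KB_D(2)[OF y n])
    have "a * y ?m = a * T ?m n (y n)" using KB_D(3)[OF y _ lt] m by simp
    also have "\<dots> = T ?m n (a * y n)" using T_scale[of ?m n a "y n"] m mn yn by simp
    finally have eq: "a * y ?m = T ?m n (a * y n)" .
    have "a * y n \<in> K n" by (rule subfield_closed(5)[OF K_sub[OF n] a yn])
    then have "T 1 ?m (T ?m n (a * y n)) = T 1 n (a * y n)" using T_trans[of ?m n "a * y n"] m mn by simp
    then show ?thesis using p eq by simp
  qed (use p in simp)
qed

lemma pairing_in: "1 \<le> n \<Longrightarrow> a \<in> K n \<Longrightarrow> y \<in> KB \<Longrightarrow> pairing K a y \<in> K 1"
  using pairing_eq[of n a y] T_in[of 1 n "a * y n"] subfield_closed(5)[OF K_sub[of n]] KB_D(2)[of y n] by simp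

lemma pairing_diff:
  assumes "1 \<le> n" "a \<in> K n" "x \<in> KB" "y \<in> KB"
  shows "pairing K a (\<lambda>n. x n - y n) = pairing K a x - pairing K a y"
proof -
  have "a * x n \<in> K n" "a * y n \<in> K n"
    using assms KB_D(2) subfield_closed(5)[OF K_sub[OF assms(1)]] by auto
  then show ?thesis
    using pairing_eq[OF assms(1,2)] KB_diff[OF assms(3,4)] assms T_diff[of 1 n "a * x n" "a * y n"]
    by (simp add: right_diff_distrib)
qed

lemma T1_bound: "1 \<le> n \<Longrightarrow> \<exists>C>0. \<forall>x\<in>K n. N (T 1 n x) \<le> C * N x"
proof -
  assume n: "1 \<le> n"
  have "0 < N (of_nat (mdeg K 1)) / N (of_nat (mdeg K n))" using N_mdeg_pos[OF n] N_mdeg_pos[of 1] by simp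
  then show ?thesis using T_bound[of 1 n] n by blast
qed

lemma openin_KBar_top:
  "openin (KBar_top abs1 K) U \<longleftrightarrow> U \<subseteq> KB \<and> (\<forall>y\<in>U. \<exists>n \<epsilon>. \<epsilon> > 0 \<and>
      {z\<in>KB. \<forall>j\<in>{1..n}. N (z j - y j) < \<epsilon>} \<subseteq> U)"
proof -
  let ?P = "\<lambda>U. U \<subseteq> KB \<and> (\<forall>y\<in>U. \<exists>n \<epsilon>. \<epsilon> > 0 \<and> {z\<in>KB. \<forall>j\<in>{1..n}. N (z j - y j) < \<epsilon>} \<subseteq> U)"
  have "istopology ?P"
    unfolding istopology_def
  proof (intro conjI allI impI)
    fix S U assume S: "?P S" and U: "?P U"
    show "S \<inter> U \<subseteq> KB" using S by auto
    show "\<forall>y\<in>S \<inter> U. \<exists>n \<epsilon>. \<epsilon> > 0 \<and> {z\<in>KB. \<forall>j\<in>{1..n}. N (z j - y j) < \<epsilon>} \<subseteq> S \<inter> U"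
    proof
      fix y assume y: "y \<in> S \<inter> U"
      obtain n \<epsilon> where 1: "\<epsilon> > 0" "{z\<in>KB. \<forall>j\<in>{1..n}. N (z j - y j) < \<epsilon>} \<subseteq> S" using S y by blast
      obtain m \<delta> where 2: "\<delta> > 0" "{z\<in>KB. \<forall>j\<in>{1..m}. N (z j - y j) < \<delta>} \<subseteq> U" using U y by blast
      have "{z\<in>KB. \<forall>j\<in>{1..max n m}. N (z j - y j) < min \<epsilon> \<delta>} \<subseteq> S \<inter> U"
      proof
        fix z assume z: "z \<in> {z\<in>KB. \<forall>j\<in>{1..max n m}. N (z j - y j) < min \<epsilon> \<delta>}"
        then have "N (z j - y j) < \<epsilon>" if "j \<in> {1..n}" for j using that by fastforce
        moreover have "N (z j - y j) < \<delta>" if "j \<in> {1..m}" for j using z that by fastforce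
        ultimately show "z \<in> S \<inter> U" using z 1(2) 2(2) by blast
      qed
      then show "\<exists>n \<epsilon>. \<epsilon> > 0 \<and> {z\<in>KB. \<forall>j\<in>{1..n}. N (z j - y j) < \<epsilon>} \<subseteq> S \<inter> U"
        using 1(1) 2(1) by (intro exI[of _ "max n m"] exI[of _ "min \<epsilon> \<delta>"]) auto
    qed
  next
    fix \<K> assume k: "\<forall>S\<in>\<K>. ?P S"
    show "\<Union>\<K> \<subseteq> KB" using k by blast
    show "\<forall>y\<in>\<Union>\<K>. \<exists>n \<epsilon>. \<epsilon> > 0 \<and> {z\<in>KB. \<forall>j\<in>{1..n}. N (z j - y j) < \<epsilon>} \<subseteq> \<Union>\<K>"
    proof
      fix y assume "y \<in> \<Union>\<K>"
      then obtain S where S: "S \<in> \<K>" "y \<in> S" by blast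
      then obtain n \<epsilon> where "\<epsilon> > 0" "{z\<in>KB. \<forall>j\<in>{1..n}. N (z j - y j) < \<epsilon>} \<subseteq> S" using k by blast
      then show "\<exists>n \<epsilon>. \<epsilon> > 0 \<and> {z\<in>KB. \<forall>j\<in>{1..n}. N (z j - y j) < \<epsilon>} \<subseteq> \<Union>\<K>"
        using S(1) by (intro exI[of _ n] exI[of _ \<epsilon>]) auto
    qed
  qed
  then have "openin (topology ?P) = ?P" by (rule topology_inverse')
  then show ?thesis unfolding KBar_top_def by simp
qed

section \<open>Cylinder balls and the sigma-algebra they generate\<close>

definition cyl :: "nat \<Rightarrow> 'a \<Rightarrow> real \<Rightarrow> (nat \<Rightarrow> 'a) set" where
  "cyl n c r = {x\<in>KB. N (x n - c) \<le> r}"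

lemma openin_cyl:
  assumes n: "1 \<le> n" and c: "c \<in> K n" and r: "0 < r"
  shows "openin (KBar_top abs1 K) (cyl n c r)"
proof -
  interpret L: nonarch "K n" N by (rule nonarch_K[OF n])
  have nb: "{z\<in>KB. \<forall>j\<in>{1..n}. N (z j - y j) < r} \<subseteq> cyl n c r" if y: "y \<in> cyl n c r" for y
  proof
    fix z assume z: "z \<in> {z\<in>KB. \<forall>j\<in>{1..n}. N (z j - y j) < r}"
    then have "N (z n - y n) < r" using n by force
    then have "N (z n - y n) \<le> r" by simp
    then have "N (z n - c) \<le> r"
      using y z c by (intro L.diff_trans_le[of "z n" "y n" c]) (auto simp: cyl_def KB_D(2) n)
    then show "z \<in> cyl n c r" using z by (simp add: cyl_def)
  qed
  have "cyl n c r \<subseteq> KB" by (auto simp: cyl_def)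
  then show ?thesis unfolding openin_KBar_top using nb r by blast
qed

text \<open>Radii for which the balls \<open>{x. N (x i) \<le> r i}\<close> form a decreasing basis of neighbourhoods of 0.\<close>
lemma radii_exist:
  "\<exists>r. (\<forall>i\<ge>1. 0 < r i \<and> (\<exists>j::nat. r i = kap i * (1 / real q) ^ j) \<and>
          (\<forall>x\<in>KB. N (x i) \<le> r i \<longrightarrow> (\<forall>j\<in>{1..i}. N (x j) \<le> 1 / real i))) \<and>
       (\<forall>i\<ge>1. \<forall>x\<in>KB. N (x (Suc i)) \<le> r (Suc i) \<longrightarrow> N (x i) \<le> r i)"
proof -
  have small: "\<exists>r>0. (\<exists>j::nat. r = kap i * (1 / real q) ^ j) \<and> (\<forall>x\<in>KB. N (x i) \<le> r \<longrightarrow> (\<forall>j\<in>{1..i}. N (x j) \<le> \<delta>))"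
    if i: "1 \<le> i" and \<delta>: "0 < \<delta>" for i \<delta>
  proof -
    obtain C where C: "C > 0" "\<forall>x\<in>KB. \<forall>j\<in>{1..i}. N (x j) \<le> C * N (x i)" using KB_coord_bound by blast
    have k: "0 < kap i" by (rule kap_pos[OF i])
    have qq: "0 < 1 / real q" "1 / real q < 1" using q_ge2 by auto
    have "0 < \<delta> / C / kap i" using \<delta> C k by simp
    then obtain j where j: "(1 / real q) ^ j < \<delta> / C / kap i" using real_arch_pow_inv[OF _ qq(2)] by blast
    let ?r = "kap i * (1 / real q) ^ j"
    have rp: "0 < ?r" using k qq by simp
    have rC: "C * ?r \<le> \<delta>" using j C k by (simp add: field_simps)
    have "N (x j') \<le> \<delta>" if x: "x \<in> KB" "N (x i) \<le> ?r" "j' \<in> {1..i}" for x j'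
    proof -
      have "N (x j') \<le> C * N (x i)" using C x by blast
      also have "\<dots> \<le> C * ?r" using x C by (intro mult_left_mono) auto
      finally show ?thesis using rC by linarith
    qed
    then show ?thesis using rp by blast
  qed
  \<comment> \<open>Recursive choice starts at 0, so stage \<open>k\<close> selects the radius for
    layer \<open>Suc k\<close>.\<close>
  let ?P = "\<lambda>k r. 0 < r \<and> (\<exists>j::nat. r = kap (Suc k) * (1 / real q) ^ j) \<and>
          (\<forall>x\<in>KB. N (x (Suc k)) \<le> r \<longrightarrow> (\<forall>j\<in>{1..Suc k}. N (x j) \<le> 1 / real (Suc k)))"
  let ?Q = "\<lambda>k r r'. \<forall>x\<in>KB. N (x (Suc (Suc k))) \<le> r' \<longrightarrow> N (x (Suc k)) \<le> r"
  have "\<exists>f. \<forall>k. ?P k (f k) \<and> ?Q k (f k) (f (Suc k))"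
  proof (rule dependent_nat_choice)
    show "\<exists>r. ?P 0 r" using small[of "Suc 0" "1 / real (Suc 0)"] by auto
    fix r k assume r: "?P k r"
    \<comment> \<open>Bounding the earlier coordinates also by \<open>r\<close> makes the new ball
      lie inside the previous one.\<close>
    have "0 < min r (1 / real (Suc (Suc k)))" using r by auto
    then obtain r' where r': "r' > 0" "\<exists>j::nat. r' = kap (Suc (Suc k)) * (1 / real q) ^ j"
      "\<forall>x\<in>KB. N (x (Suc (Suc k))) \<le> r' \<longrightarrow> (\<forall>j\<in>{1..Suc (Suc k)}. N (x j) \<le> min r (1 / real (Suc (Suc k))))"
      using small[of "Suc (Suc k)" "min r (1 / real (Suc (Suc k)))"] by auto
    have "Suc k \<in> {1..Suc (Suc k)}" by simp
    then have "?Q k r r'" using r'(3) by fastforce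
    moreover have "?P (Suc k) r'" using r' by simp
    ultimately show "\<exists>r'. ?P (Suc k) r' \<and> ?Q k r r'" by blast
  qed
  then obtain f where f: "\<And>k. ?P k (f k) \<and> ?Q k (f k) (f (Suc k))" by blast
  let ?r = "\<lambda>i. f (i - 1)"
  show ?thesis
  proof (intro exI[of _ ?r] conjI allI impI)
    fix i :: nat assume i: "1 \<le> i"
    then obtain k where k: "i = Suc k" by (cases i) auto
    show "0 < ?r i" "\<exists>j::nat. ?r i = kap i * (1 / real q) ^ j"
       "\<forall>x\<in>KB. N (x i) \<le> ?r i \<longrightarrow> (\<forall>j\<in>{1..i}. N (x j) \<le> 1 / real i)"
      using f[of k] by (simp_all add: k)
    show "\<forall>x\<in>KB. N (x (Suc i)) \<le> ?r (Suc i) \<longrightarrow> N (x i) \<le> ?r i" using f[of k] by (simp add: k)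
  qed
qed

definition rad :: "nat \<Rightarrow> real" where
  "rad = (SOME r. (\<forall>i\<ge>1. 0 < r i \<and> (\<exists>j::nat. r i = kap i * (1 / real q) ^ j) \<and>
          (\<forall>x\<in>KB. N (x i) \<le> r i \<longrightarrow> (\<forall>j\<in>{1..i}. N (x j) \<le> 1 / real i))) \<and>
       (\<forall>i\<ge>1. \<forall>x\<in>KB. N (x (Suc i)) \<le> r (Suc i) \<longrightarrow> N (x i) \<le> r i))"

lemma rad_all: "(\<forall>i\<ge>1. 0 < rad i \<and> (\<exists>j::nat. rad i = kap i * (1 / real q) ^ j) \<and>
          (\<forall>x\<in>KB. N (x i) \<le> rad i \<longrightarrow> (\<forall>j\<in>{1..i}. N (x j) \<le> 1 / real i))) \<and>
       (\<forall>i\<ge>1. \<forall>x\<in>KB. N (x (Suc i)) \<le> rad (Suc i) \<longrightarrow> N (x i) \<le> rad i)"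
  unfolding rad_def by (rule someI_ex[OF radii_exist])

lemmas rad_props = rad_all[THEN conjunct1, rule_format]

lemma rad_pos: "1 \<le> i \<Longrightarrow> 0 < rad i"
  by (rule rad_props[THEN conjunct1])

lemma rad_form: "1 \<le> i \<Longrightarrow> \<exists>j::nat. rad i = kap i * (1 / real q) ^ j"
  by (rule rad_props[THEN conjunct2, THEN conjunct1])

lemma rad_small: "1 \<le> i \<Longrightarrow> x \<in> KB \<Longrightarrow> N (x i) \<le> rad i \<Longrightarrow> j \<in> {1..i} \<Longrightarrow> N (x j) \<le> 1 / real i"
  by (rule rad_props[THEN conjunct2, THEN conjunct2, rule_format])

lemma rad_nested: "1 \<le> i \<Longrightarrow> i \<le> j \<Longrightarrow> x \<in> KB \<Longrightarrow> N (x j) \<le> rad j \<Longrightarrow> N (x i) \<le> rad i"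
proof (induction j rule: nat_induct)
  case (Suc j)
  show ?case
  proof (cases "i = Suc j")
    case False
    then have ij: "i \<le> j" "1 \<le> j" using Suc.prems by auto
    have "N (x j) \<le> rad j" using rad_all[THEN conjunct2, rule_format, OF ij(2) Suc.prems(3,4)] .
    then show ?thesis using Suc.IH Suc.prems ij by simp
  qed (use Suc in simp)
qed auto

text \<open>The empty set is included so that the family is closed under intersection; the radius is
  tied to the layer so that the balls form a tree.\<close>

definition cyls :: "(nat \<Rightarrow> 'a) set set" where
  "cyls = insert {} {cyl i c (rad i) | i c. 1 \<le> i \<and> c \<in> K i}"

lemma cyls_Pow: "cyls \<subseteq> Pow KB"
  by (auto simp: cyls_def cyl_def)

lemma cyls_open: "C \<in> cyls \<Longrightarrow> openin (KBar_top abs1 K) C"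
  using openin_cyl rad_pos by (auto simp: cyls_def)

lemma cyl_eq_of_mem:
  assumes n: "1 \<le> n" and c: "c \<in> K n" and x: "x \<in> K n" "N (x - c) \<le> r"
  shows "cyl n c r = cyl n x r"
proof -
  interpret L: nonarch "K n" N by (rule nonarch_K[OF n])
  have "N (z - c) \<le> r \<longleftrightarrow> N (z - x) \<le> r" if z: "z \<in> K n" for z
    using L.diff_trans_le[OF z x(1) c _ x(2)] L.diff_trans_le[OF z c x(1), of r] L.commute[OF x(1) c] x(2) by auto
  then show ?thesis using n KB_D(2) by (auto simp: cyl_def)
qed

text \<open>Two balls that meet can both be recentred at a common point, after which the nesting of
  the radii puts the one of higher index inside the other.\<close>

lemma cyls_Int_stable: "Int_stable cyls"
proof -
  have *: "cyl i c (rad i) \<inter> cyl j d (rad j) \<in> cyls"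
    if i: "1 \<le> i" "i \<le> j" and c: "c \<in> K i" and d: "d \<in> K j" for i j c d
  proof (cases "cyl i c (rad i) \<inter> cyl j d (rad j) = {}")
    case False
    then obtain x where x: "x \<in> cyl i c (rad i)" "x \<in> cyl j d (rad j)" by auto
    have j: "1 \<le> j" using i by simp
    have xK: "x \<in> KB" "x i \<in> K i" "x j \<in> K j" using x KB_D(2) i j by (auto simp: cyl_def)
    have 1: "cyl i c (rad i) = cyl i (x i) (rad i)" "cyl j d (rad j) = cyl j (x j) (rad j)"
      using x cyl_eq_of_mem[OF i(1) c xK(2)] cyl_eq_of_mem[OF j d xK(3)] by (simp_all add: cyl_def)
    have "cyl j (x j) (rad j) \<subseteq> cyl i (x i) (rad i)"
    proof
      fix z assume z: "z \<in> cyl j (x j) (rad j)"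
      have "(\<lambda>n. z n - x n) \<in> KB" using z xK KB_diff by (auto simp: cyl_def)
      then have "N (z i - x i) \<le> rad i" using rad_nested[OF i, of "\<lambda>n. z n - x n"] z by (simp add: cyl_def)
      then show "z \<in> cyl i (x i) (rad i)" using z by (simp add: cyl_def)
    qed
    then have "cyl i c (rad i) \<inter> cyl j d (rad j) = cyl j d (rad j)" using 1 by blast
    then show ?thesis using j d by (auto simp: cyls_def)
  qed (simp add: cyls_def)
  show ?thesis
  proof (rule Int_stableI)
    fix A B assume AB: "A \<in> cyls" "B \<in> cyls"
    show "A \<inter> B \<in> cyls"
    proof (cases "A = {} \<or> B = {}")
      case True
      then show ?thesis by (auto simp: cyls_def)
    next
      case False
      then obtain i c j d where A: "A = cyl i c (rad i)" "1 \<le> i" "c \<in> K i"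
        and B: "B = cyl j d (rad j)" "1 \<le> j" "d \<in> K j" using AB by (auto simp: cyls_def)
      then show ?thesis using *[of i j c d] *[of j i d c] by (cases "i \<le> j") (auto simp: Int_commute)
    qed
  qed
qed

lemma K_separable:
  assumes "1 \<le> n"
  shows "\<exists>D. countable D \<and> D \<subseteq> K n \<and> (\<forall>x\<in>K n. \<forall>\<epsilon>>0. \<exists>d\<in>D. N (x - d) < \<epsilon>)"
  using K_local_field[OF assms] local_field.separable by blast

lemma countable_cyls: "countable cyls"
proof -
  obtain D where D: "\<And>n. 1 \<le> n \<Longrightarrow> countable (D n) \<and> D n \<subseteq> K n \<and> (\<forall>x\<in>K n. \<forall>\<epsilon>>0. \<exists>d\<in>D n. N (x - d) < \<epsilon>)"
    using K_separable by metis
  have "cyls \<subseteq> insert {} (\<Union>i\<in>{1..}. (\<lambda>d. cyl i d (rad i)) ` D i)"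
  proof
    fix C assume "C \<in> cyls"
    then consider "C = {}" | i c where "C = cyl i c (rad i)" "1 \<le> i" "c \<in> K i" by (auto simp: cyls_def)
    then show "C \<in> insert {} (\<Union>i\<in>{1..}. (\<lambda>d. cyl i d (rad i)) ` D i)"
    proof cases
      case (2 i c)
      interpret L: nonarch "K i" N by (rule nonarch_K[OF 2(2)])
      obtain d where d: "d \<in> D i" "N (c - d) < rad i" using D[OF 2(2)] rad_pos[OF 2(2)] 2(3) by blast
      have dK: "d \<in> K i" using d D[OF 2(2)] by auto
      have "cyl i c (rad i) = cyl i d (rad i)"
        by (rule cyl_eq_of_mem[OF 2(2,3) dK]) (use d L.commute[OF 2(3) dK] in simp)
      then show ?thesis using 2 d by auto
    qed auto
  qed
  moreover have "countable (insert {} (\<Union>i\<in>{1..}. (\<lambda>d. cyl i d (rad i)) ` D i))"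
    using D by (intro countable_insert countable_UN countable_image) auto
  ultimately show ?thesis by (rule countable_subset)
qed

lemma open_eq_Union_cyls:
  assumes U: "openin (KBar_top abs1 K) U"
  shows "U = \<Union>{C\<in>cyls. C \<subseteq> U}"
proof (intro equalityI subsetI)
  fix y assume y: "y \<in> U"
  then obtain n \<epsilon> where e: "\<epsilon> > 0" "{z\<in>KB. \<forall>j\<in>{1..n}. N (z j - y j) < \<epsilon>} \<subseteq> U"
    using U unfolding openin_KBar_top by blast
  have yK: "y \<in> KB" using y U openin_KBar_top by auto
  obtain m where m: "inverse (real (Suc m)) < \<epsilon>" using reals_Archimedean[OF e(1)] by auto
  define i where "i = max n (Suc m)"
  have i: "1 \<le> i" "n \<le> i" by (auto simp: i_def)
  have "1 / real i \<le> inverse (real (Suc m))" by (simp add: i_def divide_inverse le_imp_inverse_le)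
  then have ie: "1 / real i < \<epsilon>" using m by linarith
  have "cyl i (y i) (rad i) \<subseteq> U"
  proof
    fix z assume z: "z \<in> cyl i (y i) (rad i)"
    then have zK: "z \<in> KB" "N (z i - y i) \<le> rad i" by (auto simp: cyl_def)
    have "N (z j - y j) < \<epsilon>" if "j \<in> {1..n}" for j
      using rad_small[OF i(1) KB_diff[OF zK(1) yK] zK(2), of j] that i ie by auto
    then show "z \<in> U" using e(2) zK by auto
  qed
  moreover have "cyl i (y i) (rad i) \<in> cyls" using i KB_D(2)[OF yK i(1)] by (auto simp: cyls_def)
  moreover have "y \<in> cyl i (y i) (rad i)" using yK rad_pos[OF i(1)] by (simp add: cyl_def)
  ultimately show "y \<in> \<Union>{C\<in>cyls. C \<subseteq> U}" by blast
qed auto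

text \<open>An open set is the union of the balls inside it, and countability of the family keeps
  this union within the generated sigma-algebra.\<close>

lemma sigma_sets_cyls:
  "sigma_sets KB {U. openin (KBar_top abs1 K) U} = sigma_sets KB cyls"
proof (rule sigma_sets_eqI)
  fix U assume "U \<in> {U. openin (KBar_top abs1 K) U}"
  then have U: "openin (KBar_top abs1 K) U" by simp
  have "\<Union>{C\<in>cyls. C \<subseteq> U} \<in> sigma_sets KB cyls"
    using countable_cyls by (intro sigma_sets_UNION) (auto intro: countable_subset)
  then show "U \<in> sigma_sets KB cyls" using open_eq_Union_cyls[OF U] by simp
qed (use cyls_open in blast)

end

section \<open>The measure\<close>

locale kbar_measure = tower abs1 K for abs1 :: "'a::field_char_0 \<Rightarrow> real" and K :: "nat \<Rightarrow> 'a set" +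
  fixes chr :: "'a \<Rightarrow> complex" and \<mu> :: "(nat \<Rightarrow> 'a) measure"
  assumes chi: "rank0_char abs1 (K 1) (qres abs1 K 1) chr"
    and prob_mu: "prob_space \<mu>"
    and space_mu: "space \<mu> = KBar K"
    and borel_mu: "sets \<mu> = sigma_sets (KBar K) {U. openin (KBar_top abs1 K) U}"
    and fourier: "\<forall>a\<in>Kunion K. (LINT x|\<mu>. chr (pairing K a x)) = Omega abs1 K a"
begin

sublocale prob_space \<mu> by (rule prob_mu)

lemma sets_mu: "sets \<mu> = sigma_sets KB cyls"
  using borel_mu sigma_sets_cyls by simp

lemma open_sets_mu: "openin (KBar_top abs1 K) U \<Longrightarrow> U \<in> sets \<mu>"
  unfolding borel_mu by (rule sigma_sets.Basic) simp

lemma cyl_sets: "1 \<le> n \<Longrightarrow> c \<in> K n \<Longrightarrow> 0 < r \<Longrightarrow> cyl n c r \<in> sets \<mu>"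
  by (intro open_sets_mu openin_cyl)

lemma measurable_coordinate_continuous:
  fixes f :: "(nat \<Rightarrow> 'a) \<Rightarrow> 'b::metric_space"
  assumes n: "1 \<le> n" and f: "\<And>y e. y \<in> KB \<Longrightarrow> 0 < e \<Longrightarrow>
     \<exists>\<delta>>0. \<forall>z\<in>KB. N (z n - y n) < \<delta> \<longrightarrow> dist (f z) (f y) < e"
  shows "f \<in> borel_measurable \<mu>"
proof (rule borel_measurableI)
  fix S :: "'b set" assume S: "open S"
  have "openin (KBar_top abs1 K) (f -` S \<inter> KB)"
    unfolding openin_KBar_top
  proof (intro conjI ballI)
    fix y assume y: "y \<in> f -` S \<inter> KB"
    then obtain e where e: "e > 0" "\<And>w. dist w (f y) < e \<Longrightarrow> w \<in> S"
      using S unfolding open_dist by (auto simp: dist_commute)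
    obtain \<delta> where d: "\<delta> > 0" "\<forall>z\<in>KB. N (z n - y n) < \<delta> \<longrightarrow> dist (f z) (f y) < e"
      using f[of y e] y e(1) by blast
    have "n \<in> {1..n}" using n by simp
    then have "{z\<in>KB. \<forall>j\<in>{1..n}. N (z j - y j) < \<delta>} \<subseteq> f -` S \<inter> KB"
      using d(2) e(2) by blast
    then show "\<exists>n \<epsilon>. \<epsilon> > 0 \<and> {z\<in>KB. \<forall>j\<in>{1..n}. N (z j - y j) < \<epsilon>} \<subseteq> f -` S \<inter> KB"
      using d(1) by blast
  qed simp
  then show "f -` S \<inter> space \<mu> \<in> sets \<mu>" unfolding space_mu by (rule open_sets_mu)
qed

section \<open>Characters composed with the pairing\<close>

lemma chr_add: "x \<in> K 1 \<Longrightarrow> y \<in> K 1 \<Longrightarrow> chr (x + y) = chr x * chr y"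
  and chr_norm: "x \<in> K 1 \<Longrightarrow> cmod (chr x) = 1"
  and chr_nontriv: "\<exists>x\<in>K 1. abs1 x \<le> real q \<and> chr x \<noteq> 1"
  using chi unfolding rank0_char_def by simp_all

lemma chr_triv: "x \<in> K 1 \<Longrightarrow> N x \<le> 1 \<Longrightarrow> chr x = 1"
  using chi N_abs1 unfolding rank0_char_def by simp

lemma chr_eq: "x \<in> K 1 \<Longrightarrow> y \<in> K 1 \<Longrightarrow> N (x - y) \<le> 1 \<Longrightarrow> chr x = chr y"
proof -
  assume xy: "x \<in> K 1" "y \<in> K 1" "N (x - y) \<le> 1"
  have d: "x - y \<in> K 1" using subfield_closed(4)[OF K_sub xy(1,2)] by simp
  have "chr x = chr (y + (x - y))" by simp
  also have "\<dots> = chr y * chr (x - y)" by (rule chr_add[OF xy(2) d])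
  also have "chr (x - y) = 1" by (rule chr_triv[OF d xy(3)])
  finally show ?thesis by simp
qed

lemma pairing_bound:
  assumes n: "1 \<le> n"
  shows "\<exists>C>0. \<forall>a\<in>K n. \<forall>y\<in>KB. N (pairing K a y) \<le> C * N a * N (y n)"
proof -
  obtain C where C: "C > 0" "\<forall>x\<in>K n. N (T 1 n x) \<le> C * N x" using T1_bound[OF n] by blast
  interpret L: nonarch "K n" N by (rule nonarch_K[OF n])
  have "N (pairing K a y) \<le> C * N a * N (y n)" if a: "a \<in> K n" and y: "y \<in> KB" for a y
  proof -
    have yn: "y n \<in> K n" by (rule KB_D(2)[OF y n])
    have "N (T 1 n (a * y n)) \<le> C * N (a * y n)" using C(2) L.cl(5)[OF a yn] by blast
    then show ?thesis using pairing_eq[OF n a y] L.mult[OF a yn] by simp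
  qed
  then show ?thesis using C(1) by blast
qed

lemma pairing_locally_small:
  assumes n: "1 \<le> n" and a: "a \<in> K n" and e: "0 < (e::real)"
  shows "\<exists>\<delta>>0. \<forall>y\<in>KB. \<forall>z\<in>KB. N (z n - y n) < \<delta> \<longrightarrow> N (pairing K a z - pairing K a y) < e"
proof -
  obtain C where C: "C > 0" "\<And>a y. a \<in> K n \<Longrightarrow> y \<in> KB \<Longrightarrow> N (pairing K a y) \<le> C * N a * N (y n)"
    using pairing_bound[OF n] by blast
  have p: "0 < C * (N a + 1)" using C(1) N_nonneg[of a] by simp
  have cancel: "0 < A \<Longrightarrow> A * (e / A) = e" for A by simp
  have "N (pairing K a z - pairing K a y) < e"
    if y: "y \<in> KB" and z: "z \<in> KB" and d: "N (z n - y n) < e / (C * (N a + 1))" for y z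
  proof -
    have "N (pairing K a z - pairing K a y) \<le> C * N a * N (z n - y n)"
      using C(2)[OF a KB_diff[OF z y]] pairing_diff[OF n a z y] by simp
    also have "\<dots> \<le> C * (N a + 1) * N (z n - y n)"
      using C(1) N_nonneg by (intro mult_right_mono mult_left_mono) auto
    also have "\<dots> < C * (N a + 1) * (e / (C * (N a + 1)))"
      using d p by (rule mult_strict_left_mono)
    also have "\<dots> = e" by (rule cancel[OF p])
    finally show ?thesis .
  qed
  moreover have "0 < e / (C * (N a + 1))" using e p by (rule divide_pos_pos)
  ultimately show ?thesis by blast
qed

lemma psi_measurable:
  assumes n: "1 \<le> n" and a: "a \<in> K n"
  shows "(\<lambda>x. chr (pairing K a x)) \<in> borel_measurable \<mu>"
proof (rule measurable_coordinate_continuous[OF n])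
  fix y and e :: real assume y: "y \<in> KB" and e: "0 < e"
  \<comment> \<open>The radius is independent of \<open>e\<close>: the character takes equal values
    at arguments differing by an integral element, so the function is locally constant.\<close>
  obtain \<delta> where d: "\<delta> > 0" "\<forall>y\<in>KB. \<forall>z\<in>KB. N (z n - y n) < \<delta> \<longrightarrow> N (pairing K a z - pairing K a y) < 1"
    using pairing_locally_small[OF n a, of 1] by auto
  have "dist (chr (pairing K a z)) (chr (pairing K a y)) < e" if z: "z \<in> KB" "N (z n - y n) < \<delta>" for z
  proof -
    have "N (pairing K a z - pairing K a y) < 1" using d(2) y z by blast
    then have "chr (pairing K a z) = chr (pairing K a y)"
      by (intro chr_eq pairing_in[OF n a] y z) simp
    then show ?thesis using e by simp
  qed
  then show "\<exists>\<delta>>0. \<forall>z\<in>KB. N (z n - y n) < \<delta> \<longrightarrow> dist (chr (pairing K a z)) (chr (pairing K a y)) < e"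
    using d(1) by blast
qed

lemma psi_norm: "1 \<le> n \<Longrightarrow> a \<in> K n \<Longrightarrow> x \<in> KB \<Longrightarrow> cmod (chr (pairing K a x)) = 1"
  by (intro chr_norm pairing_in)

lemma psi_integrable:
  assumes n: "1 \<le> n" and a: "a \<in> K n"
  shows "integrable \<mu> (\<lambda>x. chr (pairing K a x))"
  by (rule integrable_const_bound[of _ 1])
    (use psi_measurable[OF assms] psi_norm[OF assms] space_mu in auto)

lemma abs_pairing_measurable:
  assumes n: "1 \<le> n" and a: "a \<in> K n"
  shows "(\<lambda>x. N (pairing K a x)) \<in> borel_measurable \<mu>"
proof (rule measurable_coordinate_continuous[OF n])
  fix y and e :: real assume y: "y \<in> KB" and e: "0 < e"
  interpret L: nonarch "K 1" N by (rule nonarch_K) simp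
  obtain \<delta> where d: "\<delta> > 0" "\<forall>y\<in>KB. \<forall>z\<in>KB. N (z n - y n) < \<delta> \<longrightarrow> N (pairing K a z - pairing K a y) < e"
    using pairing_locally_small[OF n a e] by auto
  have "dist (N (pairing K a z)) (N (pairing K a y)) < e" if z: "z \<in> KB" "N (z n - y n) < \<delta>" for z
  proof -
    let ?p = "pairing K a z" and ?q = "pairing K a y"
    have pq: "?p \<in> K 1" "?q \<in> K 1" using pairing_in[OF n a] y z by auto
    have lt: "N (?p - ?q) < e" using d(2) y z by blast
    have "?p - ?q \<in> K 1" "?q - ?p \<in> K 1" using L.cl(4) pq by auto
    then have "N (?q + (?p - ?q)) \<le> max (N ?q) (N (?p - ?q))" "N (?p + (?q - ?p)) \<le> max (N ?p) (N (?q - ?p))"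
      using L.ultra pq by blast+
    then show ?thesis using e lt L.commute[OF pq] N_nonneg[of ?p] N_nonneg[of ?q]
      by (auto simp: dist_real_def max_def split: if_splits)
  qed
  then show "\<exists>\<delta>>0. \<forall>z\<in>KB. N (z n - y n) < \<delta> \<longrightarrow> dist (N (pairing K a z)) (N (pairing K a y)) < e"
    using d(1) by blast
qed

lemma psi_integral: "1 \<le> n \<Longrightarrow> a \<in> K n \<Longrightarrow> (LINT x|\<mu>. chr (pairing K a x)) = Omega abs1 K a"
  using fourier Kunion_I by blast

text \<open>Equality case of the bound on the mean: \<open>1 - Re h\<close> is nonnegative with
  integral 0, hence vanishes almost everywhere, and a complex number of modulus 1 with real part 1
  is 1.\<close>

lemma AE_eq_one:
  fixes h :: "(nat \<Rightarrow> 'a) \<Rightarrow> complex"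
  assumes h: "integrable \<mu> h" and 1: "\<And>x. x \<in> space \<mu> \<Longrightarrow> cmod (h x) = 1" and i: "(LINT x|\<mu>. h x) = 1"
  shows "AE x in \<mu>. h x = 1"
proof -
  have int: "integrable \<mu> (\<lambda>x. Re (h x))" using h by (rule integrable_Re)
  have "(LINT x|\<mu>. Re (h x)) = Re (LINT x|\<mu>. h x)" using h by (rule integral_Re)
  then have "(LINT x|\<mu>. Re (h x)) = 1" using i by simp
  then have z: "(LINT x|\<mu>. 1 - Re (h x)) = 0" using int by (simp add: prob_space)
  have "AE x in \<mu>. 0 \<le> 1 - Re (h x)" using 1 complex_Re_le_cmod by (intro AE_I2) (metis diff_ge_0_iff_ge)
  then have "AE x in \<mu>. 1 - Re (h x) = 0"
    using integral_nonneg_eq_0_iff_AE[of \<mu> "\<lambda>x. 1 - Re (h x)"] int z by auto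
  then show ?thesis
  proof (rule AE_mp, intro AE_I2 impI)
    fix x assume x: "x \<in> space \<mu>" "1 - Re (h x) = 0"
    have "(Re (h x))\<^sup>2 + (Im (h x))\<^sup>2 = 1" using 1[OF x(1)] by (simp add: cmod_def)
    then show "h x = 1" using x(2) by (simp add: complex_eq_iff)
  qed
qed

lemma psi_AE_one:
  assumes n: "1 \<le> n" and a: "a \<in> K n" "N a \<le> 1"
  shows "AE x in \<mu>. chr (pairing K a x) = 1"
  by (rule AE_eq_one[OF psi_integrable[OF n a(1)]])
    (use psi_norm[OF n a(1)] psi_integral[OF n a(1)] a(2) in \<open>auto simp: space_mu Omega_def\<close>)

text \<open>Triviality of a rank-zero character on the \<open>O\<^sub>k\<close>-module generated by a value forces the value
  to be integral.\<close>
lemma le_kap_of_chr_trivial: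
  assumes n: "1 \<le> n" and z: "z \<in> K n"
    and tr: "\<And>a. a \<in> K n \<Longrightarrow> N a \<le> 1 \<Longrightarrow> chr (T 1 n (a * z)) = 1"
  shows "N z \<le> kap n"
  unfolding N_le_kap_iff[OF n z]
proof (intro ballI impI)
  fix a assume a: "a \<in> K n" "N a \<le> 1"
  interpret L: nonarch "K n" N by (rule nonarch_K[OF n])
  obtain \<omega> where "local_field (K 1) N \<omega> (1 / real q)" using local_field_K1 by blast
  then interpret L1: local_field "K 1" N \<omega> "1 / real q" .
  let ?t = "T 1 n (a * z)"
  have az: "a * z \<in> K n" by (rule L.cl(5)[OF a(1) z])
  have tK: "?t \<in> K 1" using T_in[of 1 n] n az by simp
  show "N ?t \<le> 1"
  proof (rule ccontr)
    assume gt: "\<not> N ?t \<le> 1"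
    then have t0: "?t \<noteq> 0" using L1.zero by force
    have "N (inverse ?t) < 1" using gt by (simp add: L1.inv[OF tK] inverse_less_1_iff not_le)
    then have "N (inverse ?t) \<le> 1 / real q" by (rule L1.lt_one[OF L1.cl(6)[OF tK]])
    then have i: "inverse (N ?t) \<le> 1 / real q" by (simp add: L1.inv[OF tK])
    obtain x0 where x0: "x0 \<in> K 1" "N x0 \<le> real q" "chr x0 \<noteq> 1" using chr_nontriv N_abs1 by auto
    \<comment> \<open>By discreteness \<open>?t\<close> has value at least \<open>q\<close>, so
      \<open>x0\<close> is an integral multiple of it. Multiplying \<open>a\<close> by that factor
      produces the nontrivial character value at \<open>x0\<close>.\<close>
    let ?b = "x0 / ?t"
    have b: "?b \<in> K 1" by (rule L1.cl(8)[OF x0(1) tK])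
    have "N ?b = N x0 * inverse (N ?t)" using L1.divide[OF x0(1) tK] by (simp add: divide_inverse)
    also have "\<dots> \<le> real q * (1 / real q)" using x0 i N_nonneg by (intro mult_mono) auto
    finally have b1: "N ?b \<le> 1" using q_ge2 by simp
    have bn: "?b \<in> K n" by (rule K_mono'[OF _ n b]) simp
    have ba: "?b * a \<in> K n" "N (?b * a) \<le> 1"
      using L.cl(5)[OF bn a(1)] L.mult[OF bn a(1)] mult_le_one[OF b1 N_nonneg a(2)] by auto
    have "T 1 n (?b * (a * z)) = ?b * ?t" using T_scale[OF _ n b az] by simp
    also have "\<dots> = x0" using t0 by simp
    finally have "chr (T 1 n (?b * a * z)) = chr x0" by (simp add: mult.assoc)
    then show False using tr[OF ba] x0(3) by simp
  qed
qed

lemma AE_le_kap: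
  assumes n: "1 \<le> n"
  shows "AE x in \<mu>. N (x n) \<le> kap n"
proof -
  interpret L: nonarch "K n" N by (rule nonarch_K[OF n])
  obtain D where D: "countable D" "D \<subseteq> K n" "\<And>x \<epsilon>. x \<in> K n \<Longrightarrow> \<epsilon> > 0 \<Longrightarrow> \<exists>d\<in>D. N (x - d) < \<epsilon>"
    using K_separable[OF n] by blast
  obtain C where C: "C > 0" "\<And>a y. a \<in> K n \<Longrightarrow> y \<in> KB \<Longrightarrow> N (pairing K a y) \<le> C * N a * N (y n)"
    using pairing_bound[OF n] by blast
  let ?D = "{d\<in>D. N d \<le> 1}"
  have "AE x in \<mu>. \<forall>d\<in>?D. chr (pairing K d x) = 1"
  proof (subst AE_ball_countable)
    show "countable ?D" using D(1) by (rule countable_subset[rotated]) auto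
    show "\<forall>d\<in>?D. AE x in \<mu>. chr (pairing K d x) = 1" using psi_AE_one[OF n] D(2) by auto
  qed
  then show ?thesis
  proof (rule AE_mp, intro AE_I2 impI)
    fix x assume x: "x \<in> space \<mu>" and dd: "\<forall>d\<in>?D. chr (pairing K d x) = 1"
    have xK: "x \<in> KB" "x n \<in> K n" using x space_mu KB_D(2) n by auto
    show "N (x n) \<le> kap n"
    proof (rule le_kap_of_chr_trivial[OF n xK(2)])
      fix a assume a: "a \<in> K n" "N a \<le> 1"
      \<comment> \<open>The first bound keeps \<open>d\<close> integral. The second makes the
        pairing of \<open>a - d\<close> with \<open>x\<close> integral, so that \<open>a\<close> and
        \<open>d\<close> give the same character value; adding 1 avoids a zero denominator.\<close>
      define \<epsilon> where "\<epsilon> = min 1 (1 / (C * (N (x n) + 1)))"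
      have p: "0 < C * (N (x n) + 1)" using C(1) N_nonneg[of "x n"] by simp
      have e0: "0 < \<epsilon>" using p by (simp add: \<epsilon>_def)
      obtain d where d: "d \<in> D" "N (a - d) < \<epsilon>" using D(3)[OF a(1) e0] by blast
      have dK: "d \<in> K n" using d(1) D(2) by auto
      have ad: "a - d \<in> K n" by (rule L.cl(4)[OF a(1) dK])
      have "N d = N (a - (a - d))" by simp
      also have "\<dots> \<le> max (N a) (N (a - d))" by (rule L.diff[OF a(1) ad])
      also have "\<dots> \<le> 1" using a(2) d(2) by (simp add: \<epsilon>_def)
      finally have d1: "N d \<le> 1" .
      have "N (pairing K (a - d) x) \<le> C * N (a - d) * N (x n)" by (rule C(2)[OF ad xK(1)])
      also have "\<dots> \<le> C * N (a - d) * (N (x n) + 1)" using C(1) N_nonneg by (intro mult_left_mono) auto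
      also have "\<dots> \<le> C * (1 / (C * (N (x n) + 1))) * (N (x n) + 1)"
        using C(1) N_nonneg[of "x n"] d(2) by (intro mult_right_mono mult_left_mono) (auto simp: \<epsilon>_def)
      also have "\<dots> = 1" using p C(1) by (simp add: field_simps)
      finally have le: "N (pairing K (a - d) x) \<le> 1" .
      have axd: "a * x n \<in> K n" "d * x n \<in> K n" using L.cl(5) a(1) dK xK(2) by auto
      have "pairing K (a - d) x = pairing K a x - pairing K d x"
        using pairing_eq[OF n _ xK(1)] ad a(1) dK T_diff[OF _ n axd] by (simp add: left_diff_distrib)
      then have "chr (pairing K a x) = chr (pairing K d x)"
        using le by (intro chr_eq pairing_in[OF n _ xK(1)] a(1) dK) simp
      then show "chr (T 1 n (a * x n)) = 1" using dd d(1) d1 pairing_eq[OF n a(1) xK(1)] by simp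
    qed
  qed
qed

section \<open>The set \<open>S\<close>: full measure and singular translates\<close>

lemma Sset_eq: "Sset abs1 K = {x\<in>KB. \<forall>n\<ge>1. N (x n) \<le> kap n}"
  unfolding Sset_def kap_def ..

lemma le_kap_sets: "1 \<le> n \<Longrightarrow> {x\<in>KB. N (x n) \<le> kap n} \<in> sets \<mu>"
  using cyl_sets[of n 0 "kap n"] kap_pos[of n] subfield_closed(1)[OF K_sub[of n]] by (simp add: cyl_def)

theorem Sset_full: "Sset abs1 K \<in> sets \<mu>" "emeasure \<mu> (Sset abs1 K) = 1"
proof -
  have "Sset abs1 K = (\<Inter>n\<in>{1..}. {x\<in>KB. N (x n) \<le> kap n})" unfolding Sset_eq by auto
  moreover have "(\<Inter>n\<in>{1..}. {x\<in>KB. N (x n) \<le> kap n}) \<in> sets \<mu>"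
    using le_kap_sets by (intro sets.countable_INT') auto
  ultimately show S: "Sset abs1 K \<in> sets \<mu>" by simp
  have "AE x in \<mu>. \<forall>n\<in>{1..}. N (x n) \<le> kap n"
    by (subst AE_ball_countable) (use AE_le_kap in auto)
  then have "AE x in \<mu>. x \<in> Sset abs1 K"
    by (rule AE_mp) (auto intro!: AE_I2 simp: Sset_eq space_mu)
  then show "emeasure \<mu> (Sset abs1 K) = 1" using S by (simp add: emeasure_eq_1_AE)
qed

lemma Sset_diff: "x \<in> Sset abs1 K \<Longrightarrow> y \<in> Sset abs1 K \<Longrightarrow> (\<lambda>n. x n - y n) \<in> Sset abs1 K"
proof -
  assume xy: "x \<in> Sset abs1 K" "y \<in> Sset abs1 K"
  have "N (x n - y n) \<le> kap n" if n: "1 \<le> n" for n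
    using N.diff[of "x n" "y n"] KB_Kunion[of x n] KB_Kunion[of y n] xy n by (force simp: Sset_eq)
  then show ?thesis using xy KB_diff by (simp add: Sset_eq)
qed

theorem singular_shift:
  assumes y: "y \<in> KB - Sset abs1 K"
  shows "\<exists>B\<in>sets \<mu>. emeasure \<mu> B = 0 \<and> emeasure \<mu> (shift y (KB - B)) = 0"
proof -
  let ?S = "Sset abs1 K" and ?B = "KB - Sset abs1 K"
  have B: "?B \<in> sets \<mu>" using sets.compl_sets[OF Sset_full(1)] by (simp add: space_mu)
  have B0: "emeasure \<mu> ?B = 0"
    using emeasure_compl[OF Sset_full(1)] Sset_full(2) emeasure_space_1 by (simp add: space_mu)
  have "shift y (KB - ?B) \<subseteq> ?B"
  proof
    fix w assume "w \<in> shift y (KB - ?B)"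
    then obtain x where x: "x \<in> ?S" "w = (\<lambda>n. x n + y n)" by (auto simp: shift_def)
    have "w \<in> KB" using x y KB_add by (auto simp: Sset_eq)
    moreover have "w \<notin> ?S"
    proof
      assume "w \<in> ?S"
      from Sset_diff[OF this x(1)] have "y \<in> ?S" by (simp add: x(2))
      then show False using y by simp
    qed
    ultimately show "w \<in> ?B" by simp
  qed
  then have "emeasure \<mu> (shift y (KB - ?B)) \<le> emeasure \<mu> ?B" by (rule emeasure_mono[OF _ B])
  then show ?thesis using B B0 by (intro bexI[of _ ?B]) auto
qed

subsection \<open>Translation invariance of balls\<close>

context
  fixes n j :: nat and \<rho> :: real
  assumes n: "1 \<le> n" and rho: "\<rho> = kap n * (1 / real q) ^ j"
begin

interpretation L: nonarch "K n" N by (rule nonarch_K[OF n])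

text \<open>This is \<open>t O\<close> for an element \<open>t\<close> of value
  \<open>q ^ j\<close>, and \<open>unit_classes\<close> is the finite group \<open>t O / O\<close>.
  Its characters \<open>a \<mapsto> chr (T (a z))\<close> are well defined on classes when
  \<open>z\<close> lies in the dual of \<open>O\<close>, so that the choice in
  \<open>class_rep\<close> does not matter there.\<close>

definition "big_ball = {a\<in>K n. N a \<le> real q ^ j}"
definition "unit_class a = {b\<in>big_ball. N (b - a) \<le> 1}"
definition "unit_classes = unit_class ` big_ball"
definition "class_rep C = (SOME a. a \<in> C)"
definition "char_sum z = (\<Sum>C\<in>unit_classes. chr (T 1 n (class_rep C * z)))"

lemma big_ball_add: "a \<in> big_ball \<Longrightarrow> b \<in> big_ball \<Longrightarrow> a + b \<in> big_ball"
  using L.ultra[of a b] L.cl(3)[of a b] by (auto simp: big_ball_def)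

lemma unit_class_eq_iff: "a \<in> big_ball \<Longrightarrow> b \<in> big_ball \<Longrightarrow> unit_class a = unit_class b \<longleftrightarrow> N (a - b) \<le> 1"
proof
  assume ab: "a \<in> big_ball" "b \<in> big_ball" "unit_class a = unit_class b"
  have "a \<in> unit_class a" using L.zero ab(1) by (simp add: unit_class_def)
  then have "a \<in> unit_class b" by (simp only: ab(3))
  then show "N (a - b) \<le> 1" by (simp add: unit_class_def)
next
  assume ab: "a \<in> big_ball" "b \<in> big_ball" and d: "N (a - b) \<le> 1"
  have "N (c - a) \<le> 1 \<longleftrightarrow> N (c - b) \<le> 1" if "c \<in> big_ball" for c
    using L.diff_trans_le[of c a b 1] L.diff_trans_le[of c b a 1] L.commute[of a b] ab that d by (auto simp: big_ball_def)
  then show "unit_class a = unit_class b" by (auto simp: unit_class_def)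
qed

lemma class_rep: "C \<in> unit_classes \<Longrightarrow> class_rep C \<in> big_ball" "C \<in> unit_classes \<Longrightarrow> unit_class (class_rep C) = C"
proof -
  assume "C \<in> unit_classes"
  then obtain a where a: "a \<in> big_ball" "C = unit_class a" by (auto simp: unit_classes_def)
  then have "a \<in> C" using L.zero by (simp add: unit_class_def)
  then have "class_rep C \<in> C" unfolding class_rep_def by (rule someI)
  then show "class_rep C \<in> big_ball" "unit_class (class_rep C) = C" using a unit_class_eq_iff[of "class_rep C" a] by (auto simp: unit_class_def)
qed

lemma finite_unit_classes: "finite unit_classes"
proof -
  obtain \<pi> where "local_field (K n) N \<pi> (N \<pi>)" using K_local_field[OF n] by blast
  then obtain A where A: "finite A" "A \<subseteq> K n" "\<forall>x\<in>K n. N x \<le> real q ^ j \<longrightarrow> (\<exists>a\<in>A. N (x - a) < 1)"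
    using local_field.totally_bounded[of "K n" N \<pi> "N \<pi>" 1 "real q ^ j"] by auto
  have "unit_classes \<subseteq> (\<lambda>a. {b\<in>big_ball. N (b - a) \<le> 1}) ` A"
  proof
    fix C assume "C \<in> unit_classes"
    then obtain x where x: "x \<in> big_ball" "C = unit_class x" by (auto simp: unit_classes_def)
    then obtain a where a: "a \<in> A" "N (x - a) < 1" using A(3) by (auto simp: big_ball_def)
    have aK: "a \<in> K n" "x \<in> K n" using a A(2) x by (auto simp: big_ball_def)
    have "N (c - x) \<le> 1 \<longleftrightarrow> N (c - a) \<le> 1" if "c \<in> big_ball" for c
      using L.diff_trans_le[of c x a 1] L.diff_trans_le[of c a x 1] L.commute[of x a] aK that a(2)
      by (auto simp: big_ball_def)
    then have "C = {b\<in>big_ball. N (b - a) \<le> 1}" unfolding x(2) unit_class_def by auto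
    then show "C \<in> (\<lambda>a. {b\<in>big_ball. N (b - a) \<le> 1}) ` A" using a(1) by blast
  qed
  then show ?thesis using A(1) finite_surj by blast
qed

lemma card_unit_classes: "0 < card unit_classes"
proof -
  have "0 \<in> big_ball" using L.cl(1) L.zero q_ge2 by (simp add: big_ball_def)
  then show ?thesis using finite_unit_classes by (auto simp: card_gt_0_iff unit_classes_def)
qed

text \<open>Multiplication by an element \<open>t\<close> of value \<open>q ^ j\<close> carries the
  radius \<open>\<rho>\<close> to \<open>kap n\<close> and the integers to \<open>big_ball\<close>.
  It is taken from \<open>k\<close>, where this value is certainly attained.\<close>

lemma le_rho_iff:
  assumes z: "z \<in> K n"
  shows "N z \<le> \<rho> \<longleftrightarrow> (\<forall>a\<in>big_ball. chr (T 1 n (a * z)) = 1)"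
proof -
  obtain \<omega> where "local_field (K 1) N \<omega> (1 / real q)" using local_field_K1 by blast
  then interpret L1: local_field "K 1" N \<omega> "1 / real q" .
  define t where "t = inverse (\<omega> ^ j)"
  have t1: "t \<in> K 1" unfolding t_def by (intro L1.cl L1.unif)
  have tn: "t \<in> K n" by (rule K_mono'[OF _ n t1]) simp
  have Nt: "N t = real q ^ j" using L1.cl(9)[OF L1.unif(1)] by (simp add: t_def L1.inv L1.power L1.unif power_one_over)
  have qj: "0 < real q ^ j" using q_ge2 by simp
  have t0: "t \<noteq> 0" using Nt qj L1.zero by auto
  have tz: "t * z \<in> K n" by (rule L.cl(5)[OF tn z])
  have "N z \<le> \<rho> \<longleftrightarrow> N (t * z) \<le> kap n"
    using qj unfolding rho L.mult[OF tn z] Nt by (simp add: power_one_over field_simps)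
  also have "\<dots> \<longleftrightarrow> (\<forall>a\<in>K n. N a \<le> 1 \<longrightarrow> chr (T 1 n (a * (t * z))) = 1)"
  proof
    assume "N (t * z) \<le> kap n"
    then have "\<forall>a\<in>K n. N a \<le> 1 \<longrightarrow> N (T 1 n (a * (t * z))) \<le> 1" using N_le_kap_iff[OF n tz] by simp
    then show "\<forall>a\<in>K n. N a \<le> 1 \<longrightarrow> chr (T 1 n (a * (t * z))) = 1"
      using T_in[OF _ n L.cl(5)[OF _ tz]] by (auto intro!: chr_triv)
  next
    assume "\<forall>a\<in>K n. N a \<le> 1 \<longrightarrow> chr (T 1 n (a * (t * z))) = 1"
    then show "N (t * z) \<le> kap n" by (intro le_kap_of_chr_trivial[OF n tz]) auto
  qed
  also have "\<dots> \<longleftrightarrow> (\<forall>a\<in>big_ball. chr (T 1 n (a * z)) = 1)"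
  proof
    assume h: "\<forall>a\<in>K n. N a \<le> 1 \<longrightarrow> chr (T 1 n (a * (t * z))) = 1"
    show "\<forall>a\<in>big_ball. chr (T 1 n (a * z)) = 1"
    proof
      fix a assume a: "a \<in> big_ball"
      have "a / t \<in> K n" "N (a / t) \<le> 1" using a L.cl(8)[OF _ tn] L.divide[OF _ tn] Nt qj by (auto simp: big_ball_def)
      then have "chr (T 1 n (a / t * (t * z))) = 1" using h by blast
      then show "chr (T 1 n (a * z)) = 1" using t0 by simp
    qed
  next
    assume h: "\<forall>a\<in>big_ball. chr (T 1 n (a * z)) = 1"
    show "\<forall>a\<in>K n. N a \<le> 1 \<longrightarrow> chr (T 1 n (a * (t * z))) = 1"
    proof (intro ballI impI)
      fix a assume a: "a \<in> K n" "N a \<le> 1"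
      have "a * t \<in> big_ball" using L.cl(5)[OF a(1) tn] L.mult[OF a(1) tn] Nt qj a(2) mult_right_mono[OF a(2), of "real q ^ j"]
        by (simp add: big_ball_def)
      then have "chr (T 1 n (a * t * z)) = 1" using h by blast
      then show "chr (T 1 n (a * (t * z))) = 1" by (simp add: mult.assoc)
    qed
  qed
  finally show ?thesis .
qed

lemma psi_add:
  assumes "a \<in> K n" "b \<in> K n" "z \<in> K n"
  shows "chr (T 1 n ((a + b) * z)) = chr (T 1 n (a * z)) * chr (T 1 n (b * z))"
proof -
  have ab: "a * z \<in> K n" "b * z \<in> K n" using L.cl(5) assms by auto
  have "T 1 n (a * z) \<in> K 1" "T 1 n (b * z) \<in> K 1" using T_in[OF _ n] ab by auto
  then show ?thesis using T_add[OF _ n ab] by (simp add: distrib_right chr_add)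
qed

lemma psi_class:
  assumes z: "z \<in> K n" "N z \<le> kap n" and ab: "a \<in> K n" "b \<in> K n" "N (a - b) \<le> 1"
  shows "chr (T 1 n (a * z)) = chr (T 1 n (b * z))"
proof -
  have d: "a - b \<in> K n" by (rule L.cl(4)[OF ab(1,2)])
  have "N (T 1 n ((a - b) * z)) \<le> 1" using N_le_kap_iff[OF n z(1)] z(2) d ab(3) by blast
  moreover have "T 1 n ((a - b) * z) \<in> K 1" using T_in[OF _ n L.cl(5)[OF d z(1)]] by simp
  ultimately have "chr (T 1 n ((a - b) * z)) = 1" by (intro chr_triv)
  then show ?thesis using psi_add[OF d ab(2) z(1)] by simp
qed

text \<open>Orthogonality of characters: if the character is nontrivial at some \<open>a\<close>,
  translation by \<open>a\<close> permutes the classes and multiplies the sum by a factor other than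
  1.\<close>

lemma char_sum_eq:
  assumes z: "z \<in> K n" "N z \<le> kap n"
  shows "char_sum z = (if N z \<le> \<rho> then of_nat (card unit_classes) else 0)"
proof (cases "N z \<le> \<rho>")
  case True
  then have "chr (T 1 n (class_rep C * z)) = 1" if "C \<in> unit_classes" for C using le_rho_iff[OF z(1)] class_rep(1)[OF that] by blast
  then show ?thesis using True by (simp add: char_sum_def)
next
  case False
  then obtain a where a: "a \<in> big_ball" "chr (T 1 n (a * z)) \<noteq> 1" using le_rho_iff[OF z(1)] by blast
  let ?tr = "\<lambda>C. unit_class (class_rep C + a)"
  have PK: "b \<in> K n" if "b \<in> big_ball" for b using that by (simp add: big_ball_def)
  have sub: "?tr ` unit_classes \<subseteq> unit_classes" using class_rep(1) big_ball_add a(1) by (auto simp: unit_classes_def)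
  have inj: "inj_on ?tr unit_classes"
  proof (rule inj_onI)
    fix C D assume CD: "C \<in> unit_classes" "D \<in> unit_classes" "?tr C = ?tr D"
    have "N ((class_rep C + a) - (class_rep D + a)) \<le> 1"
      using CD(3) unit_class_eq_iff[OF big_ball_add[OF class_rep(1)[OF CD(1)] a(1)] big_ball_add[OF class_rep(1)[OF CD(2)] a(1)]] by simp
    then have "unit_class (class_rep C) = unit_class (class_rep D)" using unit_class_eq_iff[OF class_rep(1)[OF CD(1)] class_rep(1)[OF CD(2)]] by simp
    then show "C = D" using class_rep(2) CD by simp
  qed
  have bij: "bij_betw ?tr unit_classes unit_classes" using inj endo_inj_surj[OF finite_unit_classes sub inj] by (simp add: bij_betw_def)
  have "char_sum z = (\<Sum>C\<in>unit_classes. chr (T 1 n (class_rep (?tr C) * z)))"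
    unfolding char_sum_def by (rule sum.reindex_bij_betw[OF bij, symmetric])
  also have "\<dots> = (\<Sum>C\<in>unit_classes. chr (T 1 n (class_rep C * z)) * chr (T 1 n (a * z)))"
  proof (rule sum.cong[OF refl])
    fix C assume C: "C \<in> unit_classes"
    have tC: "?tr C \<in> unit_classes" using sub C by auto
    have PP: "class_rep C + a \<in> big_ball" by (rule big_ball_add[OF class_rep(1)[OF C] a(1)])
    have "N (class_rep (?tr C) - (class_rep C + a)) \<le> 1"
      using unit_class_eq_iff[OF class_rep(1)[OF tC] PP] class_rep(2)[OF tC] by simp
    then have "chr (T 1 n (class_rep (?tr C) * z)) = chr (T 1 n ((class_rep C + a) * z))"
      by (intro psi_class[OF z] PK class_rep(1)[OF tC] PP)
    then show "chr (T 1 n (class_rep (?tr C) * z)) = chr (T 1 n (class_rep C * z)) * chr (T 1 n (a * z))"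
      using psi_add[OF PK[OF class_rep(1)[OF C]] PK[OF a(1)] z(1)] by simp
  qed
  also have "\<dots> = char_sum z * chr (T 1 n (a * z))" by (simp add: char_sum_def sum_distrib_right)
  finally have "char_sum z = 0" using a(2) by simp
  then show ?thesis using False by simp
qed

lemma rho_le: "\<rho> \<le> kap n" and rho_pos: "0 < \<rho>"
proof -
  have "(1 / real q) ^ j \<le> 1" using q_ge2 by (intro power_le_one) auto
  then show "\<rho> \<le> kap n" using kap_pos[OF n] unfolding rho by (simp add: mult_left_le)
  show "0 < \<rho>" using kap_pos[OF n] q_ge2 unfolding rho by simp
qed

text \<open>Almost everywhere the character sum at \<open>x n - c\<close> is the number of classes
  times the indicator of the ball. On integrating, only integral representatives contribute, and for
  them the phase coming from \<open>c\<close> is 1. The point is that the right-hand side does not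
  depend on \<open>c\<close>.\<close>

lemma measure_ball:
  assumes c: "c \<in> K n" "N c \<le> kap n"
  shows "complex_of_real (measure \<mu> (cyl n c \<rho>)) * of_nat (card unit_classes) = (\<Sum>C\<in>unit_classes. Omega abs1 K (class_rep C))"
proof -
  have repK: "class_rep C \<in> K n" if "C \<in> unit_classes" for C using class_rep(1)[OF that] by (simp add: big_ball_def)
  let ?k = "\<lambda>C. inverse (chr (T 1 n (class_rep C * c)))"
  have Tc: "T 1 n (a * c) \<in> K 1" if "a \<in> K n" for a using T_in[OF _ n L.cl(5)[OF that c(1)]] by simp
  have split: "chr (T 1 n (class_rep C * (x n - c))) = ?k C * chr (pairing K (class_rep C) x)" if C: "C \<in> unit_classes" and x: "x \<in> KB" for C x
  proof -
    have xn: "x n \<in> K n" by (rule KB_D(2)[OF x n])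
    have xc: "x n - c \<in> K n" by (rule L.cl(4)[OF xn c(1)])
    have in1: "class_rep C * (x n - c) \<in> K n" "class_rep C * c \<in> K n" using L.cl(5)[OF repK[OF C]] xc c(1) by auto
    have "T 1 n (class_rep C * (x n - c)) + T 1 n (class_rep C * c) = T 1 n (class_rep C * x n)"
      using T_add[OF _ n in1] by (simp add: right_diff_distrib)
    moreover have "chr (T 1 n (class_rep C * (x n - c)) + T 1 n (class_rep C * c))
        = chr (T 1 n (class_rep C * (x n - c))) * chr (T 1 n (class_rep C * c))"
      using T_in[OF _ n] in1 by (intro chr_add) auto
    moreover have "chr (T 1 n (class_rep C * c)) \<noteq> 0" using chr_norm[OF Tc[OF repK[OF C]]] by auto
    ultimately show ?thesis using pairing_eq[OF n repK[OF C] x] by (simp add: field_simps)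
  qed
  have cylx: "x \<in> cyl n c \<rho> \<longleftrightarrow> N (x n - c) \<le> \<rho>" if "x \<in> KB" for x using that by (simp add: cyl_def)
  have ae: "AE x in \<mu>. (\<Sum>C\<in>unit_classes. ?k C * chr (pairing K (class_rep C) x)) = of_nat (card unit_classes) * indicator (cyl n c \<rho>) x"
    using AE_le_kap[OF n]
  proof (rule AE_mp, intro AE_I2 impI)
    fix x assume x: "x \<in> space \<mu>" "N (x n) \<le> kap n"
    have xK: "x \<in> KB" using x space_mu by simp
    have xn: "x n \<in> K n" by (rule KB_D(2)[OF xK n])
    have "N (x n - c) \<le> kap n" using L.diff[OF xn c(1)] x(2) c(2) by simp
    then have "char_sum (x n - c) = (if N (x n - c) \<le> \<rho> then of_nat (card unit_classes) else 0)"
      by (rule char_sum_eq[OF L.cl(4)[OF xn c(1)]])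
    moreover have "char_sum (x n - c) = (\<Sum>C\<in>unit_classes. ?k C * chr (pairing K (class_rep C) x))"
      unfolding char_sum_def using split xK by (intro sum.cong) auto
    ultimately show "(\<Sum>C\<in>unit_classes. ?k C * chr (pairing K (class_rep C) x)) = of_nat (card unit_classes) * indicator (cyl n c \<rho>) x"
      using cylx[OF xK] by (simp add: indicator_def)
  qed
  have cs: "cyl n c \<rho> \<in> sets \<mu>" by (rule cyl_sets[OF n c(1) rho_pos])
  have "(LINT x|\<mu>. indicator (cyl n c \<rho>) x :: complex) = (LINT x|\<mu>. complex_of_real (indicator (cyl n c \<rho>) x))"
    by (intro Bochner_Integration.integral_cong) (simp_all split: split_indicator)
  also have "\<dots> = complex_of_real (measure \<mu> (cyl n c \<rho>))"
    using cs by (simp add: sets.Int_space_eq2)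
  finally have ind: "(LINT x|\<mu>. indicator (cyl n c \<rho>) x) = complex_of_real (measure \<mu> (cyl n c \<rho>))" .
  have "of_nat (card unit_classes) * complex_of_real (measure \<mu> (cyl n c \<rho>))
      = (LINT x|\<mu>. of_nat (card unit_classes) * indicator (cyl n c \<rho>) x)"
    unfolding ind[symmetric] by (simp only: integral_mult_right_zero)
  also have "\<dots> = (LINT x|\<mu>. (\<Sum>C\<in>unit_classes. ?k C * chr (pairing K (class_rep C) x)))"
    using ae cs psi_measurable[OF n repK] by (intro integral_cong_AE) (auto elim!: AE_mp)
  also have "\<dots> = (\<Sum>C\<in>unit_classes. LINT x|\<mu>. ?k C * chr (pairing K (class_rep C) x))"
    using psi_integrable[OF n repK] by (intro Bochner_Integration.integral_sum) auto
  also have "\<dots> = (\<Sum>C\<in>unit_classes. Omega abs1 K (class_rep C))"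
  proof (rule sum.cong[OF refl])
    fix C assume C: "C \<in> unit_classes"
    have "(LINT x|\<mu>. ?k C * chr (pairing K (class_rep C) x)) = ?k C * Omega abs1 K (class_rep C)"
      using psi_integral[OF n repK[OF C]] by simp
    also have "\<dots> = Omega abs1 K (class_rep C)"
    proof (cases "N (class_rep C) \<le> 1")
      case True
      have "N (T 1 n (class_rep C * c)) \<le> 1" using N_le_kap_iff[OF n c(1)] c(2) repK[OF C] True by blast
      then show ?thesis using chr_triv[OF Tc[OF repK[OF C]]] by simp
    qed (simp add: Omega_def)
    finally show "(LINT x|\<mu>. ?k C * chr (pairing K (class_rep C) x)) = Omega abs1 K (class_rep C)" .
  qed
  finally show ?thesis by (simp add: mult.commute)
qed

text \<open>Centres in the dual of \<open>O\<close> are covered by \<open>measure_ball\<close>. A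
  ball centred elsewhere misses the dual, because its radius is at most \<open>kap n\<close>, so it
  is null; and adding \<open>s\<close> does not move a centre across the boundary.\<close>

lemma measure_ball_shift:
  assumes c: "c \<in> K n" and s: "s \<in> K n" "N s \<le> kap n"
  shows "emeasure \<mu> (cyl n (c + s) \<rho>) = emeasure \<mu> (cyl n c \<rho>)"
proof -
  have cs: "c + s \<in> K n" by (rule L.cl(3)[OF c s(1)])
  have null: "emeasure \<mu> (cyl n b \<rho>) = 0" if b: "b \<in> K n" "\<not> N b \<le> kap n" for b
  proof -
    have "AE x in \<mu>. x \<notin> cyl n b \<rho>" using AE_le_kap[OF n]
    proof (rule AE_mp, intro AE_I2 impI notI)
      fix x assume x: "x \<in> space \<mu>" "N (x n) \<le> kap n" "x \<in> cyl n b \<rho>"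
      have xn: "x n \<in> K n" using x(1) KB_D(2)[OF _ n] by (simp add: space_mu)
      have "N b = N (x n - (x n - b))" by simp
      also have "\<dots> \<le> max (N (x n)) (N (x n - b))" by (rule L.diff[OF xn L.cl(4)[OF xn b(1)]])
      also have "\<dots> \<le> kap n" using x rho_le by (simp add: cyl_def)
      finally show False using b(2) by simp
    qed
    then show ?thesis using AE_iff_measurable[OF cyl_sets[OF n b(1) rho_pos], of "\<lambda>x. x \<notin> cyl n b \<rho>"]
      by (auto simp: cyl_def space_mu)
  qed
  show ?thesis
  proof (cases "N c \<le> kap n")
    case True
    then have "N (c + s) \<le> kap n" using L.ultra[OF c s(1)] s(2) by simp
    then have "complex_of_real (measure \<mu> (cyl n (c + s) \<rho>)) = complex_of_real (measure \<mu> (cyl n c \<rho>))"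
      using measure_ball[OF cs] measure_ball[OF c True] card_unit_classes by (metis mult_right_cancel of_nat_eq_0_iff less_numeral_extra(3))
    then show ?thesis by (simp add: emeasure_eq_measure)
  next
    case False
    have "\<not> N (c + s) \<le> kap n"
    proof
      assume a: "N (c + s) \<le> kap n"
      have "N c = N ((c + s) - s)" by simp
      also have "\<dots> \<le> max (N (c + s)) (N s)" by (rule L.diff[OF cs s(1)])
      finally show False using a s(2) False by simp
    qed
    then show ?thesis using null[OF cs] null[OF c False] by simp
  qed
qed

end

section \<open>Invariance under translation by elements of \<open>S\<close>\<close>

lemma minus_measurable:
  assumes y: "y \<in> KB"
  shows "(\<lambda>x. \<lambda>n. x n - y n) \<in> measurable \<mu> \<mu>"
    and "1 \<le> i \<Longrightarrow> c \<in> K i \<Longrightarrow> (\<lambda>x. \<lambda>n. x n - y n) -` cyl i c r \<inter> space \<mu> = cyl i (c + y i) r"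
proof -
  show pre: "(\<lambda>x. \<lambda>n. x n - y n) -` cyl i c r \<inter> space \<mu> = cyl i (c + y i) r" if "1 \<le> i" "c \<in> K i" for i c r
    using KB_diff[OF _ y] by (auto simp: cyl_def space_mu algebra_simps)
  show "(\<lambda>x. \<lambda>n. x n - y n) \<in> measurable \<mu> \<mu>"
  proof (rule measurable_sigma_sets[OF sets_mu cyls_Pow])
    show "(\<lambda>x. \<lambda>n. x n - y n) \<in> space \<mu> \<rightarrow> KB" using KB_diff[OF _ y] by (auto simp: space_mu)
    fix C assume "C \<in> cyls"
    then consider "C = {}" | i c where "C = cyl i c (rad i)" "1 \<le> i" "c \<in> K i" by (auto simp: cyls_def)
    then show "(\<lambda>x. \<lambda>n. x n - y n) -` C \<inter> space \<mu> \<in> sets \<mu>"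
    proof cases
      case (2 i c)
      have "c + y i \<in> K i" by (rule subfield_closed(3)[OF K_sub[OF 2(2)] 2(3) KB_D(2)[OF y 2(2)]])
      then show ?thesis unfolding 2(1) pre[OF 2(2,3)] by (rule cyl_sets[OF 2(2) _ rad_pos[OF 2(2)]])
    qed simp
  qed
qed

text \<open>\<open>shift\<close> is an image; as the preimage under subtraction of \<open>y\<close>
  it becomes accessible to a push-forward, which agrees with the measure on the generating
  balls.\<close>

theorem shift_invariant:
  assumes y: "y \<in> Sset abs1 K" and A: "A \<in> sets \<mu>"
  shows "emeasure \<mu> (shift y A) = emeasure \<mu> A"
proof -
  let ?f = "\<lambda>x. \<lambda>n. x n - y n"
  have yK: "y \<in> KB" and yk: "\<And>n. 1 \<le> n \<Longrightarrow> N (y n) \<le> kap n" using y by (auto simp: Sset_eq)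
  have f: "?f \<in> measurable \<mu> \<mu>" by (rule minus_measurable(1)[OF yK])
  have "distr \<mu> \<mu> ?f = \<mu>"
  proof (rule measure_eqI_generator_eq_countable[OF cyls_Int_stable cyls_Pow])
    fix C assume "C \<in> cyls"
    then consider "C = {}" | i c where "C = cyl i c (rad i)" "1 \<le> i" "c \<in> K i" by (auto simp: cyls_def)
    then show "emeasure (distr \<mu> \<mu> ?f) C = emeasure \<mu> C"
    proof cases
      case (2 i c)
      obtain j :: nat where j: "rad i = kap i * (1 / real q) ^ j" using rad_form[OF 2(2)] by blast
      have "emeasure (distr \<mu> \<mu> ?f) C = emeasure \<mu> (?f -` C \<inter> space \<mu>)"
        by (rule emeasure_distr[OF f]) (use cyl_sets[OF 2(2,3) rad_pos[OF 2(2)]] 2(1) in simp)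
      also have "\<dots> = emeasure \<mu> (cyl i (c + y i) (rad i))"
        unfolding 2(1) minus_measurable(2)[OF yK 2(2,3)] ..
      also have "\<dots> = emeasure \<mu> C"
        unfolding 2(1) by (rule measure_ball_shift[OF 2(2) j 2(3) KB_D(2)[OF yK 2(2)] yk[OF 2(2)]])
      finally show ?thesis .
    qed simp
  next
    show "sets (distr \<mu> \<mu> ?f) = sigma_sets KB cyls" "sets \<mu> = sigma_sets KB cyls" using sets_mu by simp_all
    show "cyls \<subseteq> cyls" ..
    have "openin (KBar_top abs1 K) KB" unfolding openin_KBar_top by (auto intro!: exI[of _ 1])
    then show "\<Union>cyls = KB" using open_eq_Union_cyls[of KB] cyls_Pow by blast
    show "countable cyls" by (rule countable_cyls)
    show "emeasure (distr \<mu> \<mu> ?f) a \<noteq> \<infinity>" for a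
      using prob_space.finite_measure[OF prob_space_distr[OF f]] finite_measure.emeasure_finite by fastforce
  qed
  then have "emeasure \<mu> A = emeasure (distr \<mu> \<mu> ?f) A" by simp
  also have "\<dots> = emeasure \<mu> (?f -` A \<inter> space \<mu>)" by (rule emeasure_distr[OF f A])
  also have "?f -` A \<inter> space \<mu> = shift y A"
  proof (intro equalityI subsetI)
    fix x assume "x \<in> ?f -` A \<inter> space \<mu>"
    then show "x \<in> shift y A" unfolding shift_def by (intro image_eqI[of _ _ "?f x"]) auto
  next
    fix x assume "x \<in> shift y A"
    then obtain w where w: "w \<in> A" "x = (\<lambda>n. w n + y n)" by (auto simp: shift_def)
    have "w \<in> KB" using w sets.sets_into_space[OF A] space_mu by auto
    then show "x \<in> ?f -` A \<inter> space \<mu>" using w KB_add[OF _ yK] by (simp add: space_mu)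
  qed
  finally show ?thesis by simp
qed

text \<open>The bound comes from scaling \<open>a\<close> by powers of a uniformizer of
  \<open>k\<close>. If the scaled element is integral, its pairing is integral almost everywhere.
  For the first power that makes it non-integral this must fail on a set of positive measure, since
  otherwise its character would have integral 1, while the Fourier transform gives 0.\<close>

theorem esssup_pairing:
  assumes n: "1 \<le> n" and a: "a \<in> K n" "a \<noteq> 0"
    and Na: "absn abs1 K n a = real (qres abs1 K n) powr real_of_int m"
  shows "esssup \<mu> (\<lambda>x. ereal (abs1 (pairing K a x))) =
     ereal (real q powr real_of_int (- \<lfloor>- real_of_int m / real (ram abs1 K n)\<rfloor>))"
proof -
  interpret L: nonarch "K n" N by (rule nonarch_K[OF n])
  obtain \<omega> where "local_field (K 1) N \<omega> (1 / real q)" using local_field_K1 by blast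
  then interpret L1: local_field "K 1" N \<omega> "1 / real q" .
  obtain \<pi> u e f where I: "local_field (K n) N \<pi> u" "0 < e" "u ^ e = 1 / real q" by (rule K_invariants[OF n])
  have ram: "ram abs1 K n = e" by (rule ram_eq[OF n I])
  have u: "0 < u" "u < 1" using I(1) by (auto simp: local_field_def local_field_axioms_def)
  have q0: "0 < real q" "1 < real q" using q_ge2 by auto
  have "N a = u powi (- m)"
  proof -
    have md: "0 < mdeg K n" by (rule mdeg_pos[OF n])
    have "N a = (N a ^ mdeg K n) powr (1 / real (mdeg K n))"
      using L.pos[OF a] md by (simp add: powr_realpow[symmetric] powr_powr)
    also have "\<dots> = real (qres abs1 K n) powr (real_of_int m / real (mdeg K n))"
      using Na by (simp add: absn_def powr_powr)
    also have "\<dots> = u powi (- m)" by (rule qres_powr[OF n I(1)])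
    finally show ?thesis .
  qed
  then have Na': "N a = real q powr (real_of_int m / real e)"
  proof -
    have "u = (u ^ e) powr (1 / real e)" using u I(2) by (simp add: powr_realpow[symmetric] powr_powr)
    also have "\<dots> = real q powr (- (1 / real e))" unfolding I(3) using q0 by (simp add: powr_divide powr_minus_divide)
    finally have uq: "u = real q powr (- (1 / real e))" .
    have "N a = u powr real_of_int (- m)" using \<open>N a = u powi (- m)\<close> powr_int_eq[OF u(1)] by metis
    also have "\<dots> = real q powr (real_of_int m / real e)" by (subst uq) (simp add: powr_powr)
    finally show ?thesis .
  qed
  \<comment> \<open>The largest exponent \<open>i\<close> for which
    \<open>\<omega> powi (- i) * a\<close> is still integral, because that element has norm
    \<open>q\<close> to the power \<open>i + m / e\<close>.\<close>
  define fl where "fl = \<lfloor>- real_of_int m / real e\<rfloor>"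
  have fl: "real_of_int fl \<le> - (real_of_int m / real e)" "- (real_of_int m / real e) < real_of_int fl + 1"
    unfolding fl_def by linarith+
  define R where "R = real q powr real_of_int (- fl)"
  have R0: "0 < R" using q0 by (simp add: R_def)
  have bK: "\<omega> powi (- i) \<in> K 1" "\<omega> powi (- i) \<in> K n" "N (\<omega> powi (- i)) = real q powr real_of_int i" for i
  proof -
    show b1: "\<omega> powi (- i) \<in> K 1" by (rule L1.unif_powi)
    show "\<omega> powi (- i) \<in> K n" by (rule K_mono'[OF _ n b1]) simp
    show "N (\<omega> powi (- i)) = real q powr real_of_int i"
      unfolding L1.unif_powi(2) powr_int_eq[OF q0(1)] by (simp add: power_int_minus power_int_divide_distrib)
  qed
  have Nba: "N (\<omega> powi (- i) * a) = real q powr (real_of_int i + real_of_int m / real e)" for i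
    using L.mult[OF bK(2) a(1)] by (simp add: bK Na' powr_add)
  have baK: "\<omega> powi (- i) * a \<in> K n" for i by (rule L.cl(5)[OF bK(2) a(1)])
  have pair: "pairing K (\<omega> powi (- i) * a) x = \<omega> powi (- i) * pairing K a x" if x: "x \<in> KB" for i x
  proof -
    have "a * x n \<in> K n" by (rule L.cl(5)[OF a(1) KB_D(2)[OF x n]])
    then show ?thesis using pairing_eq[OF n baK x] pairing_eq[OF n a(1) x] T_scale[OF _ n bK(1)] by (simp add: mult.assoc)
  qed
  have Npair: "N (\<omega> powi (- i) * pairing K a x) = real q powr real_of_int i * N (pairing K a x)" if x: "x \<in> KB" for i x
    using L1.mult[OF bK(1) pairing_in[OF n a(1) x]] by (simp add: bK)
  have upper: "AE x in \<mu>. N (pairing K a x) \<le> R"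
    using AE_le_kap[OF n]
  proof (rule AE_mp, intro AE_I2 impI)
    fix x assume x: "x \<in> space \<mu>" "N (x n) \<le> kap n"
    have xK: "x \<in> KB" using x space_mu by simp
    have "N (\<omega> powi (- fl) * a) \<le> 1"
      unfolding Nba using q0 fl powr_mono[of "real_of_int fl + real_of_int m / real e" 0 "real q"] by simp
    then have "N (T 1 n (\<omega> powi (- fl) * a * x n)) \<le> 1"
      using N_le_kap_iff[OF n KB_D(2)[OF xK n]] x(2) baK by blast
    then have "N (\<omega> powi (- fl) * pairing K a x) \<le> 1" using pairing_eq[OF n baK xK] pair[OF xK] by simp
    then have "real q powr real_of_int fl * N (pairing K a x) \<le> 1" using Npair[OF xK] by simp
    then show "N (pairing K a x) \<le> R"
      using q0 by (simp add: R_def powr_minus_divide field_simps)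
  qed
  have lower: "\<not> (AE x in \<mu>. N (pairing K a x) < R)"
  proof
    assume ae: "AE x in \<mu>. N (pairing K a x) < R"
    let ?b = "\<omega> powi (- (fl + 1)) * a"
    have "AE x in \<mu>. chr (pairing K ?b x) = 1" using ae
    proof (rule AE_mp, intro AE_I2 impI)
      fix x assume x: "x \<in> space \<mu>" "N (pairing K a x) < R"
      have xK: "x \<in> KB" using x space_mu by simp
      let ?w = "\<omega> powi (- fl) * pairing K a x"
      have "N ?w < real q powr real_of_int fl * R" using Npair[OF xK, of fl] x(2) q0 by simp
      also have "\<dots> = 1" using q0 by (simp add: R_def powr_minus_divide)
      finally have "N ?w < 1" .
      \<comment> \<open>Values in \<open>k\<close> are discrete, so the strict bound gains a whole
        factor \<open>q\<close>, exactly what the next power of the uniformizer costs.\<close>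
      then have "N ?w \<le> 1 / real q"
        by (rule L1.lt_one[OF L1.cl(5)[OF bK(1) pairing_in[OF n a(1) xK]]])
      then have "real q powr real_of_int (fl + 1) * N (pairing K a x) \<le> 1"
        using Npair[OF xK, of fl] q0 by (simp add: powr_add field_simps)
      then have "N (pairing K ?b x) \<le> 1" unfolding pair[OF xK] Npair[OF xK] .
      then show "chr (pairing K ?b x) = 1" by (rule chr_triv[OF pairing_in[OF n baK xK]])
    qed
    then have "(LINT x|\<mu>. chr (pairing K ?b x)) = (LINT x|\<mu>. 1)"
      by (intro integral_cong_AE psi_measurable[OF n baK] borel_measurable_const)
    also have "\<dots> = 1" by (simp add: prob_space)
    finally have "Omega abs1 K ?b = 1" unfolding psi_integral[OF n baK] .
    then have "N ?b \<le> 1" unfolding Omega_def by (simp only: zero_neq_one split: if_splits)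
    moreover have "1 < N ?b"
      unfolding Nba using q0 fl powr_less_mono[of 0 "real_of_int (fl + 1) + real_of_int m / real e" "real q"]
      by simp
    ultimately show False by simp
  qed
  have meas: "(\<lambda>x. ereal (abs1 (pairing K a x))) \<in> borel_measurable \<mu>"
  proof -
    have "(\<lambda>x. ereal (N (pairing K a x))) \<in> borel_measurable \<mu>"
      using abs_pairing_measurable[OF n a(1)] by simp
    moreover have "ereal (N (pairing K a x)) = ereal (abs1 (pairing K a x))" if "x \<in> space \<mu>" for x
      using N_abs1[OF pairing_in[OF n a(1)]] that by (simp add: space_mu)
    ultimately show ?thesis by (subst measurable_cong[symmetric]) auto
  qed
  have eqN: "AE x in \<mu>. abs1 (pairing K a x) = N (pairing K a x)"
    using N_abs1[OF pairing_in[OF n a(1)]] by (intro AE_I2) (simp add: space_mu)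
  have "esssup \<mu> (\<lambda>x. ereal (abs1 (pairing K a x))) = ereal R"
    unfolding esssup_eq_AE[OF meas]
  proof (rule antisym)
    have "AE x in \<mu>. ereal (abs1 (pairing K a x)) \<le> ereal R" using upper eqN by eventually_elim simp
    then show "Inf {z. AE x in \<mu>. ereal (abs1 (pairing K a x)) \<le> z} \<le> ereal R" by (intro Inf_lower) simp
    show "ereal R \<le> Inf {z. AE x in \<mu>. ereal (abs1 (pairing K a x)) \<le> z}"
    proof (rule Inf_greatest)
      fix z assume "z \<in> {z. AE x in \<mu>. ereal (abs1 (pairing K a x)) \<le> z}"
      then have z: "AE x in \<mu>. ereal (abs1 (pairing K a x)) \<le> z" by simp
      show "ereal R \<le> z"
      proof (rule ccontr)
        assume "\<not> ereal R \<le> z"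
        then have zR: "z < ereal R" by simp
        have "AE x in \<mu>. N (pairing K a x) < R"
          using z eqN
        proof (eventually_elim)
          case (elim x)
          then have "ereal (N (pairing K a x)) \<le> z" by simp
          from order.strict_trans1[OF this zR] show ?case by simp
        qed
        then show False using lower by simp
      qed
    qed
  qed
  then show ?thesis unfolding R_def fl_def ram by simp
qed

end

section \<open>Density of locally constant functions\<close>

context tower
begin

section \<open>The metric topology of a layer and compactness of its balls\<close>

lemma K_metric:
  assumes n: "1 \<le> n"
  shows "Metric_space (K n) (\<lambda>x y. N (x - y))"
proof -
  interpret L: nonarch "K n" N by (rule nonarch_K[OF n])
  show ?thesis
  proof
    show "0 \<le> N (x - y)" for x y by (rule N_nonneg)
    show "N (x - y) = N (y - x)" for x y
    proof (cases "x - y \<in> Kunion K")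
      case True
      then show ?thesis using N.minus[OF True] by simp
    next
      case False
      then have "y - x \<notin> Kunion K" using N.cl(7)[of "y - x"] by auto
      then show ?thesis using N_out False by simp
    qed
    show "(N (x - y) = 0) = (x = y)" if "x \<in> K n" "y \<in> K n" for x y
      using L.eq0[OF L.cl(4)[OF that]] by simp
    show "N (x - z) \<le> N (x - y) + N (y - z)" if "x \<in> K n" "y \<in> K n" "z \<in> K n" for x y z
    proof -
      have "N (x - z) = N ((x - y) + (y - z))" by simp
      also have "\<dots> \<le> max (N (x - y)) (N (y - z))" using that by (intro L.ultra L.cl(4))
      finally show ?thesis using N_nonneg[of "x - y"] N_nonneg[of "y - z"] by linarith
    qed
  qed
qed

text \<open>Gives access to the characterization of relatively compact sets by total boundedness in
  a complete metric space.\<close>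

lemma Kn_top_eq:
  assumes n: "1 \<le> n"
  shows "Kn_top abs1 K n = Metric_space.mtopology (K n) (\<lambda>x y. N (x - y))"
proof -
  interpret M: Metric_space "K n" "\<lambda>x y. N (x - y)" by (rule K_metric[OF n])
  have "(\<lambda>U. U \<subseteq> K n \<and> (\<forall>x\<in>U. \<exists>r>0. \<forall>y\<in>K n. N (y - x) < r \<longrightarrow> y \<in> U)) = openin M.mtopology"
  proof
    fix U
    show "(U \<subseteq> K n \<and> (\<forall>x\<in>U. \<exists>r>0. \<forall>y\<in>K n. N (y - x) < r \<longrightarrow> y \<in> U)) = openin M.mtopology U"
    proof (cases "U \<subseteq> K n")
      case True
      have "M.mball x r \<subseteq> U \<longleftrightarrow> (\<forall>y\<in>K n. N (y - x) < r \<longrightarrow> y \<in> U)" if x: "x \<in> U" for x r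
      proof -
        have "M.mball x r = {y\<in>K n. N (y - x) < r}"
          unfolding M.mball_def M.commute[of x] using x True by auto
        then show ?thesis by auto
      qed
      then show ?thesis using True unfolding M.openin_mtopology by auto
    qed (simp add: M.openin_mtopology)
  qed
  then show ?thesis unfolding Kn_top_def by (simp add: openin_inverse)
qed

lemma compact_closure_of_bounded:
  assumes n: "1 \<le> n" and r: "0 < r" and S: "S \<subseteq> {z\<in>K n. N z \<le> r}"
  shows "compactin (Kn_top abs1 K n) ((Kn_top abs1 K n) closure_of S)"
proof -
  interpret M: Metric_space "K n" "\<lambda>x y. N (x - y)" by (rule K_metric[OF n])
  interpret L: nonarch "K n" N by (rule nonarch_K[OF n])
  obtain \<pi> where "local_field (K n) N \<pi> (N \<pi>)" using K_local_field[OF n] by blast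
  then interpret F: local_field "K n" N \<pi> "N \<pi>" .
  have "M.mcomplete"
    unfolding M.mcomplete_def
  proof (intro allI impI)
    fix \<sigma> assume c: "M.MCauchy \<sigma>"
    have sK: "\<sigma> i \<in> K n" for i using c by (auto simp: M.MCauchy_def)
    have "\<exists>l\<in>K n. \<forall>\<epsilon>>0. \<exists>N0. \<forall>i\<ge>N0. N (\<sigma> i - l) < \<epsilon>"
    proof (rule F.complete[OF sK])
      fix \<epsilon> :: real assume "0 < \<epsilon>"
      then obtain m where "\<forall>i j. m \<le> i \<longrightarrow> m \<le> j \<longrightarrow> N (\<sigma> i - \<sigma> j) < \<epsilon>"
        using c unfolding M.MCauchy_def by blast
      then show "\<exists>m. \<forall>i\<ge>m. \<forall>j\<ge>m. N (\<sigma> i - \<sigma> j) < \<epsilon>" by blast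
    qed
    then obtain l where l: "l \<in> K n" "\<forall>\<epsilon>>0. \<exists>N0. \<forall>i\<ge>N0. N (\<sigma> i - l) < \<epsilon>" by blast
    then have "limitin M.mtopology \<sigma> l sequentially"
      using sK by (auto simp: M.limitin_metric eventually_sequentially)
    then show "\<exists>x. limitin M.mtopology \<sigma> x sequentially" by blast
  qed
  moreover have "M.mtotally_bounded {z\<in>K n. N z \<le> r}"
    unfolding M.mtotally_bounded_def
  proof (intro allI impI)
    fix \<epsilon> :: real assume e: "0 < \<epsilon>"
    \<comment> \<open>Total boundedness asks for centres inside the ball. With mesh at most
      \<open>r\<close>, every centre near a point of the ball lies in it by the ultrametric
      inequality.\<close>
    then have "0 < min \<epsilon> r" using r by simp
    then obtain A where A: "finite A" "A \<subseteq> K n" "\<forall>x\<in>K n. N x \<le> r \<longrightarrow> (\<exists>a\<in>A. N (x - a) < min \<epsilon> r)"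
      using F.totally_bounded[of "min \<epsilon> r" r] by blast
    have "{z\<in>K n. N z \<le> r} \<subseteq> (\<Union>x\<in>{a\<in>A. N a \<le> r}. M.mball x \<epsilon>)"
    proof
      fix x assume x: "x \<in> {z\<in>K n. N z \<le> r}"
      then obtain a where a: "a \<in> A" "N (x - a) < min \<epsilon> r" using A(3) by blast
      have aK: "a \<in> K n" "x \<in> K n" using a(1) A(2) x by auto
      have "N a = N (x - (x - a))" by simp
      also have "\<dots> \<le> max (N x) (N (x - a))" by (rule L.diff[OF aK(2) L.cl(4)[OF aK(2,1)]])
      also have "\<dots> \<le> r" using x a(2) by simp
      finally have "a \<in> {a\<in>A. N a \<le> r}" using a(1) by simp
      moreover have "x \<in> M.mball a \<epsilon>" using aK a(2) M.commute[of a x] by simp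
      ultimately show "x \<in> (\<Union>x\<in>{a\<in>A. N a \<le> r}. M.mball x \<epsilon>)" by blast
    qed
    then show "\<exists>A. finite A \<and> A \<subseteq> {z\<in>K n. N z \<le> r} \<and> {z\<in>K n. N z \<le> r} \<subseteq> (\<Union>x\<in>A. M.mball x \<epsilon>)"
      using A(1,2) by (intro exI[of _ "{a\<in>A. N a \<le> r}"]) auto
  qed
  then have "M.mtotally_bounded S" by (rule M.mtotally_bounded_subset[OF _ S])
  ultimately show ?thesis
    unfolding Kn_top_eq[OF n] using M.mtotally_bounded_eq_compact_closure_of by blast
qed

section \<open>Locally constant functions of a single coordinate\<close>

definition loc_const :: "nat \<Rightarrow> ('a \<Rightarrow> complex) \<Rightarrow> bool" where
  "loc_const n \<phi> \<longleftrightarrow> (\<forall>x\<in>K n. \<exists>r>0. \<forall>y\<in>K n. N (y - x) < r \<longrightarrow> \<phi> y = \<phi> x)"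

lemma loc_constD:
  "loc_const n \<phi> \<Longrightarrow> x \<in> K n \<Longrightarrow> \<exists>r>0. \<forall>y\<in>K n. N (y - x) < r \<longrightarrow> \<phi> y = \<phi> x"
  unfolding loc_const_def by blast

lemma loc_const_combine:
  assumes "loc_const n \<phi>" "loc_const n \<psi>"
  shows "loc_const n (\<lambda>z. h (\<phi> z) (\<psi> z))"
  unfolding loc_const_def
proof
  fix x assume x: "x \<in> K n"
  obtain r where r: "0 < r" "\<And>y. y \<in> K n \<Longrightarrow> N (y - x) < r \<Longrightarrow> \<phi> y = \<phi> x"
    using loc_constD[OF assms(1) x] by blast
  obtain t where t: "0 < t" "\<And>y. y \<in> K n \<Longrightarrow> N (y - x) < t \<Longrightarrow> \<psi> y = \<psi> x"
    using loc_constD[OF assms(2) x] by blast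
  show "\<exists>r>0. \<forall>y\<in>K n. N (y - x) < r \<longrightarrow> h (\<phi> y) (\<psi> y) = h (\<phi> x) (\<psi> x)"
    using r t by (intro exI[of _ "min r t"]) auto
qed

lemma loc_const_const: "loc_const n (\<lambda>_. c)"
  unfolding loc_const_def by (auto intro: exI[of _ 1])

lemma loc_const_ball:
  assumes n: "1 \<le> n" and c: "c \<in> K n" and r: "0 < r"
  shows "loc_const n (\<lambda>z. if N (z - c) \<le> r then 1 else 0)"
  unfolding loc_const_def
proof
  fix x assume x: "x \<in> K n"
  interpret L: nonarch "K n" N by (rule nonarch_K[OF n])
  have "N (y - c) \<le> r \<longleftrightarrow> N (x - c) \<le> r" if y: "y \<in> K n" "N (y - x) < r" for y
    using L.diff_trans_le[OF y(1) x c, of r] L.diff_trans_le[OF x y(1) c, of r] y(2) L.commute[OF x y(1)] by auto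
  then show "\<exists>r'>0. \<forall>y\<in>K n. N (y - x) < r' \<longrightarrow> (if N (y - c) \<le> r then 1 else 0) = (if N (x - c) \<le> r then 1 else (0::complex))"
    using r by (intro exI[of _ r]) auto
qed

lemma loc_const_lift:
  assumes n: "1 \<le> n" "n \<le> m" and \<phi>: "loc_const n \<phi>"
  shows "loc_const m (\<lambda>z. \<phi> (T n m z))"
  unfolding loc_const_def
proof
  fix x assume x: "x \<in> K m"
  have m: "1 \<le> m" using n by simp
  obtain r where r: "0 < r" "\<And>y. y \<in> K n \<Longrightarrow> N (y - T n m x) < r \<Longrightarrow> \<phi> y = \<phi> (T n m x)"
    using loc_constD[OF \<phi> T_in[OF n x]] by blast
  let ?C = "N (of_nat (mdeg K n)) / N (of_nat (mdeg K m))"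
  have C: "0 < ?C" using N_mdeg_pos[OF n(1)] N_mdeg_pos[OF m] by simp
  have "\<phi> (T n m y) = \<phi> (T n m x)" if y: "y \<in> K m" "N (y - x) < r / ?C" for y
  proof (rule r(2)[OF T_in[OF n y(1)]])
    have yx: "y - x \<in> K m" by (rule subfield_closed(4)[OF K_sub[OF m] y(1) x])
    have "N (T n m y - T n m x) \<le> ?C * N (y - x)" using T_bound[OF n yx] T_diff[OF n y(1) x] by simp
    also have "\<dots> < ?C * (r / ?C)" using y(2) C by (rule mult_strict_left_mono)
    also have "\<dots> = r"
    proof -
      have "A * (r / A) = r" if "0 < A" for A :: real using that by simp
      from this[OF C] show ?thesis .
    qed
    finally show "N (T n m y - T n m x) < r" .
  qed
  moreover have "0 < r / ?C" using r(1) C by (rule divide_pos_pos)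
  ultimately show "\<exists>r>0. \<forall>y\<in>K m. N (y - x) < r \<longrightarrow> \<phi> (T n m y) = \<phi> (T n m x)" by blast
qed

text \<open>The ball of radius \<open>kap n\<close> is open and closed, so cutting off outside it
  preserves local constancy and gives compact support. Since almost every \<open>x\<close> has its
  coordinate in this ball, the cut-off costs nothing in measure.\<close>

lemma truncation_DK:
  assumes n: "1 \<le> n" and \<phi>: "loc_const n \<phi>"
  shows "(\<lambda>z. if N z \<le> kap n then \<phi> z else 0) \<in> DK abs1 K n"
proof -
  interpret M: Metric_space "K n" "\<lambda>x y. N (x - y)" by (rule K_metric[OF n])
  let ?\<psi> = "\<lambda>z. if N z \<le> kap n then \<phi> z else 0"
  have "loc_const n (\<lambda>z. (\<lambda>a b. b * a) (\<phi> z) (if N (z - 0) \<le> kap n then 1 else 0))"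
    by (rule loc_const_combine[OF \<phi> loc_const_ball[OF n subfield_closed(1)[OF K_sub[OF n]] kap_pos[OF n]]])
  then have lc: "loc_const n ?\<psi>" by (simp add: if_distrib[of "\<lambda>t. t * _"] cong: if_cong)
  have 1: "\<exists>U. openin (Kn_top abs1 K n) U \<and> x \<in> U \<and> (\<forall>y\<in>U. ?\<psi> y = ?\<psi> x)" if x: "x \<in> K n" for x
  proof -
    obtain r where r: "0 < r" "\<And>y. y \<in> K n \<Longrightarrow> N (y - x) < r \<Longrightarrow> ?\<psi> y = ?\<psi> x"
      using loc_constD[OF lc x] by blast
    have "openin (Kn_top abs1 K n) (M.mball x r)" unfolding Kn_top_eq[OF n] by (rule M.openin_mball)
    moreover have "x \<in> M.mball x r" using x r(1) by simp
    moreover have "\<forall>y\<in>M.mball x r. ?\<psi> y = ?\<psi> x"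
    proof
      fix y assume "y \<in> M.mball x r"
      then have y: "y \<in> K n" "N (y - x) < r" using M.commute[of y x] by simp_all
      show "?\<psi> y = ?\<psi> x" by (rule r(2)[OF y])
    qed
    ultimately show ?thesis by (intro exI[of _ "M.mball x r"] conjI)
  qed
  have 2: "compactin (Kn_top abs1 K n) ((Kn_top abs1 K n) closure_of {x\<in>K n. ?\<psi> x \<noteq> 0})"
    by (rule compact_closure_of_bounded[OF n kap_pos[OF n]]) auto
  show ?thesis unfolding DK_def by (rule CollectI, rule conjI, rule ballI, erule 1, rule 2)
qed

text \<open>\<open>DKBar\<close> without the support condition. Constants belong to this class and
  it is closed under all pointwise operations; compact support is restored by truncation only at the
  end.\<close>

definition cyl_const :: "((nat \<Rightarrow> 'a) \<Rightarrow> complex) \<Rightarrow> bool" where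
  "cyl_const f \<longleftrightarrow> (\<exists>n\<ge>1. \<exists>\<phi>. loc_const n \<phi> \<and> (\<forall>x\<in>KB. f x = \<phi> (x n)))"

lemma cyl_const_lift:
  assumes n: "1 \<le> n" "n \<le> m" and \<phi>: "loc_const n \<phi>" "\<forall>x\<in>KB. f x = \<phi> (x n)"
  shows "\<exists>\<psi>. loc_const m \<psi> \<and> (\<forall>x\<in>KB. f x = \<psi> (x m))"
proof (cases "n = m")
  case False
  then have nm: "n < m" using n by simp
  have "f x = \<phi> (T n m (x m))" if x: "x \<in> KB" for x
    using \<phi>(2) x KB_D(3)[OF x n(1) nm] by simp
  then show ?thesis using loc_const_lift[OF n \<phi>(1)] by blast
qed (use \<phi> in blast)

text \<open>Functions of different coordinates are rewritten as functions of the higher one by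
  composing with the continuous map \<open>T n m\<close>.\<close>

lemma cyl_const_combine:
  assumes f: "cyl_const f" and g: "cyl_const g"
  shows "cyl_const (\<lambda>x. h (f x) (g x))"
proof -
  obtain n \<phi> where 1: "1 \<le> n" "loc_const n \<phi>" "\<forall>x\<in>KB. f x = \<phi> (x n)" using f unfolding cyl_const_def by blast
  obtain m \<psi> where 2: "1 \<le> m" "loc_const m \<psi>" "\<forall>x\<in>KB. g x = \<psi> (x m)" using g unfolding cyl_const_def by blast
  obtain \<phi>' where p: "loc_const (max n m) \<phi>'" "\<forall>x\<in>KB. f x = \<phi>' (x (max n m))"
    using cyl_const_lift[OF 1(1) _ 1(2,3), of "max n m"] by auto
  obtain \<psi>' where r: "loc_const (max n m) \<psi>'" "\<forall>x\<in>KB. g x = \<psi>' (x (max n m))"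
    using cyl_const_lift[OF 2(1) _ 2(2,3), of "max n m"] by auto
  have "loc_const (max n m) (\<lambda>z. h (\<phi>' z) (\<psi>' z))" by (rule loc_const_combine[OF p(1) r(1)])
  moreover have "\<forall>x\<in>KB. h (f x) (g x) = (\<lambda>z. h (\<phi>' z) (\<psi>' z)) (x (max n m))" using p(2) r(2) by simp
  moreover have "1 \<le> max n m" using 1(1) by simp
  ultimately show ?thesis unfolding cyl_const_def by blast
qed

lemma cyl_const_const: "cyl_const (\<lambda>_. c)"
  unfolding cyl_const_def by (intro exI[of _ 1] conjI exI[of _ "\<lambda>_. c"] loc_const_const) auto

lemma cyl_const_indicator:
  assumes n: "1 \<le> n" and c: "c \<in> K n" and r: "0 < r"
  shows "cyl_const (indicator (cyl n c r))"
  unfolding cyl_const_def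
  by (intro exI[of _ n] conjI n exI[of _ "\<lambda>z. if N (z - c) \<le> r then 1 else 0"] loc_const_ball[OF n c r])
    (simp add: cyl_def indicator_def)

end

text \<open>A crude substitute for Minkowski's inequality: the constant is harmless because only
  smallness of distances is at stake.\<close>

lemma powr_norm_add_le:
  fixes a b :: complex
  assumes s: "0 \<le> s"
  shows "cmod (a + b) powr s \<le> 2 powr s * (cmod a powr s + cmod b powr s)"
proof -
  let ?M = "max (cmod a) (cmod b)"
  have "cmod (a + b) \<le> 2 * ?M" using norm_triangle_ineq[of a b] by simp
  then have "cmod (a + b) powr s \<le> (2 * ?M) powr s" using s by (intro powr_mono2) auto
  also have "\<dots> = 2 powr s * ?M powr s" by (rule powr_mult)
  also have "?M powr s \<le> cmod a powr s + cmod b powr s" by (auto simp: max_def)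
  finally show ?thesis by simp
qed

context kbar_measure
begin

lemma cyl_const_measurable:
  assumes f: "cyl_const f"
  shows "f \<in> borel_measurable \<mu>"
proof -
  obtain n \<phi> where n: "1 \<le> n" "loc_const n \<phi>" "\<forall>x\<in>KB. f x = \<phi> (x n)" using f unfolding cyl_const_def by blast
  show ?thesis
  proof (rule measurable_coordinate_continuous[OF n(1)])
    fix y and e :: real assume y: "y \<in> KB" and e: "0 < e"
    obtain r where r: "0 < r" "\<And>z. z \<in> K n \<Longrightarrow> N (z - y n) < r \<Longrightarrow> \<phi> z = \<phi> (y n)"
      using loc_constD[OF n(2) KB_D(2)[OF y n(1)]] by blast
    have "dist (f z) (f y) < e" if z: "z \<in> KB" "N (z n - y n) < r" for z
      using r(2)[OF KB_D(2)[OF z(1) n(1)] z(2)] n(3) y z(1) e by simp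
    then show "\<exists>\<delta>>0. \<forall>z\<in>KB. N (z n - y n) < \<delta> \<longrightarrow> dist (f z) (f y) < e" using r(1) by blast
  qed
qed

lemma cyl_const_AE_DKBar:
  assumes f: "cyl_const f"
  shows "\<exists>g\<in>DKBar abs1 K. g \<in> borel_measurable \<mu> \<and> (AE x in \<mu>. f x = g x)"
proof -
  obtain n \<phi> where n: "1 \<le> n" "loc_const n \<phi>" "\<forall>x\<in>KB. f x = \<phi> (x n)" using f unfolding cyl_const_def by blast
  let ?\<psi> = "\<lambda>z. if N z \<le> kap n then \<phi> z else 0"
  let ?g = "\<lambda>x. ?\<psi> (x n)"
  have 1: "?g \<in> DKBar abs1 K"
    unfolding DKBar_def by (intro CollectI exI[of _ n] conjI n(1) bexI[OF _ truncation_DK[OF n(1,2)]]) simp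
  have "loc_const n (\<lambda>z. (\<lambda>a b. b * a) (\<phi> z) (if N (z - 0) \<le> kap n then 1 else 0))"
    by (rule loc_const_combine[OF n(2) loc_const_ball[OF n(1) subfield_closed(1)[OF K_sub[OF n(1)]] kap_pos[OF n(1)]]])
  then have "loc_const n ?\<psi>" by (simp add: if_distrib[of "\<lambda>t. t * _"] cong: if_cong)
  then have "cyl_const ?g" unfolding cyl_const_def by (intro exI[of _ n] conjI n(1) exI[of _ ?\<psi>]) simp_all
  then have 2: "?g \<in> borel_measurable \<mu>" by (rule cyl_const_measurable)
  have 3: "AE x in \<mu>. f x = ?g x" using AE_le_kap[OF n(1)]
    by (rule AE_mp) (use n(3) in \<open>auto intro!: AE_I2 simp: space_mu\<close>)
  show ?thesis by (rule bexI[OF _ 1], rule conjI[OF 2 3])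
qed

section \<open>Approximation in the space \<open>L_s\<close>\<close>

context
  fixes s :: real
  assumes s: "1 \<le> s"
begin

text \<open>The \<open>s\<close>-th power of the \<open>L_s\<close> norm; leaving out the root does
  not change which distances are small.\<close>

definition Ls :: "((nat \<Rightarrow> 'a) \<Rightarrow> complex) \<Rightarrow> ennreal" where
  "Ls f = (\<integral>\<^sup>+ x. ennreal (cmod (f x) powr s) \<partial>\<mu>)"

definition approximable :: "((nat \<Rightarrow> 'a) \<Rightarrow> complex) \<Rightarrow> bool" where
  "approximable f \<longleftrightarrow> f \<in> borel_measurable \<mu> \<and>
     (\<forall>\<epsilon>>0. \<exists>g. cyl_const g \<and> Ls (\<lambda>x. f x - g x) < ennreal \<epsilon>)"

lemma approximable_measurable: "approximable f \<Longrightarrow> f \<in> borel_measurable \<mu>"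
  by (simp add: approximable_def)

lemma Ls_add:
  assumes [measurable]: "f \<in> borel_measurable \<mu>" "g \<in> borel_measurable \<mu>"
  shows "Ls (\<lambda>x. f x + g x) \<le> ennreal (2 powr s) * (Ls f + Ls g)"
proof -
  have "Ls (\<lambda>x. f x + g x) \<le> (\<integral>\<^sup>+ x. ennreal (2 powr s) * (ennreal (cmod (f x) powr s) + ennreal (cmod (g x) powr s)) \<partial>\<mu>)"
    unfolding Ls_def
  proof (rule nn_integral_mono)
    fix x
    have "ennreal (cmod (f x + g x) powr s) \<le> ennreal (2 powr s * (cmod (f x) powr s + cmod (g x) powr s))"
      using powr_norm_add_le[of s] s by (intro ennreal_leI) simp
    then show "ennreal (cmod (f x + g x) powr s) \<le> ennreal (2 powr s) * (ennreal (cmod (f x) powr s) + ennreal (cmod (g x) powr s))"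
      by (simp add: ennreal_mult ennreal_plus[symmetric] del: ennreal_plus)
  qed
  also have "\<dots> = ennreal (2 powr s) * (Ls f + Ls g)"
    unfolding Ls_def by (subst nn_integral_cmult) (simp_all add: nn_integral_add)
  finally show ?thesis .
qed

text \<open>The denominator absorbs the constant \<open>2 powr s\<close> and the two summands,
  leaving half of \<open>\<epsilon>\<close> so that the final inequality is strict.\<close>

lemma Ls_add_lt:
  assumes m: "f \<in> borel_measurable \<mu>" "g \<in> borel_measurable \<mu>" and e: "0 < \<epsilon>"
    and "Ls f < ennreal (\<epsilon> / (4 * 2 powr s))" "Ls g < ennreal (\<epsilon> / (4 * 2 powr s))"
  shows "Ls (\<lambda>x. f x + g x) < ennreal \<epsilon>"
proof -
  let ?d = "\<epsilon> / (4 * 2 powr s)"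
  have d: "0 \<le> ?d" using e by simp
  have "Ls (\<lambda>x. f x + g x) \<le> ennreal (2 powr s) * (Ls f + Ls g)" by (rule Ls_add[OF m])
  also have "\<dots> \<le> ennreal (2 powr s) * (ennreal ?d + ennreal ?d)"
    using assms(4,5) by (intro mult_left_mono add_mono) auto
  also have "\<dots> = ennreal (2 powr s) * ennreal (?d + ?d)" by (simp only: ennreal_plus[OF d d])
  also have "\<dots> = ennreal (2 powr s * (?d + ?d))" by (rule ennreal_mult[symmetric]) (use e in auto)
  also have "2 powr s * (?d + ?d) = \<epsilon> / 2" by simp
  also have "ennreal (\<epsilon> / 2) < ennreal \<epsilon>" using e by (simp add: ennreal_lessI)
  finally show ?thesis .
qed

lemma approximable_add:
  assumes f: "approximable f" and g: "approximable g"
  shows "approximable (\<lambda>x. f x + g x)"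
  unfolding approximable_def
proof (intro conjI allI impI)
  note [measurable] = approximable_measurable[OF f] approximable_measurable[OF g]
  show "(\<lambda>x. f x + g x) \<in> borel_measurable \<mu>" by simp
  fix \<epsilon> :: real assume e: "0 < \<epsilon>"
  then have "0 < \<epsilon> / (4 * 2 powr s)" by simp
  then obtain f' g' where f': "cyl_const f'" "Ls (\<lambda>x. f x - f' x) < ennreal (\<epsilon> / (4 * 2 powr s))"
    and g': "cyl_const g'" "Ls (\<lambda>x. g x - g' x) < ennreal (\<epsilon> / (4 * 2 powr s))"
    using f g unfolding approximable_def by meson
  note [measurable] = cyl_const_measurable[OF f'(1)] cyl_const_measurable[OF g'(1)]
  have "Ls (\<lambda>x. (f x - f' x) + (g x - g' x)) < ennreal \<epsilon>"
    by (rule Ls_add_lt[OF _ _ e f'(2) g'(2)]) simp_all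
  moreover have "(\<lambda>x. (f x - f' x) + (g x - g' x)) = (\<lambda>x. (f x + g x) - (f' x + g' x))" by (simp add: fun_eq_iff)
  ultimately show "\<exists>h. cyl_const h \<and> Ls (\<lambda>x. (f x + g x) - h x) < ennreal \<epsilon>"
    using cyl_const_combine[OF f'(1) g'(1), of "(+)"] by (intro exI[of _ "\<lambda>x. f' x + g' x"]) simp
qed

lemma approximable_cyl_const: "cyl_const f \<Longrightarrow> approximable f"
  unfolding approximable_def using cyl_const_measurable
  by (auto intro!: exI[of _ f] simp: Ls_def)

lemma approximable_scale:
  assumes f: "approximable f"
  shows "approximable (\<lambda>x. c * f x)"
  unfolding approximable_def
proof (intro conjI allI impI)
  note [measurable] = approximable_measurable[OF f]
  show "(\<lambda>x. c * f x) \<in> borel_measurable \<mu>" by simp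
  fix \<epsilon> :: real assume e: "0 < \<epsilon>"
  let ?d = "\<epsilon> / (cmod c powr s + 1)"
  have c: "0 < cmod c powr s + 1" by (simp add: add_nonneg_pos)
  then have d: "0 < ?d" using e by simp
  then obtain g where g: "cyl_const g" "Ls (\<lambda>x. f x - g x) < ennreal ?d" using f unfolding approximable_def by blast
  note [measurable] = cyl_const_measurable[OF g(1)]
  have "Ls (\<lambda>x. c * f x - c * g x) = (\<integral>\<^sup>+ x. ennreal (cmod c powr s) * ennreal (cmod (f x - g x) powr s) \<partial>\<mu>)"
    unfolding Ls_def by (intro nn_integral_cong)
      (simp add: right_diff_distrib[symmetric] norm_mult powr_mult ennreal_mult)
  also have "\<dots> = ennreal (cmod c powr s) * Ls (\<lambda>x. f x - g x)"
    unfolding Ls_def by (subst nn_integral_cmult) simp_all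
  also have "\<dots> \<le> ennreal (cmod c powr s) * ennreal ?d" using g(2) by (intro mult_left_mono) auto
  also have "\<dots> = ennreal (cmod c powr s * ?d)"
    by (rule ennreal_mult[symmetric]) (use d in auto)
  also have "\<dots> < ennreal \<epsilon>"
  proof (rule ennreal_lessI[OF e])
    show "cmod c powr s * ?d < \<epsilon>" using e c by (simp add: field_simps)
  qed
  finally show "\<exists>h. cyl_const h \<and> Ls (\<lambda>x. c * f x - h x) < ennreal \<epsilon>"
    using cyl_const_combine[OF cyl_const_const[of c] g(1), of "(*)"] by (intro exI[of _ "\<lambda>x. c * g x"]) simp
qed

lemma approximable_limit:
  assumes f: "f \<in> borel_measurable \<mu>"
    and lim: "\<And>\<epsilon>. 0 < \<epsilon> \<Longrightarrow> \<exists>h. approximable h \<and> Ls (\<lambda>x. f x - h x) < ennreal \<epsilon>"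
  shows "approximable f"
  unfolding approximable_def
proof (intro conjI allI impI f)
  note [measurable] = f
  fix \<epsilon> :: real assume e: "0 < \<epsilon>"
  then have d: "0 < \<epsilon> / (4 * 2 powr s)" by simp
  obtain h where h: "approximable h" "Ls (\<lambda>x. f x - h x) < ennreal (\<epsilon> / (4 * 2 powr s))" using lim[OF d] by blast
  obtain g where g: "cyl_const g" "Ls (\<lambda>x. h x - g x) < ennreal (\<epsilon> / (4 * 2 powr s))"
    using h(1) d unfolding approximable_def by blast
  note [measurable] = cyl_const_measurable[OF g(1)] approximable_measurable[OF h(1)]
  have "Ls (\<lambda>x. (f x - h x) + (h x - g x)) < ennreal \<epsilon>"
    by (rule Ls_add_lt[OF _ _ e h(2) g(2)]) simp_all
  then show "\<exists>g. cyl_const g \<and> Ls (\<lambda>x. f x - g x) < ennreal \<epsilon>" using g(1) by (intro exI[of _ g]) simp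
qed

lemma approximable_cong:
  assumes f: "approximable f" and eq: "\<And>x. x \<in> space \<mu> \<Longrightarrow> g x = f x"
  shows "approximable g"
proof -
  have "g \<in> borel_measurable \<mu>" using approximable_measurable[OF f] measurable_cong[of \<mu> g f] eq by blast
  moreover have "Ls (\<lambda>x. g x - h x) = Ls (\<lambda>x. f x - h x)" for h
    unfolding Ls_def using eq by (intro nn_integral_cong) simp
  ultimately show ?thesis using f unfolding approximable_def by simp
qed

text \<open>Induction over the sigma-algebra generated by a family closed under intersection. Only
  disjoint unions have to be handled, for which indicators add up.\<close>

lemma approximable_indicator:
  assumes A: "A \<in> sets \<mu>"
  shows "approximable (indicator A)"
  using cyls_Int_stable cyls_Pow A[unfolded sets_mu]
proof (induction rule: sigma_sets_induct_disjoint)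
  case (basic C)
  then consider "C = {}" | i c where "C = cyl i c (rad i)" "1 \<le> i" "c \<in> K i" by (auto simp: cyls_def)
  then show ?case
  proof cases
    case 1
    show ?thesis unfolding 1 by (rule approximable_cong[OF approximable_cyl_const[OF cyl_const_const[of 0]]]) simp
  next
    case (2 i c)
    show ?thesis unfolding 2(1) by (intro approximable_cyl_const cyl_const_indicator 2(2,3) rad_pos)
  qed
next
  case empty
  show ?case by (rule approximable_cong[OF approximable_cyl_const[OF cyl_const_const[of 0]]]) simp
next
  case (compl A)
  have "approximable (\<lambda>x. 1 + (- 1) * indicator A x)"
    by (intro approximable_add approximable_scale compl approximable_cyl_const cyl_const_const)
  then show ?case by (rule approximable_cong) (simp add: space_mu indicator_def)
next
  case (union A)
  have As: "A i \<in> sets \<mu>" for i using union(2) sets_mu by auto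
  let ?B = "\<lambda>n. \<Union>i<n. A i" and ?U = "\<Union>i. A i"
  have Bs: "?B n \<in> sets \<mu>" and Us: "?U \<in> sets \<mu>" for n using As by auto
  have appB: "approximable (indicator (?B n))" for n
  proof (induction n)
    case 0
    show ?case by (rule approximable_cong[OF approximable_cyl_const[OF cyl_const_const[of 0]]]) simp
  next
    case (Suc n)
    have "approximable (\<lambda>x. indicator (?B n) x + indicator (A n) x)"
      by (intro approximable_add Suc union(3))
    moreover have "indicator (?B (Suc n)) x = indicator (?B n) x + (indicator (A n) x :: complex)" for x
    proof -
      have "A i \<inter> A n = {}" if "i < n" for i
        using disjoint_family_onD[OF union(1), of i n] that by simp
      then show ?thesis by (auto simp: indicator_def lessThan_Suc)
    qed
    ultimately show ?case by (rule approximable_cong)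
  qed
  show ?case
  proof (rule approximable_limit)
    show "indicator ?U \<in> borel_measurable \<mu>" using Us by simp
    fix \<epsilon> :: real assume e: "0 < \<epsilon>"
    have "(\<lambda>n. measure \<mu> (?B n)) \<longlonglongrightarrow> measure \<mu> (\<Union>n. ?B n)"
      by (rule finite_Lim_measure_incseq) (use Bs in \<open>auto simp: incseq_def intro: order.strict_trans2\<close>)
    also have "(\<Union>n. ?B n) = ?U" by auto
    finally have lim: "(\<lambda>n. measure \<mu> (?B n)) \<longlonglongrightarrow> measure \<mu> ?U" .
    have "eventually (\<lambda>n. measure \<mu> ?U - \<epsilon> < measure \<mu> (?B n)) sequentially"
      by (rule order_tendstoD(1)[OF lim]) (use e in simp)
    then obtain n where n: "measure \<mu> ?U - \<epsilon> < measure \<mu> (?B n)" by (auto simp: eventually_sequentially)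
    \<comment> \<open>The difference of the two indicators takes only the values 0 and 1, so raising
      it to the power \<open>s\<close> changes nothing and its integral is a measure.\<close>
    have "Ls (\<lambda>x. indicator ?U x - indicator (?B n) x) = (\<integral>\<^sup>+ x. indicator (?U - ?B n) x \<partial>\<mu>)"
      unfolding Ls_def using s by (intro nn_integral_cong) (auto simp: indicator_def)
    also have "\<dots> = emeasure \<mu> (?U - ?B n)" using Us Bs by simp
    also have "\<dots> = ennreal (measure \<mu> ?U - measure \<mu> (?B n))"
    proof -
      have "?B n \<subseteq> ?U" by auto
      from finite_measure_Diff[OF Us Bs this] show ?thesis by (simp only: emeasure_eq_measure)
    qed
    also have "\<dots> < ennreal \<epsilon>" using n e by (intro ennreal_lessI) auto
    finally show "\<exists>h. approximable h \<and> Ls (\<lambda>x. indicator ?U x - h x) < ennreal \<epsilon>" using appB by blast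
  qed
qed

lemma approximable_sum:
  assumes "finite I" "\<And>i. i \<in> I \<Longrightarrow> approximable (f i)"
  shows "approximable (\<lambda>x. \<Sum>i\<in>I. f i x)"
  using assms
proof (induction I rule: finite_induct)
  case empty
  then show ?case using approximable_cyl_const[OF cyl_const_const[of 0]] by simp
next
  case (insert i I)
  then have "approximable (\<lambda>x. f i x + (\<Sum>i\<in>I. f i x))" by (intro approximable_add) auto
  then show ?case using insert(1,2) by simp
qed

lemma approximable_simple:
  assumes f: "simple_function \<mu> f"
  shows "approximable f"
proof -
  have fin: "finite (f ` space \<mu>)" and m: "\<And>y. f -` {y} \<inter> space \<mu> \<in> sets \<mu>"
    using f by (auto simp: simple_function_def intro: simple_functionD(2)[OF f])
  have "approximable (\<lambda>x. \<Sum>y\<in>f ` space \<mu>. y * indicator (f -` {y} \<inter> space \<mu>) x)"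
    by (intro approximable_sum fin approximable_scale approximable_indicator m)
  then show ?thesis
  proof (rule approximable_cong)
    fix x assume x: "x \<in> space \<mu>"
    have "(\<Sum>y\<in>f ` space \<mu>. y * indicator (f -` {y} \<inter> space \<mu>) x) = (\<Sum>y\<in>f ` space \<mu>. if y = f x then f x else 0)"
      using x by (intro sum.cong) (auto simp: indicator_def)
    also have "\<dots> = f x" using fin x by simp
    finally show "f x = (\<Sum>y\<in>f ` space \<mu>. y * indicator (f -` {y} \<inter> space \<mu>) x)" by simp
  qed
qed

text \<open>Dominated convergence along simple functions with modulus at most twice that of
  \<open>f\<close>; the difference is then at most three times \<open>f\<close> in modulus, which
  accounts for \<open>3 powr s\<close>.\<close>

lemma approximable_Ls:
  assumes f: "f \<in> borel_measurable \<mu>" and fin: "Ls f < \<infinity>"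
  shows "approximable f"
proof (rule approximable_limit[OF f])
  note [measurable] = f
  fix \<epsilon> :: real assume e: "0 < \<epsilon>"
  obtain F where F: "\<And>i. simple_function \<mu> (F i)" "\<And>x. x \<in> space \<mu> \<Longrightarrow> (\<lambda>i. F i x) \<longlonglongrightarrow> f x"
    "\<And>i x. x \<in> space \<mu> \<Longrightarrow> dist (F i x) 0 \<le> 2 * dist (f x) 0"
    using borel_measurable_implies_sequence_metric[OF f, of 0] by blast
  have [measurable]: "F i \<in> borel_measurable \<mu>" for i by (rule borel_measurable_simple_function[OF F(1)])
  let ?u = "\<lambda>i x. ennreal (cmod (f x - F i x) powr s)"
  let ?w = "\<lambda>x. ennreal (3 powr s) * ennreal (cmod (f x) powr s)"
  have "(\<lambda>i. \<integral>\<^sup>+ x. ?u i x \<partial>\<mu>) \<longlonglongrightarrow> (\<integral>\<^sup>+ x. 0 \<partial>\<mu>)"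
  proof (rule nn_integral_dominated_convergence[where w = ?w])
    show "AE x in \<mu>. ?u i x \<le> ?w x" for i
    proof (rule AE_I2)
      fix x assume x: "x \<in> space \<mu>"
      have "cmod (f x - F i x) \<le> cmod (f x) + cmod (F i x)" by (rule norm_triangle_ineq4)
      also have "\<dots> \<le> 3 * cmod (f x)" using F(3)[OF x, of i] by simp
      finally have "cmod (f x - F i x) powr s \<le> (3 * cmod (f x)) powr s" using s by (intro powr_mono2) auto
      also have "\<dots> = 3 powr s * cmod (f x) powr s" by (rule powr_mult)
      finally show "?u i x \<le> ?w x" by (simp add: ennreal_mult[symmetric] ennreal_leI)
    qed
    have "(\<integral>\<^sup>+ x. ?w x \<partial>\<mu>) = ennreal (3 powr s) * Ls f"
      unfolding Ls_def by (subst nn_integral_cmult) simp_all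
    then show "(\<integral>\<^sup>+ x. ?w x \<partial>\<mu>) < \<infinity>" using fin by (simp add: ennreal_mult_less_top)
    show "AE x in \<mu>. (\<lambda>i. ?u i x) \<longlonglongrightarrow> 0"
    proof (rule AE_I2)
      fix x assume x: "x \<in> space \<mu>"
      have "(\<lambda>i. f x - F i x) \<longlonglongrightarrow> f x - f x" by (intro tendsto_diff tendsto_const F(2)[OF x])
      then have "(\<lambda>i. cmod (f x - F i x)) \<longlonglongrightarrow> 0" by (simp add: tendsto_norm_zero)
      then have "(\<lambda>i. cmod (f x - F i x) powr s) \<longlonglongrightarrow> 0 powr s"
        using s by (intro tendsto_powr2) auto
      then have "(\<lambda>i. ennreal (cmod (f x - F i x) powr s)) \<longlonglongrightarrow> ennreal (0 powr s)" by (rule tendsto_ennrealI)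
      then show "(\<lambda>i. ?u i x) \<longlonglongrightarrow> 0" by simp
    qed
  qed simp_all
  then have "(\<lambda>i. Ls (\<lambda>x. f x - F i x)) \<longlonglongrightarrow> 0" by (simp add: Ls_def)
  then have "eventually (\<lambda>i. Ls (\<lambda>x. f x - F i x) < ennreal \<epsilon>) sequentially"
    using e by (intro order_tendstoD) auto
  then obtain i where "Ls (\<lambda>x. f x - F i x) < ennreal \<epsilon>" by (auto simp: eventually_sequentially)
  then show "\<exists>h. approximable h \<and> Ls (\<lambda>x. f x - h x) < ennreal \<epsilon>" using approximable_simple[OF F(1)] by blast
qed

text \<open>The approximant by a function of one coordinate may be exchanged for its truncation,
  since the two agree almost everywhere and the integral is unchanged.\<close>

theorem DKBar_dense:
  assumes f: "f \<in> borel_measurable \<mu>" "(\<integral>\<^sup>+ x. ennreal (cmod (f x) powr s) \<partial>\<mu>) < \<infinity>" and e: "0 < \<epsilon>"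
  shows "\<exists>g\<in>DKBar abs1 K. (\<integral>\<^sup>+ x. ennreal (cmod (f x - g x) powr s) \<partial>\<mu>) < ennreal \<epsilon>"
proof -
  have "approximable f" using approximable_Ls[OF f(1)] f(2) by (simp add: Ls_def)
  then obtain h where h: "cyl_const h" "Ls (\<lambda>x. f x - h x) < ennreal \<epsilon>"
    using e unfolding approximable_def by blast
  obtain g where g: "g \<in> DKBar abs1 K" "AE x in \<mu>. h x = g x" using cyl_const_AE_DKBar[OF h(1)] by blast
  have "(\<integral>\<^sup>+ x. ennreal (cmod (f x - g x) powr s) \<partial>\<mu>) = Ls (\<lambda>x. f x - h x)"
    unfolding Ls_def by (intro nn_integral_cong_AE) (use g(2) in \<open>eventually_elim, simp\<close>)
  then show ?thesis using h(2) by (intro bexI[OF _ g(1)]) (simp only:)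
qed

end

end

theorem theorem1:
  fixes abs1 :: "'a::field_char_0 \<Rightarrow> real" and K :: "nat \<Rightarrow> 'a set"
    and chr :: "'a \<Rightarrow> complex" and \<mu> :: "(nat \<Rightarrow> 'a) measure"
  assumes tower: "tower_setup abs1 K"
    and chi: "rank0_char abs1 (K 1) (qres abs1 K 1) chr"
    and prob: "prob_space \<mu>"
    and space: "space \<mu> = KBar K"
    and borel: "sets \<mu> = sigma_sets (KBar K) {U. openin (KBar_top abs1 K) U}"
    and radon: "radon_on (KBar_top abs1 K) \<mu>"
    and fourier: "\<forall>a\<in>Kunion K. (LINT x|\<mu>. chr (pairing K a x)) = Omega abs1 K a"
  shows "(Sset abs1 K \<in> sets \<mu> \<and> emeasure \<mu> (Sset abs1 K) = 1)
    \<and> (\<forall>y\<in>Sset abs1 K. \<forall>A\<in>sets \<mu>. emeasure \<mu> (shift y A) = emeasure \<mu> A)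
    \<and> (\<forall>y\<in>KBar K - Sset abs1 K. \<exists>B\<in>sets \<mu>. emeasure \<mu> B = 0 \<and>
          emeasure \<mu> (shift y (KBar K - B)) = 0)
    \<and> (\<forall>n\<ge>1. \<forall>a\<in>K n. \<forall>N::int. a \<noteq> 0 \<longrightarrow>
          absn abs1 K n a = real (qres abs1 K n) powr real_of_int N \<longrightarrow>
          esssup \<mu> (\<lambda>x. ereal (abs1 (pairing K a x))) =
            ereal (real (qres abs1 K 1) powr
              real_of_int (- \<lfloor>- real_of_int N / real (ram abs1 K n)\<rfloor>)))
    \<and> (\<forall>s::real. s \<ge> 1 \<longrightarrow> (\<forall>f::(nat \<Rightarrow> 'a) \<Rightarrow> complex.
          f \<in> borel_measurable \<mu> \<and> (\<integral>\<^sup>+ x. ennreal (cmod (f x) powr s) \<partial>\<mu>) < \<infinity> \<longrightarrow>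
          (\<forall>\<epsilon>>0. \<exists>g\<in>DKBar abs1 K. (\<integral>\<^sup>+ x. ennreal (cmod (f x - g x) powr s) \<partial>\<mu>) < ennreal \<epsilon>)))"
proof -
  interpret kbar_measure abs1 K chr \<mu>
    by (intro kbar_measure.intro tower.intro kbar_measure_axioms.intro tower chi prob space borel fourier)
  have singular: "\<forall>y\<in>KBar K - Sset abs1 K. \<exists>B\<in>sets \<mu>. emeasure \<mu> B = 0 \<and>
      emeasure \<mu> (shift y (KBar K - B)) = 0"
    using singular_shift by blast
  show ?thesis
    by (intro conjI Sset_full singular ballI allI impI shift_invariant esssup_pairing)
      (use DKBar_dense in auto)
qed

end
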